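(* Let $s\in\mathbb{R}$ and $p\in(0,\infty]$. Then $\dot{B}^{s,1/p}_{p,\infty}(\mathbb{R}^n)=\dot{B}^s_{\infty,\infty}(\mathbb{R}^n)$ with equivalent norms.
   Context: $\mathcal{S}(\mathbb{R}^n)$ is the Schwartz space; $\mathcal{S}_\infty(\mathbb{R}^n)$ is the subspace of all $\varphi\in\mathcal{S}(\mathbb{R}^n)$ with $\int_{\mathbb{R}^n}\varphi(x)x^\gamma\,dx=0$ for all multi-indices $\gamma$, with the topology inherited from $\mathcal{S}(\mathbb{R}^n)$; $\mathcal{S}'_\infty(\mathbb{R}^n)$ is its topological dual (equivalently, $\mathcal{S}'(\mathbb{R}^n)$ modulo polynomials). $\mathcal{Q}$ is the set of all dyadic cubes $Q_{jk}=2^{-j}([0,1)^n+k)$, $j\in\mathbb{Z}$, $k\in\mathbb{Z}^n$. For $P\in\mathcal{Q}$, $|P|$ is its Lebesgue measure, $\ell(P)$ its side-length and $j_P=-\log_2\ell(P)$. Convention: $1/p=0$ if $p=\infty$. Fix $\varphi\in\mathcal{S}(\mathbb{R}^n)$ with $\mathrm{supp}\,\widehat{\varphi}\subset\{\xi:1/2\le|\xi|\le2\}$ and $|\widehat{\varphi}(\xi)|\ge C>0$ when $3/5\le|\xi|\le5/3$. Put $\varphi_j(x)=2^{jn}\varphi(2^jx)$, $j\in\mathbb{Z}$. For $s\in\mathbb{R}$, $\tau\in[0,\infty)$ and $p\in(0,\infty]$, the Besov-type space $\dot{B}^{s,\tau}_{p,\infty}(\mathbb{R}^n)$ is the set of $f\in\mathcal{S}'_\infty(\mathbb{R}^n)$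 with $$\|f\|_{\dot{B}^{s,\tau}_{p,\infty}(\mathbb{R}^n)}=\sup_{P\in\mathcal{Q}}\frac1{|P|^{\tau}}\sup_{j\ge j_P}2^{js}\left[\int_P|\varphi_j\ast f(x)|^p\,dx\right]^{1/p}<\infty,$$ where for $p=\infty$ the $L^p(P)$ quasi-norm is replaced by the essential supremum over $P$. The classical homogeneous Besov space $\dot{B}^{s}_{\infty,\infty}(\mathbb{R}^n)$ consists of all $f\in\mathcal{S}'_\infty(\mathbb{R}^n)$ with $\sup_{j\in\mathbb{Z}}2^{js}\|\varphi_j\ast f\|_{L^\infty(\mathbb{R}^n)}<\infty$, this quantity being the norm. *)

theory Defs
  imports "HOL-Analysis.Analysis" "HOL-Probability.Essential_Supremum"
begin

section \<open>Schwartz functions and the topology of the Schwartz space\<close>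

definition partial_deriv :: "'n::finite \<Rightarrow> (real ^ 'n \<Rightarrow> complex) \<Rightarrow> real ^ 'n \<Rightarrow> complex" where
  "partial_deriv i f x = vector_derivative (\<lambda>t. f (x + t *\<^sub>R axis i 1)) (at 0)"

text \<open>
  A list of coordinate directions plays the part of the multi-index of a derivative.  On smooth
  functions the order of the directions is irrelevant, so that these are precisely the usual
  mixed partial derivatives.
\<close>

definition iter_partial_deriv :: "'n::finite list \<Rightarrow> (real ^ 'n \<Rightarrow> complex) \<Rightarrow> real ^ 'n \<Rightarrow> complex" where
  "iter_partial_deriv is f = foldr partial_deriv is f"

definition smooth :: "(real ^ 'n::finite \<Rightarrow> complex) \<Rightarrow> bool" where
  "smooth f \<longleftrightarrow> (\<forall>is. iter_partial_deriv is f differentiable_on UNIV)"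

definition schwartz_space :: "(real ^ 'n::finite \<Rightarrow> complex) set" where
  "schwartz_space = {f. smooth f \<and>
     (\<forall>N is. bdd_above (range (\<lambda>x. (1 + norm x) ^ N * norm (iter_partial_deriv is f x))))}"

definition schwartz_seminorm :: "nat \<Rightarrow> 'n::finite list \<Rightarrow> (real ^ 'n \<Rightarrow> complex) \<Rightarrow> real" where
  "schwartz_seminorm N is f = (SUP x. (1 + norm x) ^ N * norm (iter_partial_deriv is f x))"

text \<open>The open seminorm balls form a subbasis.\<close>

definition schwartz_topology :: "(real ^ 'n::finite \<Rightarrow> complex) topology" where
  "schwartz_topology = topology_generated_by
     {{g \<in> schwartz_space. schwartz_seminorm N is (\<lambda>x. g x - f x) < e} |f N is e.
        f \<in> schwartz_space \<and> 0 < e}"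

definition schwartz_infty :: "(real ^ 'n::finite \<Rightarrow> complex) set" where
  "schwartz_infty = {\<phi> \<in> schwartz_space.
     \<forall>\<gamma> :: 'n \<Rightarrow> nat. (LINT x|lborel. \<phi> x * of_real (\<Prod>i\<in>UNIV. x $ i ^ \<gamma> i)) = 0}"

definition schwartz_infty_topology :: "(real ^ 'n::finite \<Rightarrow> complex) topology" where
  "schwartz_infty_topology = subtopology schwartz_topology schwartz_infty"

text \<open>
  Extensionality makes equality of functionals coincide with equality on the space
  \<^term>\<open>schwartz_infty\<close> on which they are defined.
\<close>

definition schwartz_infty_dual :: "((real ^ 'n::finite \<Rightarrow> complex) \<Rightarrow> complex) set" where
  "schwartz_infty_dual = {f \<in> extensional schwartz_infty.
     (\<forall>\<phi>\<in>schwartz_infty. \<forall>\<psi>\<in>schwartz_infty. f (\<lambda>x. \<phi> x + \<psi> x) = f \<phi> + f \<psi>) \<and>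
     (\<forall>c. \<forall>\<phi>\<in>schwartz_infty. f (\<lambda>x. c * \<phi> x) = c * f \<phi>) \<and>
     continuous_map schwartz_infty_topology euclidean f}"

section \<open>Littlewood--Paley pieces\<close>

definition fourier :: "(real ^ 'n::finite \<Rightarrow> complex) \<Rightarrow> real ^ 'n \<Rightarrow> complex" where
  "fourier \<phi> \<xi> = (LINT x|lborel. exp (- \<i> * of_real (x \<bullet> \<xi>)) * \<phi> x)"

definition littlewood_paley :: "(real ^ 'n::finite \<Rightarrow> complex) \<Rightarrow> bool" where
  "littlewood_paley \<phi> \<longleftrightarrow> \<phi> \<in> schwartz_space \<and>
     closure {\<xi>. fourier \<phi> \<xi> \<noteq> 0} \<subseteq> {\<xi>. 1/2 \<le> norm \<xi> \<and> norm \<xi> \<le> 2} \<and>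
     (\<exists>C>0. \<forall>\<xi>. 3/5 \<le> norm \<xi> \<and> norm \<xi> \<le> 5/3 \<longrightarrow> C \<le> norm (fourier \<phi> \<xi>))"

definition dilate :: "int \<Rightarrow> (real ^ 'n::finite \<Rightarrow> complex) \<Rightarrow> real ^ 'n \<Rightarrow> complex" where
  "dilate j \<phi> x = of_real (2 powi (j * int CARD('n))) * \<phi> ((2 powi j) *\<^sub>R x)"

text \<open>
  Convolution of a test function with a functional: \<open>(\<phi> * f)(x) = f(\<phi>(x - \<cdot>))\<close>.  It is only meant
  for \<open>\<phi>\<close> whose reflected translates lie in \<^term>\<open>schwartz_infty\<close>, as do those of the dilates of
  a function whose Fourier transform vanishes near the origin.
\<close>

definition conv :: "(real ^ 'n::finite \<Rightarrow> complex) \<Rightarrow> ((real ^ 'n \<Rightarrow> complex) \<Rightarrow> complex)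
    \<Rightarrow> real ^ 'n \<Rightarrow> complex" where
  "conv \<phi> f x = f (\<lambda>y. \<phi> (x - y))"

section \<open>Dyadic cubes\<close>

definition dyadic_cube :: "int \<Rightarrow> int ^ 'n::finite \<Rightarrow> (real ^ 'n) set" where
  "dyadic_cube j k =
     (\<lambda>x. (2 powi (- j)) *\<^sub>R (x + (\<chi> i. of_int (k $ i)))) ` {x. \<forall>i. 0 \<le> x $ i \<and> x $ i < 1}"

definition dyadic_cubes :: "(real ^ 'n::finite) set set" where
  "dyadic_cubes = {dyadic_cube j k |j k. True}"

definition side_length :: "(real ^ 'n::finite) set \<Rightarrow> real" where
  "side_length P = (THE l. \<exists>j k. P = dyadic_cube j k \<and> l = 2 powi (- j))"

definition dyadic_level :: "(real ^ 'n::finite) set \<Rightarrow> real" where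
  "dyadic_level P = - log 2 (side_length P)"

lemma mem_dyadic_cube:
  "x \<in> dyadic_cube j k \<longleftrightarrow>
     (\<forall>i. 2 powi (- j) * of_int (k $ i) \<le> x $ i \<and> x $ i < 2 powi (- j) * (of_int (k $ i) + 1))"
  (is "?L \<longleftrightarrow> ?R")
proof
  assume ?L
  then show ?R
    by (auto simp: dyadic_cube_def)
next
  assume R: ?R
  define y :: "real ^ 'a" where "y = (2 powi j) *\<^sub>R x - (\<chi> i. of_int (k $ i))"
  have inv: "2 powi j * (2 powi (- j) :: real) = 1"
    by (simp add: power_int_minus)
  have scale: "2 powi j * (2 powi (- j) * t) = t" for t :: real
    using inv by (metis mult.assoc mult_1)
  have "0 \<le> y $ i \<and> y $ i < 1" for i
  proof -
    have "2 powi j * (2 powi (- j) * of_int (k $ i)) \<le> 2 powi j * x $ i"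
      using R by (intro mult_left_mono) auto
    moreover have "2 powi j * x $ i < 2 powi j * (2 powi (- j) * (of_int (k $ i) + 1))"
      using R by (intro mult_strict_left_mono) auto
    ultimately show ?thesis
      unfolding scale by (simp add: y_def)
  qed
  moreover have "x = (2 powi (- j)) *\<^sub>R (y + (\<chi> i. of_int (k $ i)))"
    using inv by (simp add: y_def mult.commute)
  ultimately show ?L
    unfolding dyadic_cube_def by blast
qed

lemma dyadic_cube_level_inj:
  fixes k l :: "int ^ 'n::finite"
  assumes "dyadic_cube i k = dyadic_cube j l"
  shows "i = j"
proof -
  have *: "2 powi (- j) \<le> (2 powi (- i) :: real)"
    if sub: "dyadic_cube j l \<subseteq> dyadic_cube i k" for i j and k l :: "int ^ 'n"
  proof (rule ccontr)
    fix m :: 'n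
    define a b where "a = (2 powi (- i) :: real)" and "b = (2 powi (- j) :: real)"
    assume "\<not> 2 powi (- j) \<le> (2 powi (- i) :: real)"
    then have ab: "a < b" and pos: "0 < a" by (auto simp: a_def b_def)
    have "(\<chi> n. b * of_int (l $ n)) \<in> dyadic_cube j l"
      using pos ab by (auto simp: mem_dyadic_cube b_def[symmetric])
    moreover have "(\<chi> n. b * of_int (l $ n) + a) \<in> dyadic_cube j l"
      using pos ab by (auto simp: mem_dyadic_cube b_def[symmetric] distrib_left)
    ultimately have
      "(\<chi> n. b * of_int (l $ n)) \<in> dyadic_cube i k"
      "(\<chi> n. b * of_int (l $ n) + a) \<in> dyadic_cube i k"
      using sub by auto
    then have "a * of_int (k $ m) \<le> b * of_int (l $ m)"
      "b * of_int (l $ m) + a < a * (of_int (k $ m) + 1)"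
      by (auto simp: mem_dyadic_cube a_def[symmetric])
    then show False by (simp add: distrib_left)
  qed
  have "(2 powi (- i) :: real) = 2 powi (- j)"
    using *[of j l i k] *[of i k j l] assms by auto
  then show ?thesis
    using powr_inj[of 2 "of_int (- i)" "of_int (- j)"]
    by (simp add: powr_real_of_int' del: of_int_minus)
qed

lemma side_length_dyadic_cube: "side_length (dyadic_cube j k) = 2 powi (- j)"
  unfolding side_length_def by (rule the_equality) (auto dest: dyadic_cube_level_inj)

lemma dyadic_level_dyadic_cube: "dyadic_level (dyadic_cube j k) = of_int j"
  by (simp add: dyadic_level_def side_length_dyadic_cube flip: powr_real_of_int')

section \<open>Besov-type and Besov spaces\<close>

text \<open>The quasi-norm of \<open>L\<^sup>p(A)\<close> for \<open>0 < p \<le> \<infinity>\<close>.\<close>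

definition lp_norm :: "ennreal \<Rightarrow> (real ^ 'n::finite) set \<Rightarrow> (real ^ 'n \<Rightarrow> complex) \<Rightarrow> ennreal" where
  "lp_norm p A g =
     (if p = \<infinity> then esssup (restrict_space lborel A) (\<lambda>x. ennreal (norm (g x)))
      else let I = (\<integral>\<^sup>+x\<in>A. ennreal (norm (g x) powr enn2real p) \<partial>lborel)
           in if I = \<infinity> then \<infinity> else ennreal (enn2real I powr (1 / enn2real p)))"

definition recip_exponent :: "ennreal \<Rightarrow> real" where
  "recip_exponent p = (if p = \<infinity> then 0 else 1 / enn2real p)"

definition besov_type_norm :: "(real ^ 'n::finite \<Rightarrow> complex) \<Rightarrow> real \<Rightarrow> real \<Rightarrow> ennreal
    \<Rightarrow> ((real ^ 'n \<Rightarrow> complex) \<Rightarrow> complex) \<Rightarrow> ennreal" where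
  "besov_type_norm \<phi> s \<tau> p f =
     (SUP P\<in>dyadic_cubes. ennreal (1 / measure lborel P powr \<tau>) *
        (SUP j\<in>{j. dyadic_level P \<le> real_of_int j}.
           ennreal (2 powr (real_of_int j * s)) * lp_norm p P (conv (dilate j \<phi>) f)))"

definition besov_type_space :: "(real ^ 'n::finite \<Rightarrow> complex) \<Rightarrow> real \<Rightarrow> real \<Rightarrow> ennreal
    \<Rightarrow> ((real ^ 'n \<Rightarrow> complex) \<Rightarrow> complex) set" where
  "besov_type_space \<phi> s \<tau> p = {f \<in> schwartz_infty_dual. besov_type_norm \<phi> s \<tau> p f < \<infinity>}"

definition besov_infty_norm :: "(real ^ 'n::finite \<Rightarrow> complex) \<Rightarrow> real
    \<Rightarrow> ((real ^ 'n \<Rightarrow> complex) \<Rightarrow> complex) \<Rightarrow> ennreal" where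
  "besov_infty_norm \<phi> s f =
     (SUP j. ennreal (2 powr (real_of_int j * s)) * lp_norm \<infinity> UNIV (conv (dilate j \<phi>) f))"

definition besov_infty_space :: "(real ^ 'n::finite \<Rightarrow> complex) \<Rightarrow> real
    \<Rightarrow> ((real ^ 'n \<Rightarrow> complex) \<Rightarrow> complex) set" where
  "besov_infty_space \<phi> s = {f \<in> schwartz_infty_dual. besov_infty_norm \<phi> s f < \<infinity>}"

end

theory Submission
  imports Defs "HOL-Probability.Sinc_Integral" "HOL-Real_Asymp.Real_Asymp"
begin

text \<open>
  Averages over cubes are bounded by suprema, so the point is the converse estimate for
  \<open>g = \<phi>\<^sub>j * f\<close>, which by scaling may be taken at unit frequency.  It suffices to find, for every
  point \<open>a\<close>, a ball of fixed radius on which \<open>4 \<bar>g\<bar> \<ge> \<bar>g a\<bar>\<close>: this settles all \<open>p > 0\<close> at once.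

  Let \<open>K\<close> be a power of a product of sinc functions centred at \<open>a\<close>, with spectrum in a small ball
  and decaying faster than \<open>g\<close> grows.  Then \<open>H = K g\<close> is bounded and has spectrum in the
  ball of radius 3.  There the translation symbol \<open>exp (i t x)\<close>, expanded in powers of \<open>sin (x/2)\<close>, gives
  an absolutely convergent series of finite differences for \<open>H (x + t e)\<close>, and hence a Bernstein type
  inequality \<open>\<bar>H z - H x\<bar> \<le> (exp (\<pi> \<bar>z - x\<bar>) - 1) sup \<bar>H\<bar>\<close> with constants independent of \<open>f\<close>.  So
  \<open>\<bar>H\<bar>\<close> stays large near a point where it almost attains its supremum, and \<open>\<bar>g\<bar> \<ge> \<bar>H\<bar>\<close> while
  \<open>g a = H a\<close>.
\<close>

text \<open>The obstacle is that \<open>f\<close> acts on test functions only, so neither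
  \<open>g\<close> nor \<open>H\<close> has a Fourier transform at hand and the series of
  differences cannot be derived for \<open>H\<close> directly. It is proved one level below: for
  fixed y, every derivative in y of the test function K(x) phi(x + c y), read as a function of the
  parameter x, is continuous, integrable and band-limited, and there the series is a statement about
  integrable functions. The remainders then tend to 0 in the finitely many Schwartz seminorms that
  control \<open>f\<close>, and continuity of \<open>f\<close> carries the series over to
  \<open>H\<close>. Translation by t e has the symbol exp(i t e.xi), which is recovered from
  sin(e.xi / 2) only while |e.xi| stays below pi. The spectrum of phi reaches radius 2; the gap
  between 2 and pi is the room for K. The order of decay of K depends on \<open>f\<close>, but its
  spectrum is kept small by widening K, so the radius 3 does not depend on \<open>f\<close>.\<close>

section \<open>The exponential as a power series in the sine\<close>

text \<open>
  The Taylor coefficients of \<open>exp (a arcsin w)\<close>; the recursion is the differential equation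
  \<open>(1 - w\<^sup>2) F'' - w F' = a\<^sup>2 F\<close>.
\<close>

fun exp_arcsin_coeff :: "complex \<Rightarrow> nat \<Rightarrow> complex" where
  "exp_arcsin_coeff a 0 = 1"
| "exp_arcsin_coeff a (Suc 0) = a"
| "exp_arcsin_coeff a (Suc (Suc m)) =
     (of_nat m ^ 2 + a ^ 2) / (of_nat (m + 1) * of_nat (m + 2)) * exp_arcsin_coeff a m"

text \<open>The triangle inequality bounds the factor \<open>m^2 + a^2\<close> of the recursion by
  \<open>m^2 + norm a ^ 2\<close>, so the coefficients for the real exponent \<open>norm a\<close>
  form a nonnegative majorant. The second conjunct records that this complex-valued majorant is
  real.\<close>

lemma norm_exp_arcsin_coeff_le:
  "norm (exp_arcsin_coeff a m) \<le> Re (exp_arcsin_coeff (of_real (norm a)) m) \<and>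
   Im (exp_arcsin_coeff (of_real (norm a)) m) = 0"
proof (induction a m rule: exp_arcsin_coeff.induct)
  case (3 a m)
  let ?b = "exp_arcsin_coeff (of_real (norm a))"
  define q where "q = (real m ^ 2 + norm a ^ 2) / (real (m + 1) * real (m + 2))"
  have qpos: "0 \<le> q" by (simp add: q_def)
  have eq: "?b (Suc (Suc m)) = of_real q * ?b m"
    by (simp add: q_def)
  have "norm (of_nat m ^ 2 + a ^ 2) \<le> real m ^ 2 + norm a ^ 2"
    by (rule order_trans[OF norm_triangle_ineq]) (simp add: norm_power)
  then have "norm ((of_nat m ^ 2 + a ^ 2) / (of_nat (m + 1) * of_nat (m + 2))) \<le> q"
    unfolding q_def norm_divide norm_mult norm_of_nat by (intro divide_right_mono) auto
  then have "norm (exp_arcsin_coeff a (Suc (Suc m))) \<le> q * Re (?b m)"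
    using 3 qpos by (simp only: exp_arcsin_coeff.simps norm_mult) (intro mult_mono, auto)
  then show ?case using 3 unfolding eq by simp
qed auto

text \<open>Once m reaches \<open>norm a ^ 2\<close>, the factor of the two-step recursion has
  modulus at most 1, so neither parity class can grow any further.\<close>

lemma exp_arcsin_coeff_bounded: "\<exists>B. \<forall>m. norm (exp_arcsin_coeff a m) \<le> B"
proof -
  let ?b = "\<lambda>m. norm (exp_arcsin_coeff a m)"
  obtain K :: nat where K: "norm a ^ 2 \<le> real K" using real_arch_simple by blast
  have step: "?b (Suc (Suc m)) \<le> ?b m" if "K \<le> m" for m
  proof -
    have "norm (of_nat m ^ 2 + a ^ 2) \<le> real m ^ 2 + norm a ^ 2"
      by (rule order_trans[OF norm_triangle_ineq]) (simp add: norm_power)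
    also have "\<dots> \<le> real m ^ 2 + real m" using K that by linarith
    also have "\<dots> \<le> real (m + 1) * real (m + 2)"
      by (simp add: power2_eq_square algebra_simps)
    finally have "norm ((of_nat m ^ 2 + a ^ 2) / (of_nat (m + 1) * of_nat (m + 2))) \<le> 1"
      unfolding norm_divide norm_mult norm_of_nat by (subst divide_le_eq_1_pos) auto
    then show ?thesis
      using mult_right_mono[of _ 1 "?b m"] by (simp only: exp_arcsin_coeff.simps norm_mult) simp
  qed
  \<comment> \<open>The recursion advances by two, so both starting indices \<open>K\<close> and
    \<open>K + 1\<close> have to be covered.\<close>
  define B where "B = Max (?b ` {..K + 1})"
  have "?b m \<le> B" for m
  proof (induction m rule: less_induct)
    case (less m)
    show ?case
    proof (cases "m \<le> K + 1")
      case True then show ?thesis by (auto simp: B_def)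
    next
      case False
      define l where "l = m - 2"
      have l: "m = Suc (Suc l)" "K \<le> l" using False by (simp_all add: l_def)
      then show ?thesis using step[of l] less[of l] by simp
    qed
  qed
  then show ?thesis by blast
qed

lemma summable_exp_arcsin_coeff:
  assumes "norm z < 1"
  shows "summable (\<lambda>m. exp_arcsin_coeff a m * z ^ m)"
proof -
  obtain B where B: "\<And>m. norm (exp_arcsin_coeff a m) \<le> B"
    using exp_arcsin_coeff_bounded by blast
  show ?thesis
  proof (rule summable_comparison_test')
    show "summable (\<lambda>m. B * norm z ^ m)"
      using assms by (intro summable_mult summable_geometric) auto
    show "norm (exp_arcsin_coeff a m * z ^ m) \<le> B * norm z ^ m" for m
      using B[of m] by (auto simp: norm_mult norm_power intro!: mult_right_mono)
  qed
qed

text \<open>Comparing coefficients shows that \<open>P 0\<close> solves the differential equation of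
  exp(a arcsin w) in the unit disc. The substitution w = sin y turns it into G'' = a^2 G with G(0) =
  1 and G'(0) = a. The bound on \<open>x\<close> keeps sin x inside the disc of convergence and x on
  the principal branch of arcsin.\<close>

lemma exp_arcsin_series:
  fixes x :: real
  assumes x: "\<bar>x\<bar> < pi / 2"
  shows "(\<lambda>m. exp_arcsin_coeff a m * of_real (sin x) ^ m) sums exp (a * of_real x)"
proof -
  let ?b = "exp_arcsin_coeff a"
  define P where "P d z = (\<Sum>m. (diffs ^^ d) ?b m * z ^ m)" for d and z :: complex
  have sm: "summable (\<lambda>m. (diffs ^^ d) ?b m * z ^ m)" if "norm z < 1" for d and z :: complex
    using that
  proof (induction d arbitrary: z)
    case 0 then show ?case by (simp add: summable_exp_arcsin_coeff)
  next
    case (Suc d)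
    show ?case using termdiff_converges[of z 1 "(diffs ^^ d) ?b"] Suc by auto
  qed
  have DP: "(P d has_field_derivative P (Suc d) z) (at z)" if z: "norm z < 1" for d z
  proof -
    obtain r where r: "norm z < r" "r < 1" using dense[OF z] by blast
    then have "norm z < norm (of_real r :: complex)" "norm (of_real r :: complex) < 1"
      using norm_ge_zero[of z] unfolding norm_of_real by linarith+
    with termdiffs_strong[OF sm[of "of_real r" d], of z] show ?thesis
      unfolding P_def[abs_def] by simp
  qed
  have ode: "(1 - z\<^sup>2) * P 2 z - z * P 1 z = a\<^sup>2 * P 0 z" if z: "norm z < 1" for z
  proof -
    have s0: "(\<lambda>m. ?b m * z ^ m) sums P 0 z"
      using sm[OF z, of 0] unfolding P_def by (simp add: summable_sums)
    have s1: "(\<lambda>m. of_nat (Suc m) * ?b (Suc m) * z ^ m) sums P 1 z"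
      using sm[OF z, of 1] unfolding P_def by (simp add: summable_sums diffs_def)
    have s2: "(\<lambda>m. of_nat (Suc m) * (of_nat (Suc (Suc m)) * ?b (Suc (Suc m))) * z ^ m) sums P 2 z"
      using sm[OF z, of 2] unfolding P_def by (simp add: summable_sums diffs_def numeral_2_eq_2)
    have "(\<lambda>m. z * (of_nat (Suc m) * ?b (Suc m) * z ^ m)) sums (z * P 1 z)"
      by (intro sums_mult s1)
    then have "(\<lambda>m. of_nat (Suc m) * ?b (Suc m) * z ^ Suc m) sums (z * P 1 z)"
      by (simp add: mult_ac)
    then have t1: "(\<lambda>m. of_nat m * ?b m * z ^ m) sums (z * P 1 z)"
      by (subst (asm) sums_Suc_iff) simp
    have "(\<lambda>m. z\<^sup>2 * (of_nat (Suc m) * (of_nat (Suc (Suc m)) * ?b (Suc (Suc m))) * z ^ m))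
        sums (z\<^sup>2 * P 2 z)"
      by (intro sums_mult s2)
    then have "(\<lambda>m. of_nat (Suc (Suc m)) * of_nat (Suc m) * ?b (Suc (Suc m)) * z ^ Suc (Suc m))
        sums (z\<^sup>2 * P 2 z)"
      by (simp add: power2_eq_square mult_ac del: exp_arcsin_coeff.simps)
    then have "(\<lambda>m. of_nat (Suc m) * of_nat m * ?b (Suc m) * z ^ Suc m) sums (z\<^sup>2 * P 2 z)"
      using sums_Suc_iff[of "\<lambda>m. of_nat (Suc m) * of_nat m * ?b (Suc m) * z ^ Suc m" "z\<^sup>2 * P 2 z"]
      by simp
    then have t2: "(\<lambda>m. of_nat m * (of_nat m - 1) * ?b m * z ^ m) sums (z\<^sup>2 * P 2 z)"
      using sums_Suc_iff[of "\<lambda>m. of_nat m * (of_nat m - 1) * ?b m * z ^ m" "z\<^sup>2 * P 2 z"]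
      by simp
    have rec: "of_nat (Suc m) * (of_nat (Suc (Suc m)) * ?b (Suc (Suc m))) = (of_nat m ^ 2 + a ^ 2) * ?b m" for m
      by (simp add: field_simps del: of_nat_Suc of_nat_add)
    have "(\<lambda>m. of_nat (Suc m) * (of_nat (Suc (Suc m)) * ?b (Suc (Suc m))) * z ^ m
          - of_nat m * (of_nat m - 1) * ?b m * z ^ m - of_nat m * ?b m * z ^ m)
        sums (P 2 z - z\<^sup>2 * P 2 z - z * P 1 z)"
      by (intro sums_diff s2 t2 t1)
    then have "(\<lambda>m. a\<^sup>2 * (?b m * z ^ m)) sums (P 2 z - z\<^sup>2 * P 2 z - z * P 1 z)"
      unfolding rec by (simp add: algebra_simps power2_eq_square)
    from sums_unique2[OF this sums_mult[OF s0]] show ?thesis by (simp add: algebra_simps)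
  qed
  define S where "S = {-(pi/2)<..<pi/2 :: real}"
  have sin1: "norm (of_real (sin y) :: complex) < 1" if "y \<in> S" for y
  proof -
    have "cos y > 0" using that by (auto simp: S_def intro!: cos_gt_zero_pi)
    then have "sin y ^ 2 < 1" using sin_cos_squared_add[of y] by (smt (verit) zero_less_power)
    then show ?thesis by (simp add: abs_square_less_1)
  qed
  define G where "G y = P 0 (of_real (sin y))" for y :: real
  define G' where "G' y = P 1 (of_real (sin y)) * of_real (cos y)" for y :: real
  have Dsin: "((\<lambda>y. of_real (sin y) :: complex) has_vector_derivative of_real (cos y)) (at y)" for y :: real
    by (rule has_vector_derivative_eq_rhs[OF has_vector_derivative_of_real[of sin]])
       (auto intro!: derivative_eq_intros simp flip: has_real_derivative_iff_has_vector_derivative)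
  have chain: "((\<lambda>y. P d (of_real (sin y))) has_vector_derivative
       of_real (cos y) * P (Suc d) (of_real (sin y))) (at y)" if "y \<in> S" for d y
    using field_vector_diff_chain_at[OF Dsin[of y] DP[OF sin1[OF that], of d]] by (simp add: o_def)
  have DG: "(G has_vector_derivative G' y) (at y)" if "y \<in> S" for y
    using chain[OF that, of 0] by (simp add: G_def[abs_def] G'_def mult.commute)
  have Dcos: "((\<lambda>y. of_real (cos y) :: complex) has_vector_derivative - of_real (sin y)) (at y)" for y :: real
    by (rule has_vector_derivative_eq_rhs[OF has_vector_derivative_of_real[of cos]])
       (auto intro!: derivative_eq_intros simp flip: has_real_derivative_iff_has_vector_derivative)
  have DG': "(G' has_vector_derivative a\<^sup>2 * G y) (at y)" if "y \<in> S" for y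
  proof -
    have "(G' has_vector_derivative
        P 1 (of_real (sin y)) * (- of_real (sin y)) +
        of_real (cos y) * P 2 (of_real (sin y)) * of_real (cos y)) (at y)"
      unfolding G'_def[abs_def]
      using has_vector_derivative_mult[OF chain[OF that, of 1] Dcos[of y]] by (simp add: numeral_2_eq_2)
    moreover have "P 1 (of_real (sin y)) * (- of_real (sin y)) +
        of_real (cos y) * P 2 (of_real (sin y)) * of_real (cos y) = a\<^sup>2 * G y"
    proof -
      have "(of_real (cos y) :: complex) * of_real (cos y) = 1 - (of_real (sin y))\<^sup>2"
        by (metis cos_squared_eq of_real_1 of_real_diff of_real_mult of_real_power power2_eq_square)
      then show ?thesis using ode[OF sin1[OF that]] unfolding G_def
        by (metis (no_types, opaque_lifting) ab_group_add_class.ab_diff_conv_add_uminus add.commute mult.assoc mult.commute mult_minus_right)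
    qed
    ultimately show ?thesis by simp
  qed
  have Dexp: "((\<lambda>y. exp (c * of_real y)) has_vector_derivative c * exp (c * of_real y)) (at y)" for c :: complex and y :: real
    by (rule has_vector_derivative_real_field) (auto intro!: derivative_eq_intros)
  have S0: "0 \<in> S" "convex S" "x \<in> S" using x by (auto simp: S_def)
  have P0: "P d 0 = (diffs ^^ d) ?b 0" for d
    unfolding P_def by (simp add: powser_zero)
  have P00: "P 0 0 = 1" "P (Suc 0) 0 = a" by (simp_all add: P0 diffs_def)
  \<comment> \<open>The operator d^2/dy^2 - a^2 factors: G' - a G is annihilated by d/dy + a and
    vanishes at 0, after which G itself is annihilated by d/dy - a. Two integrating factors thus
    replace a uniqueness theorem.\<close>
  have first: "G' y = a * G y" if "y \<in> S" for y
  proof -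
    have D: "((\<lambda>y. (G' y - a * G y) * exp (a * of_real y)) has_vector_derivative 0) (at y)" if "y \<in> S" for y
      by (rule has_vector_derivative_eq_rhs,
          rule has_vector_derivative_mult[OF has_vector_derivative_diff[OF DG'[OF that]
            has_vector_derivative_mult_right[OF DG[OF that], of a]] Dexp[of a]])
         (simp add: algebra_simps power2_eq_square)
    obtain k where "(G' y - a * G y) * exp (a * of_real y) = k" if "y \<in> S" for y
      using has_vector_derivative_zero_constant[OF S0(2),
          of "\<lambda>y. (G' y - a * G y) * exp (a * of_real y)"] D
      by (blast intro: has_vector_derivative_at_within)
    then have "(G' y - a * G y) * exp (a * of_real y) = (G' 0 - a * G 0) * exp (a * of_real 0)"
      using S0(1) that by metis
    then show ?thesis by (simp add: G_def G'_def P00)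
  qed
  have D: "((\<lambda>y. G y * exp (- a * of_real y)) has_vector_derivative 0) (at y)" if "y \<in> S" for y
    by (rule has_vector_derivative_eq_rhs, rule has_vector_derivative_mult[OF DG[OF that] Dexp])
       (simp add: first[OF that])
  obtain k where "G y * exp (- a * of_real y) = k" if "y \<in> S" for y
    using has_vector_derivative_zero_constant[OF S0(2), of "\<lambda>y. G y * exp (- a * of_real y)"] D
    by (blast intro: has_vector_derivative_at_within)
  then have "G x * exp (- a * of_real x) = G 0 * exp (- a * of_real 0)"
    using S0 by metis
  then have "G x = exp (a * of_real x)"
    by (simp add: G_def P00 exp_minus field_simps)
  moreover have "(\<lambda>m. ?b m * of_real (sin x) ^ m) sums G x"
    using sm[OF sin1[OF S0(3)], of 0] unfolding G_def P_def by (simp add: summable_sums)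
  ultimately show ?thesis by simp
qed

text \<open>
  For real positive exponent all coefficients are nonnegative, so the partial sums at
  \<open>w = 1\<close> are limits of partial sums at \<open>w = sin x\<close>; they dominate the general case.
\<close>

lemma exp_arcsin_coeff_abs_summable:
  "summable (\<lambda>m. norm (exp_arcsin_coeff a m))"
  "(\<Sum>m. norm (exp_arcsin_coeff a m)) \<le> exp (norm a * (pi / 2))"
proof -
  let ?c = "\<lambda>m. Re (exp_arcsin_coeff (of_real (norm a)) m)"
  have c0: "0 \<le> ?c m" for m
    using norm_exp_arcsin_coeff_le[of a m] norm_ge_zero order_trans by blast
  have part: "(\<Sum>m<M. ?c m) \<le> exp (norm a * (pi / 2))" for M
  proof -
    have le: "(\<Sum>m<M. ?c m * sin x ^ m) \<le> exp (norm a * (pi / 2))" if x: "0 < x" "x < pi / 2" for x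
    proof -
      have "(\<lambda>m. Re (exp_arcsin_coeff (of_real (norm a)) m * of_real (sin x) ^ m))
          sums Re (exp (of_real (norm a) * of_real x))"
        by (intro sums_Re exp_arcsin_series) (use x in auto)
      moreover have "Re (exp (of_real (norm a) * of_real x)) = exp (norm a * x)"
        by (metis Re_complex_of_real exp_of_real of_real_mult)
      moreover have "Re (z * of_real (sin x) ^ m) = Re z * sin x ^ m" for z m
        by (simp flip: of_real_power)
      ultimately have s: "(\<lambda>m. ?c m * sin x ^ m) sums exp (norm a * x)" by simp
      have "0 \<le> sin x" using x by (intro sin_ge_zero) auto
      then have "(\<Sum>m<M. ?c m * sin x ^ m) \<le> exp (norm a * x)"
        using sum_le_suminf[OF sums_summable[OF s], of "{..<M}"] c0 sums_unique[OF s] by auto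
      also have "\<dots> \<le> exp (norm a * (pi / 2))"
        using x by (intro iffD2[OF exp_le_cancel_iff] mult_left_mono) auto
      finally show ?thesis .
    qed
    have "((\<lambda>x. \<Sum>m<M. ?c m * sin x ^ m) \<longlongrightarrow> (\<Sum>m<M. ?c m * sin (pi/2) ^ m)) (at_left (pi/2))"
      by (intro tendsto_intros)
    moreover have "eventually (\<lambda>x. (\<Sum>m<M. ?c m * sin x ^ m) \<le> exp (norm a * (pi / 2))) (at_left (pi/2))"
      using eventually_at_left_real[of 0 "pi/2"] le by (auto elim: eventually_mono)
    ultimately have "(\<Sum>m<M. ?c m * sin (pi/2) ^ m) \<le> exp (norm a * (pi / 2))"
      by (rule tendsto_upperbound) simp
    then show ?thesis by simp
  qed
  have sc: "summable ?c"
    by (rule summableI_nonneg_bounded[OF c0 part])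
  show *: "summable (\<lambda>m. norm (exp_arcsin_coeff a m))"
    by (rule summable_comparison_test'[OF sc]) (use norm_exp_arcsin_coeff_le in auto)
  have "(\<Sum>m. norm (exp_arcsin_coeff a m)) \<le> (\<Sum>m. ?c m)"
    by (intro suminf_le * sc) (use norm_exp_arcsin_coeff_le in auto)
  also have "\<dots> \<le> exp (norm a * (pi / 2))"
    by (intro suminf_le_const sc part)
  finally show "(\<Sum>m. norm (exp_arcsin_coeff a m)) \<le> exp (norm a * (pi / 2))" .
qed

section \<open>Band-limited functions\<close>

lemma integral_lborel_affine:
  fixes G :: "'a::euclidean_space \<Rightarrow> complex"
  assumes [measurable]: "G \<in> borel_measurable borel" and c: "c \<noteq> 0"
  shows "(LINT x|lborel. G x) = \<bar>c\<bar> ^ DIM('a) *\<^sub>R (LINT x|lborel. G (t + c *\<^sub>R x))"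
  by (subst lborel_affine[OF c, of t]) (simp add: integral_density integral_distr)

lemma integrable_lborel_affine:
  fixes G :: "'a::euclidean_space \<Rightarrow> complex"
  assumes G: "integrable lborel G" and c: "c \<noteq> 0"
  shows "integrable lborel (\<lambda>x. G (t + c *\<^sub>R x))"
proof -
  have [measurable]: "G \<in> borel_measurable borel" using G by auto
  have "integrable (density (distr lborel borel (\<lambda>x. t + c *\<^sub>R x)) (\<lambda>_. \<bar>c\<bar> ^ DIM('a))) G"
    using G lborel_affine[OF c, of t] by simp
  then have "integrable lborel (\<lambda>x. \<bar>c\<bar> ^ DIM('a) *\<^sub>R G (t + c *\<^sub>R x))"
    by (subst (asm) integrable_density) (auto simp: integrable_distr_eq)
  from integrable_scaleR_right[OF this, of "inverse (\<bar>c\<bar> ^ DIM('a))"] show ?thesis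
    using c by simp
qed

lemma integrable_mult_bounded:
  fixes F G :: "'a::euclidean_space \<Rightarrow> complex"
  assumes F: "integrable lborel F" and [measurable]: "G \<in> borel_measurable borel"
    and B: "\<And>x. norm (G x) \<le> B"
  shows "integrable lborel (\<lambda>x. G x * F x)"
proof (rule Bochner_Integration.integrable_bound)
  show "integrable lborel (\<lambda>x. B * norm (F x))" using F by auto
  have [measurable]: "F \<in> borel_measurable borel" using F by auto
  show "(\<lambda>x. G x * F x) \<in> borel_measurable lborel" by measurable
  show "AE x in lborel. norm (G x * F x) \<le> norm (B * norm (F x))"
    using B by (auto simp: norm_mult abs_mult intro!: mult_right_mono order_trans[OF B])
qed

lemma integrable_fourier:
  "integrable lborel F \<Longrightarrow> integrable lborel (\<lambda>x. exp (- \<i> * of_real (x \<bullet> \<xi>)) * F x)"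
  by (rule integrable_mult_bounded[where B = 1]) (auto simp: norm_exp_eq_Re)

lemma fourier_add:
  "integrable lborel F \<Longrightarrow> integrable lborel G \<Longrightarrow>
    fourier (\<lambda>x. F x + G x) \<xi> = fourier F \<xi> + fourier G \<xi>"
  unfolding fourier_def distrib_left
  by (intro Bochner_Integration.integral_add integrable_fourier)

lemma fourier_cmult: "fourier (\<lambda>x. c * F x) \<xi> = c * fourier F \<xi>"
proof -
  have "fourier (\<lambda>x. c * F x) \<xi> = (LINT x|lborel. c * (exp (- \<i> * of_real (x \<bullet> \<xi>)) * F x))"
    unfolding fourier_def by (simp add: mult_ac)
  then show ?thesis by (simp only: fourier_def integral_mult_right_zero)
qed

lemma fourier_affine:
  fixes F :: "real ^ 'n::finite \<Rightarrow> complex"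
  assumes F: "integrable lborel F" and c: "c \<noteq> 0"
  shows "fourier (\<lambda>x. F (t + c *\<^sub>R x)) \<xi> =
    of_real (1 / \<bar>c\<bar> ^ CARD('n)) * exp (\<i> * of_real (t \<bullet> \<xi> / c)) * fourier F (\<xi> /\<^sub>R c)"
proof -
  have [measurable]: "F \<in> borel_measurable borel" using F by auto
  have "fourier F (\<xi> /\<^sub>R c) = of_real (\<bar>c\<bar> ^ CARD('n)) *
      (LINT x|lborel. exp (- \<i> * of_real ((t + c *\<^sub>R x) \<bullet> (\<xi> /\<^sub>R c))) * F (t + c *\<^sub>R x))"
    unfolding fourier_def by (subst integral_lborel_affine[OF _ c, of _ t]) (auto simp: scaleR_conv_of_real)
  also have "(\<lambda>x. exp (- \<i> * of_real ((t + c *\<^sub>R x) \<bullet> (\<xi> /\<^sub>R c))) * F (t + c *\<^sub>R x)) =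
      (\<lambda>x. exp (- \<i> * of_real (t \<bullet> \<xi> / c)) * (exp (- \<i> * of_real (x \<bullet> \<xi>)) * F (t + c *\<^sub>R x)))"
  proof
    fix x
    have "(t + c *\<^sub>R x) \<bullet> (\<xi> /\<^sub>R c) = t \<bullet> \<xi> / c + x \<bullet> \<xi>"
      using c by (simp add: inner_add_left divide_inverse distrib_left)
    then have "- \<i> * of_real ((t + c *\<^sub>R x) \<bullet> (\<xi> /\<^sub>R c)) =
        - \<i> * of_real (t \<bullet> \<xi> / c) + - \<i> * of_real (x \<bullet> \<xi>)"
      by (simp only: of_real_add distrib_left)
    then show "exp (- \<i> * of_real ((t + c *\<^sub>R x) \<bullet> (\<xi> /\<^sub>R c))) * F (t + c *\<^sub>R x) =
        exp (- \<i> * of_real (t \<bullet> \<xi> / c)) * (exp (- \<i> * of_real (x \<bullet> \<xi>)) * F (t + c *\<^sub>R x))"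
      by (simp only: exp_add mult.assoc)
  qed
  also have "(LINT x|lborel. exp (- \<i> * of_real (t \<bullet> \<xi> / c)) * (exp (- \<i> * of_real (x \<bullet> \<xi>)) * F (t + c *\<^sub>R x))) =
      exp (- \<i> * of_real (t \<bullet> \<xi> / c)) * fourier (\<lambda>x. F (t + c *\<^sub>R x)) \<xi>"
    unfolding fourier_def by (rule integral_mult_right_zero)
  finally show ?thesis using c by (simp add: exp_minus field_simps)
qed

text \<open>A negative radius is meaningful: it makes the transform vanish everywhere, the origin
  included. Continuity is part of the notion so that a vanishing transform can force a vanishing
  value at every single point.\<close>

definition band_limited :: "real \<Rightarrow> (real ^ 'n::finite \<Rightarrow> complex) \<Rightarrow> bool" where
  "band_limited R F \<longleftrightarrow> continuous_on UNIV F \<and> integrable lborel F \<and>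
     (\<forall>\<xi>. R < norm \<xi> \<longrightarrow> fourier F \<xi> = 0)"

lemma band_limited_mono: "band_limited R F \<Longrightarrow> R \<le> S \<Longrightarrow> band_limited S F"
  by (auto simp: band_limited_def)

lemma band_limited_add:
  "band_limited R F \<Longrightarrow> band_limited R G \<Longrightarrow> band_limited R (\<lambda>x. F x + G x)"
  by (auto simp: band_limited_def fourier_add intro!: continuous_intros)

lemma band_limited_cmult: "band_limited R F \<Longrightarrow> band_limited R (\<lambda>x. c * F x)"
  by (auto simp: band_limited_def fourier_cmult intro!: continuous_intros)

lemma band_limited_shift:
  assumes "band_limited R F"
  shows "band_limited R (\<lambda>x. F (t + x))"
proof -
  have "continuous_on UNIV (\<lambda>x. F (t + x))"
    using assms unfolding band_limited_def
    by (auto intro!: continuous_on_compose2[of UNIV F UNIV "(+) t"] continuous_intros)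
  then show ?thesis
    using assms fourier_affine[of F 1 t] integrable_lborel_affine[of F 1 t]
    by (auto simp: band_limited_def)
qed

lemma band_limited_modulate:
  fixes F :: "real ^ 'n::finite \<Rightarrow> complex"
  assumes "band_limited R F"
  shows "band_limited (R + norm v) (\<lambda>x. exp (\<i> * of_real (x \<bullet> v)) * F x)"
  unfolding band_limited_def
proof (intro conjI allI impI)
  show "continuous_on UNIV (\<lambda>x. exp (\<i> * of_real (x \<bullet> v)) * F x)"
    using assms by (auto simp: band_limited_def intro!: continuous_intros)
  show "integrable lborel (\<lambda>x. exp (\<i> * of_real (x \<bullet> v)) * F x)"
    using assms integrable_fourier[of F "- v"] by (auto simp: band_limited_def)
  fix \<xi> :: "real ^ 'n" assume "R + norm v < norm \<xi>"
  then have "R < norm (\<xi> - v)" using norm_triangle_ineq2[of \<xi> v] by linarith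
  moreover have "fourier (\<lambda>x. exp (\<i> * of_real (x \<bullet> v)) * F x) \<xi> = fourier F (\<xi> - v)"
    unfolding fourier_def
    by (rule Bochner_Integration.integral_cong) (simp_all add: algebra_simps flip: exp_add mult.assoc)
  ultimately show "fourier (\<lambda>x. exp (\<i> * of_real (x \<bullet> v)) * F x) \<xi> = 0"
    using assms by (simp add: band_limited_def)
qed

lemma band_limited_cos:
  assumes "band_limited R F"
  shows "band_limited (R + norm v) (\<lambda>x. of_real (cos ((x - a) \<bullet> v)) * F x)"
proof -
  have "band_limited (R + norm v) (\<lambda>x.
      exp (- \<i> * of_real (a \<bullet> v)) / 2 * (exp (\<i> * of_real (x \<bullet> v)) * F x) +
      exp (\<i> * of_real (a \<bullet> v)) / 2 * (exp (\<i> * of_real (x \<bullet> (- v))) * F x))"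
    using band_limited_modulate[OF assms, of v] band_limited_modulate[OF assms, of "- v"]
    by (intro band_limited_add band_limited_cmult) auto
  moreover have "exp (- \<i> * of_real (a \<bullet> v)) / 2 * (exp (\<i> * of_real (x \<bullet> v)) * F x) +
      exp (\<i> * of_real (a \<bullet> v)) / 2 * (exp (\<i> * of_real (x \<bullet> (- v))) * F x) =
      of_real (cos ((x - a) \<bullet> v)) * F x" for x
    by (simp add: cos_of_real[symmetric] cos_exp_eq inner_diff_left algebra_simps exp_add exp_diff exp_minus divide_simps)
  ultimately show ?thesis by simp
qed

text \<open>Dominated convergence carries each zero of the transforms over to the limit. Continuity
  of \<open>G\<close> is assumed because a pointwise limit need not inherit it.\<close>

lemma band_limited_limit:
  fixes F :: "nat \<Rightarrow> real ^ 'n::finite \<Rightarrow> complex"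
  assumes F: "\<And>k. band_limited R (F k)" and w: "integrable lborel w"
    and bd: "\<And>k x. norm (F k x) \<le> w x"
    and lim: "\<And>x. (\<lambda>k. F k x) \<longlonglongrightarrow> G x" and G: "continuous_on UNIV G"
  shows "band_limited R G"
  unfolding band_limited_def
proof (intro conjI allI impI G)
  have [measurable]: "F k \<in> borel_measurable borel" "G \<in> borel_measurable borel" for k
    using F[of k] G by (auto simp: band_limited_def intro: borel_measurable_continuous_onI)
  show "integrable lborel G"
    by (rule integrable_dominated_convergence[where w = w and s = F]) (use w bd lim in auto)
  fix \<xi> :: "real ^ 'n" assume "R < norm \<xi>"
  then have "fourier (F k) \<xi> = 0" for k using F[of k] by (simp add: band_limited_def)
  moreover have "(\<lambda>k. fourier (F k) \<xi>) \<longlonglongrightarrow> fourier G \<xi>"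
    unfolding fourier_def
    by (rule integral_dominated_convergence[where w = w])
       (use w bd in \<open>auto simp: norm_mult norm_exp_eq_Re intro!: tendsto_mult lim\<close>)
  ultimately show "fourier G \<xi> = 0" by (simp add: LIMSEQ_const_iff)
qed

section \<open>Sinc kernels\<close>

lemma abs_sinc_le_1: "\<bar>sinc t\<bar> \<le> 1"
  using abs_sin_x_le_abs_x[of t] by (auto simp: divide_le_eq)

lemma abs_mult_sinc_le_1: "\<bar>t\<bar> * \<bar>sinc t\<bar> \<le> 1"
  by (auto simp: abs_mult[symmetric] simp del: abs_mult)

lemma sinc_double: "sinc t = sinc (t / 2) * cos (t / 2)"
  using sin_double[of "t / 2"] by (auto simp: field_simps)

text \<open>Viete's product: the half-angle identity iterated \<open>K\<close> times. The leftover
  factor tends to 1, which makes sinc a limit of products of cosines.\<close>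

lemma sinc_eq_prod_cos: "sinc t = sinc (t / 2 ^ K) * (\<Prod>k<K. cos (t / 2 ^ Suc k))"
proof (induction K)
  case (Suc K)
  have "sinc (t / 2 ^ K) = sinc (t / 2 ^ Suc K) * cos (t / 2 ^ Suc K)"
    using sinc_double[of "t / 2 ^ K"] by (simp only: divide_divide_eq_left power_Suc mult.commute)
  with Suc show ?case by (simp only: prod.lessThan_Suc mult_ac)
qed simp

lemma prod_cos_tendsto_sinc: "(\<lambda>K. \<Prod>k<K. cos (t / 2 ^ Suc k)) \<longlonglongrightarrow> sinc t"
proof -
  let ?P = "\<lambda>K. \<Prod>k<K. cos (t / 2 ^ Suc k)"
  have "(\<lambda>K. t / 2 ^ K) \<longlonglongrightarrow> 0" by real_asymp
  from isCont_tendsto_compose[OF isCont_sinc this]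
  have l: "(\<lambda>K. \<bar>1 - sinc (t / 2 ^ K)\<bar>) \<longlonglongrightarrow> \<bar>1 - 1\<bar>"
    by (intro tendsto_intros) simp
  have P1: "\<bar>?P K\<bar> \<le> 1" for K
    unfolding abs_prod by (intro prod_le_1) auto
  have "norm (?P K - sinc t) \<le> \<bar>1 - sinc (t / 2 ^ K)\<bar>" for K
  proof -
    have "?P K - sinc t = (1 - sinc (t / 2 ^ K)) * ?P K"
      by (subst sinc_eq_prod_cos[of t K]) (simp only: left_diff_distrib mult_1)
    then show ?thesis
      using mult_left_mono[OF P1[of K], of "\<bar>1 - sinc (t / 2 ^ K)\<bar>"] by (simp only: real_norm_def abs_mult) simp
  qed
  then have "(\<lambda>K. ?P K - sinc t) \<longlonglongrightarrow> 0"
    by (intro Lim_null_comparison[OF _ l[simplified]] always_eventually) auto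
  then show ?thesis by (simp only: LIM_zero_iff)
qed

text \<open>
  No Fourier inversion is needed: \<open>sinc\<close> is a bounded limit of products of cosines, and
  multiplication by a cosine only shifts the Fourier transform.
\<close>

lemma band_limited_sinc:
  assumes F: "band_limited R F"
  shows "band_limited (R + norm v) (\<lambda>x. of_real (sinc ((x - a) \<bullet> v)) * F x)"
proof -
  define Q where "Q K x = (\<Prod>k<K. cos ((x - a) \<bullet> v / 2 ^ Suc k))" for K x
  have Q1: "\<bar>Q K x\<bar> \<le> 1" for K x
    unfolding Q_def abs_prod by (intro prod_le_1) auto
  \<comment> \<open>The cosines contribute the frequencies norm v / 2, norm v / 4 and so on, whose
    sum stays below norm v for every \<open>K\<close>.\<close>
  have *: "band_limited (R + norm v * (1 - 1 / 2 ^ K)) (\<lambda>x. of_real (Q K x) * F x)" for K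
  proof (induction K)
    case 0 then show ?case using F by (simp add: Q_def)
  next
    case (Suc K)
    have e: "R + norm v * (1 - 1 / 2 ^ K) + norm (v /\<^sub>R 2 ^ Suc K) = R + norm v * (1 - 1 / 2 ^ Suc K)"
      by (simp add: field_simps)
    have "(\<lambda>x. of_real (cos ((x - a) \<bullet> (v /\<^sub>R 2 ^ Suc K))) * (of_real (Q K x) * F x)) =
        (\<lambda>x. of_real (Q (Suc K) x) * F x)"
    proof
      fix x
      have "(x - a) \<bullet> (v /\<^sub>R 2 ^ Suc K) = (x - a) \<bullet> v / 2 ^ Suc K"
        by (simp only: inner_scaleR_right divide_inverse mult.commute)
      then show "of_real (cos ((x - a) \<bullet> (v /\<^sub>R 2 ^ Suc K))) * (of_real (Q K x) * F x) =
          of_real (Q (Suc K) x) * F x"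
        by (simp only: Q_def prod.lessThan_Suc of_real_mult mult_ac)
    qed
    then show ?case using band_limited_cos[OF Suc, of "v /\<^sub>R 2 ^ Suc K" a] unfolding e by simp
  qed
  show ?thesis
  proof (rule band_limited_limit)
    show "band_limited (R + norm v) (\<lambda>x. of_real (Q K x) * F x)" for K
      by (rule band_limited_mono[OF *[of K]]) (simp add: mult_left_le)
    show "integrable lborel (\<lambda>x. norm (F x))" using F by (auto simp: band_limited_def)
    show "norm (of_real (Q K x) * F x) \<le> norm (F x)" for K x
      using mult_right_mono[OF Q1, of "norm (F x)"] by (simp add: norm_mult)
    show "(\<lambda>K. of_real (Q K x) * F x) \<longlonglongrightarrow> of_real (sinc ((x - a) \<bullet> v)) * F x" for x
      unfolding Q_def by (intro tendsto_mult tendsto_const tendsto_of_real prod_cos_tendsto_sinc)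
    show "continuous_on UNIV (\<lambda>x. of_real (sinc ((x - a) \<bullet> v)) * F x)"
      using F unfolding band_limited_def
      by (intro continuous_on_mult continuous_on_of_real continuous_on_sinc continuous_intros) auto
  qed
qed

text \<open>\<open>c\<close> is an inverse width and \<open>N\<close> the order of decay. Decay of
  order N costs a spectral radius of N times the dimension times |c|, so a small \<open>c\<close>
  keeps the spectrum small whatever the order.\<close>

definition sinc_kernel :: "real \<Rightarrow> nat \<Rightarrow> real ^ 'n::finite \<Rightarrow> real ^ 'n \<Rightarrow> real" where
  "sinc_kernel c N a x = (\<Prod>i\<in>UNIV. sinc (c * (x $ i - a $ i))) ^ N"

lemma continuous_on_sinc_kernel: "continuous_on S (sinc_kernel c N a)"
  unfolding sinc_kernel_def
  by (intro continuous_on_power continuous_on_prod continuous_on_sinc continuous_intros)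

lemma sinc_kernel_center: "sinc_kernel c N a a = 1"
  by (simp add: sinc_kernel_def)

lemma abs_sinc_kernel_le_1: "\<bar>sinc_kernel c N a x\<bar> \<le> 1"
  unfolding sinc_kernel_def power_abs abs_prod
  by (intro power_le_one prod_nonneg prod_le_1 conjI abs_sinc_le_1) auto

text \<open>For each j the sinc factor of that coordinate absorbs |c (x_j - a_j)|, and the other
  factors are at most 1. Summing over j controls the l1 norm, hence the Euclidean norm, at the price
  of the dimension; then take the \<open>N\<close>-th power.\<close>

lemma sinc_kernel_decay:
  fixes a x :: "real ^ 'n::finite"
  shows "(\<bar>c\<bar> * norm (x - a)) ^ N * \<bar>sinc_kernel c N a x\<bar> \<le> real CARD('n) ^ N"
proof -
  let ?P = "\<Prod>i\<in>UNIV. \<bar>sinc (c * (x $ i - a $ i))\<bar>"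
  have "\<bar>c * (x $ j - a $ j)\<bar> * ?P \<le> 1" for j
  proof -
    have "?P = \<bar>sinc (c * (x $ j - a $ j))\<bar> * (\<Prod>i\<in>UNIV - {j}. \<bar>sinc (c * (x $ i - a $ i))\<bar>)"
      by (rule prod.remove) auto
    also have "\<dots> \<le> \<bar>sinc (c * (x $ j - a $ j))\<bar> * 1"
      by (intro mult_left_mono prod_le_1 conjI abs_sinc_le_1) auto
    finally show ?thesis
      using mult_left_mono[of ?P "\<bar>sinc (c * (x $ j - a $ j))\<bar>" "\<bar>c * (x $ j - a $ j)\<bar>"]
        abs_mult_sinc_le_1[of "c * (x $ j - a $ j)"] by linarith
  qed
  then have "(\<Sum>j\<in>(UNIV::'n set). \<bar>c * (x $ j - a $ j)\<bar> * ?P) \<le> (\<Sum>j\<in>(UNIV::'n set). 1)"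
    by (rule sum_mono)
  moreover have "\<bar>c\<bar> * norm (x - a) * ?P \<le> (\<Sum>j\<in>UNIV. \<bar>c * (x $ j - a $ j)\<bar>) * ?P"
    using norm_le_l1_cart[of "x - a"]
    by (intro mult_right_mono prod_nonneg) (auto simp: abs_mult simp flip: sum_distrib_left intro!: mult_left_mono)
  ultimately have "\<bar>c\<bar> * norm (x - a) * ?P \<le> real CARD('n)"
    by (simp only: sum_distrib_right) simp
  moreover have "0 \<le> \<bar>c\<bar> * norm (x - a) * ?P" by (intro mult_nonneg_nonneg prod_nonneg) auto
  ultimately have "(\<bar>c\<bar> * norm (x - a) * ?P) ^ N \<le> real CARD('n) ^ N" by (rule power_mono)
  then show ?thesis by (simp only: sinc_kernel_def power_abs abs_prod power_mult_distrib)
qed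

lemma band_limited_sinc_kernel:
  fixes F :: "real ^ 'n::finite \<Rightarrow> complex"
  assumes F: "band_limited R F"
  shows "band_limited (R + real N * real CARD('n) * \<bar>c\<bar>) (\<lambda>x. of_real (sinc_kernel c N a x) * F x)"
proof -
  have step: "band_limited (S + real (card I) * \<bar>c\<bar>) (\<lambda>x. of_real (\<Prod>i\<in>I. sinc (c * (x $ i - a $ i))) * G x)"
    if "finite I" and G: "band_limited S G" for I S and G :: "real ^ 'n \<Rightarrow> complex"
    using \<open>finite I\<close>
  proof (induction I rule: finite_induct)
    case empty then show ?case using G by simp
  next
    case (insert i I)
    have s: "(x - a) \<bullet> (c *\<^sub>R axis i 1) = c * (x $ i - a $ i)" for x
      by (simp add: inner_axis algebra_simps)
    have n: "norm (c *\<^sub>R axis i 1 :: real ^ 'n) = \<bar>c\<bar>" by simp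
    have "band_limited (S + real (card I) * \<bar>c\<bar> + \<bar>c\<bar>)
        (\<lambda>x. of_real (sinc (c * (x $ i - a $ i))) * (of_real (\<Prod>i\<in>I. sinc (c * (x $ i - a $ i))) * G x))"
      using band_limited_sinc[OF insert(3), of "c *\<^sub>R axis i 1" a] unfolding s n .
    moreover have "S + real (card I) * \<bar>c\<bar> + \<bar>c\<bar> = S + real (card (insert i I)) * \<bar>c\<bar>"
      using insert by (simp add: algebra_simps)
    moreover have "of_real (sinc (c * (x $ i - a $ i))) * (of_real (\<Prod>i\<in>I. sinc (c * (x $ i - a $ i))) * G x) =
        of_real (\<Prod>i\<in>insert i I. sinc (c * (x $ i - a $ i))) * G x" for x
      using insert(1,2) by (simp only: prod.insert of_real_mult mult.assoc not_False_eq_True)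
    ultimately show ?case by (simp only:)
  qed
  show ?thesis
  proof (induction N)
    case 0 then show ?case using F by (simp add: sinc_kernel_def)
  next
    case (Suc N)
    have "R + real N * real CARD('n) * \<bar>c\<bar> + real (card (UNIV :: 'n set)) * \<bar>c\<bar> = R + real (Suc N) * real CARD('n) * \<bar>c\<bar>"
      by (simp add: algebra_simps)
    moreover have "of_real (\<Prod>i\<in>UNIV. sinc (c * (x $ i - a $ i))) * (of_real (sinc_kernel c N a x) * F x) =
        of_real (sinc_kernel c (Suc N) a x) * F x" for x
      by (simp only: sinc_kernel_def power_Suc of_real_mult mult.assoc)
    ultimately show ?case using step[OF finite_class.finite_UNIV Suc] by (simp only:)
  qed
qed

text \<open>
  Injectivity of the Fourier transform.  Pairing with a high power of the sinc product,
  concentrated at \<open>a\<close> as \<open>c \<rightarrow> \<infinity>\<close>, gives \<open>0\<close>; the power \<open>2 n\<close> makes the mass near \<open>a\<close>, of order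
  \<open>c\<^sup>-\<^sup>n\<close>, exceed the tail, of order \<open>c\<^sup>-\<^sup>2\<^sup>n\<close>.
\<close>

lemma band_limited_all_zero:
  fixes h :: "real ^ 'n::finite \<Rightarrow> complex"
  assumes h: "\<And>R. band_limited R h"
  shows "h a = 0"
proof (rule ccontr)
  assume ha: "h a \<noteq> 0"
  define n where "n = CARD('n)"
  define N where "N = 2 * n"
  \<comment> \<open>This phase makes the value at \<open>a\<close> real and positive, so that it
    suffices to estimate a real part.\<close>
  define u where "u = cnj (h a) / of_real (norm (h a))"
  define \<delta> where "\<delta> = norm (h a) / 2"
  have n: "0 < n" by (simp add: n_def)
  have \<delta>: "0 < \<delta>" using ha by (simp add: \<delta>_def)
  have u1: "norm u = 1" using ha by (simp add: u_def norm_divide)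
  have cont: "continuous_on UNIV h" and int: "integrable lborel h"
    using h[of 0] by (auto simp: band_limited_def)
  have [measurable]: "h \<in> borel_measurable borel" using int by auto
  have "u * h a = of_real (norm (h a))"
    using ha complex_norm_square[of "h a"] by (simp add: u_def power2_eq_square mult.commute divide_simps)
  then have ua: "Re (u * h a) = 2 * \<delta>" by (simp add: \<delta>_def)
  have "continuous_on UNIV (\<lambda>x. Re (u * h x))" by (intro continuous_intros cont)
  then have "isCont (\<lambda>x. Re (u * h x)) a" by (simp add: continuous_on_eq_continuous_at)
  then obtain r where r: "0 < r" and "\<And>x. dist x a < r \<Longrightarrow> dist (Re (u * h x)) (Re (u * h a)) < \<delta>"
    unfolding continuous_at_eps_delta using \<delta> by blast
  then have near: "\<delta> \<le> Re (u * h x)" if "norm (x - a) < r" for x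
    using that ua unfolding dist_real_def dist_norm by (smt (verit))
  have "isCont sinc 0" by (rule isCont_sinc)
  then obtain \<eta>' where "0 < \<eta>'" and \<eta>': "\<And>t. dist t 0 < \<eta>' \<Longrightarrow> dist (sinc t) (sinc 0) < 1/2"
    unfolding continuous_at_eps_delta by (metis half_gt_zero_iff zero_less_one)
  define \<eta> where "\<eta> = \<eta>' / 2"
  have \<eta>: "0 < \<eta>" using \<open>0 < \<eta>'\<close> by (simp add: \<eta>_def)
  have sinc_half: "1/2 \<le> sinc t" if "\<bar>t\<bar> \<le> \<eta>" for t
    using \<eta>'[of t] that \<open>0 < \<eta>'\<close> unfolding dist_real_def \<eta>_def by (smt (verit) field_sum_of_halves)
  define D where "D = \<delta> * (1/2) ^ (n * N) * (2 * \<eta>) ^ n"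
  define A where "A = (LINT x|lborel. norm (h x))"
  define E where "E = (real n / r) ^ N * A"
  have D: "0 < D" using \<delta> \<eta> by (simp add: D_def)
  have main: "D * c ^ n \<le> E" if c: "0 < c" "real n * \<eta> / r < c" for c
  proof -
    let ?K = "sinc_kernel c N a"
    let ?B = "cbox (a - (\<chi> i. \<eta> / c)) (a + (\<chi> i. \<eta> / c))"
    have [measurable]: "?K \<in> borel_measurable borel"
      by (intro borel_measurable_continuous_onI continuous_on_sinc_kernel)
    \<comment> \<open>The exponent \<open>N\<close> is even, so the kernel is nonnegative although
      sinc changes sign.\<close>
    have K0: "0 \<le> ?K x" for x
      unfolding sinc_kernel_def N_def by (intro zero_le_even_power) simp
    \<comment> \<open>The kernel widens the spectrum by N times the dimension times |c|. Since
      \<open>h\<close> is band-limited for every radius, one may start that much below -1 and end at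
      radius -1; the transform of the product then vanishes at 0, that is, the product has integral
      0.\<close>
    have "band_limited (- 1) (\<lambda>x. of_real (?K x) * h x)"
      using band_limited_sinc_kernel[OF h[of "- 1 - real N * real CARD('n) * \<bar>c\<bar>"], of N c a] by simp
    then have intK: "integrable lborel (\<lambda>x. of_real (?K x) * h x)"
      and "fourier (\<lambda>x. of_real (?K x) * h x) 0 = 0"
      by (auto simp: band_limited_def)
    then have "(LINT x|lborel. of_real (?K x) * h x) = 0" by (simp add: fourier_def)
    moreover have "Re (u * h x) * ?K x = Re (u * (of_real (?K x) * h x))" for x
      by (simp add: algebra_simps)
    ultimately have I0: "(LINT x|lborel. Re (u * h x) * ?K x) = 0"
      and intI: "integrable lborel (\<lambda>x. Re (u * h x) * ?K x)"
      using integral_Re[OF integrable_mult_right[OF intK, of u]] integrable_Re[OF integrable_mult_right[OF intK, of u]]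
      by (simp_all only: integral_mult_right_zero) simp_all
    have inB: "\<bar>x $ i - a $ i\<bar> \<le> \<eta> / c" if "x \<in> ?B" for x i
      using that by (auto simp: mem_box_cart abs_le_iff algebra_simps dest: spec[of _ i])
    have KB: "(1/2) ^ (n * N) \<le> ?K x" if "x \<in> ?B" for x
    proof -
      have "\<bar>c * (x $ i - a $ i)\<bar> \<le> \<eta>" for i
        using mult_left_mono[OF inB[OF that, of i], of c] c by (simp only: abs_mult) simp
      then have "(\<Prod>i\<in>(UNIV::'n set). 1/2) \<le> (\<Prod>i\<in>UNIV. sinc (c * (x $ i - a $ i)))"
        by (intro prod_mono conjI sinc_half) auto
      then show ?thesis
        unfolding sinc_kernel_def n_def by (subst power_mult) (intro power_mono, auto)
    qed
    have ballB: "norm (x - a) < r" if "x \<in> ?B" for x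
    proof -
      have "norm (x - a) \<le> (\<Sum>i\<in>UNIV. \<bar>(x - a) $ i\<bar>)" by (rule norm_le_l1_cart)
      also have "\<dots> \<le> (\<Sum>i\<in>(UNIV::'n set). \<eta> / c)"
        using inB[OF that] by (intro sum_mono) auto
      also have "\<dots> < r" using c r by (simp add: n_def field_simps)
      finally show ?thesis .
    qed
    \<comment> \<open>Near \<open>a\<close> the real part is at least delta, and on the box every
      sinc factor is at least 1/2. Away from \<open>a\<close> only the decay of the kernel
      helps.\<close>
    have le: "\<delta> * (1/2) ^ (n * N) * indicator ?B x - (real n / (c * r)) ^ N * norm (h x) \<le> Re (u * h x) * ?K x" for x
    proof (cases "norm (x - a) < r")
      case True
      have "\<delta> * ((1/2) ^ (n * N) * indicator ?B x) \<le> Re (u * h x) * ?K x"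
        using near[OF True] \<delta> K0[of x] KB[of x] by (intro mult_mono) (auto simp: indicator_def)
      moreover have "0 \<le> (real n / (c * r)) ^ N * norm (h x)" using c r by simp
      ultimately show ?thesis by (simp add: mult.assoc)
    next
      case False
      have "(c * r) ^ N * ?K x \<le> (\<bar>c\<bar> * norm (x - a)) ^ N * \<bar>?K x\<bar>"
        using False c r K0[of x] by (intro mult_mono power_mono) auto
      also have "\<dots> \<le> real n ^ N" unfolding n_def by (rule sinc_kernel_decay)
      finally have "?K x \<le> (real n / (c * r)) ^ N"
        using c r by (simp add: power_divide field_simps)
      then have "norm (u * h x) * ?K x \<le> (real n / (c * r)) ^ N * norm (h x)"
        by (simp add: norm_mult u1 mult.commute mult_left_mono)
      moreover have "- (norm (u * h x) * ?K x) \<le> Re (u * h x) * ?K x"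
        using abs_Re_le_cmod[of "u * h x"] K0[of x] mult_right_mono[of "- norm (u * h x)" "Re (u * h x)" "?K x"] by auto
      moreover have "x \<notin> ?B" using ballB False by blast
      ultimately show ?thesis by simp
    qed
    have mB: "measure lborel ?B = (2 * \<eta> / c) ^ n"
      using \<eta> c by (simp add: content_cbox_if_cart interval_ne_empty_cart n_def)
    have iB: "integrable lborel (indicator ?B :: _ \<Rightarrow> real)"
      using emeasure_bounded_finite[OF bounded_cbox] by (intro integrable_real_indicator) simp_all
    have "(LINT x|lborel. \<delta> * (1/2) ^ (n * N) * indicator ?B x - (real n / (c * r)) ^ N * norm (h x)) \<le> 0"
      by (subst I0[symmetric], intro integral_mono intI le Bochner_Integration.integrable_diff
          integrable_mult_right iB integrable_norm int)
    moreover have "(LINT x|lborel. \<delta> * (1/2) ^ (n * N) * indicator ?B x - (real n / (c * r)) ^ N * norm (h x)) =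
        \<delta> * (1/2) ^ (n * N) * (2 * \<eta> / c) ^ n - (real n / (c * r)) ^ N * A"
      using int mB iB unfolding A_def by (subst Bochner_Integration.integral_diff) auto
    ultimately have "\<delta> * (1/2) ^ (n * N) * (2 * \<eta> / c) ^ n \<le> (real n / (c * r)) ^ N * A" by simp
    moreover have "\<delta> * (1/2) ^ (n * N) * (2 * \<eta> / c) ^ n = D / c ^ n"
      by (simp add: D_def power_divide)
    moreover have "(real n / (c * r)) ^ N * A = E / (c ^ n * c ^ n)"
      by (simp add: E_def N_def power_divide power_mult_distrib mult_2 power_add)
    ultimately have "D / c ^ n \<le> E / (c ^ n * c ^ n)" by (simp only:)
    then show ?thesis using c by (simp add: field_simps)
  qed
  \<comment> \<open>The three lower bounds serve, in turn, to have c <= c^n, to put the box inside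
    the ball where \<open>h\<close> is controlled, and to contradict D c <= E.\<close>
  define c where "c = max 1 (max (real n * \<eta> / r + 1) (E / D + 1))"
  have c: "1 \<le> c" "real n * \<eta> / r < c" "E / D < c" by (auto simp: c_def)
  have "c ^ 1 \<le> c ^ n" using n c by (intro power_increasing) auto
  then have "D * c \<le> D * c ^ n" using D by simp
  also have "\<dots> \<le> E" using c by (intro main) auto
  finally show False using D c(3) by (simp add: field_simps)
qed

section \<open>Central differences and translations\<close>

definition central_diff :: "real ^ 'n::finite \<Rightarrow> (real ^ 'n \<Rightarrow> complex) \<Rightarrow> real ^ 'n \<Rightarrow> complex" where
  "central_diff e F x = (F (x + (1/2) *\<^sub>R e) - F (x - (1/2) *\<^sub>R e)) / (2 * \<i>)"

text \<open>Division by 2 makes the central difference a contraction for the supremum norm, and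
  likewise for the L^1 norm, so absolute summability of the coefficients is enough for the series.
  Division by i makes its symbol a real sine.\<close>

lemma norm_central_diff_le:
  assumes "\<And>x. norm (F x) \<le> B"
  shows "norm (central_diff e F x) \<le> B"
  using norm_triangle_ineq4[of "F (x + (1/2) *\<^sub>R e)" "F (x - (1/2) *\<^sub>R e)"]
    assms[of "x + (1/2) *\<^sub>R e"] assms[of "x - (1/2) *\<^sub>R e"]
  unfolding central_diff_def norm_divide by (simp add: norm_mult)

lemma norm_central_diff_power_le:
  assumes "\<And>x. norm (F x) \<le> B"
  shows "norm ((central_diff e ^^ m) F x) \<le> B"
  by (induction m arbitrary: x) (auto intro: assms norm_central_diff_le)

lemma band_limited_central_diff:
  assumes "band_limited R F"
  shows "band_limited R (central_diff e F)"
    and "fourier (central_diff e F) \<xi> = of_real (sin (e \<bullet> \<xi> / 2)) * fourier F \<xi>"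
    and "(LINT x|lborel. norm (central_diff e F x)) \<le> (LINT x|lborel. norm (F x))"
proof -
  define f g where "f = (\<lambda>x. F ((1/2) *\<^sub>R e + x))" and "g = (\<lambda>x. F ((- 1/2) *\<^sub>R e + x))"
  have eq: "central_diff e F = (\<lambda>x. 1 / (2 * \<i>) * f x + - 1 / (2 * \<i>) * g x)"
    by (simp add: central_diff_def fun_eq_iff f_def g_def diff_divide_distrib algebra_simps)
  have b: "band_limited R f" "band_limited R g"
    unfolding f_def g_def by (intro band_limited_shift assms)+
  show "band_limited R (central_diff e F)"
    unfolding eq by (intro band_limited_add band_limited_cmult b)
  have F: "integrable lborel F" and i: "integrable lborel f" "integrable lborel g"
    using b assms by (auto simp: band_limited_def)
  have ff: "fourier f \<xi> = exp (\<i> * of_real (e \<bullet> \<xi> / 2)) * fourier F \<xi>"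
    "fourier g \<xi> = exp (- \<i> * of_real (e \<bullet> \<xi> / 2)) * fourier F \<xi>"
    using fourier_affine[OF F, of 1 "(1/2) *\<^sub>R e" \<xi>] fourier_affine[OF F, of 1 "(-1/2) *\<^sub>R e" \<xi>]
    by (simp_all add: f_def g_def)
  show "fourier (central_diff e F) \<xi> = of_real (sin (e \<bullet> \<xi> / 2)) * fourier F \<xi>"
  proof -
    have "fourier (central_diff e F) \<xi> = 1 / (2 * \<i>) * fourier f \<xi> + - 1 / (2 * \<i>) * fourier g \<xi>"
      unfolding eq by (subst fourier_add) (intro integrable_mult_right i, intro integrable_mult_right i, simp only: fourier_cmult)
    then show ?thesis
      unfolding ff sin_of_real[symmetric] sin_exp_eq by (simp add: field_simps)
  qed
  have e: "(LINT x|lborel. norm (F (t + x))) = (LINT x|lborel. norm (F x))" for t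
    using F integral_lborel_affine[of "\<lambda>x. of_real (norm (F x))" 1 t] by simp
  have "(LINT x|lborel. norm (central_diff e F x)) \<le> (LINT x|lborel. (1/2) * norm (f x) + (1/2) * norm (g x))"
  proof (rule integral_mono)
    show "integrable lborel (\<lambda>x. norm (central_diff e F x))" unfolding eq using i by auto
    show "norm (central_diff e F x) \<le> (1/2) * norm (f x) + (1/2) * norm (g x)" for x
      unfolding eq by (rule order_trans[OF norm_triangle_ineq]) (simp add: norm_mult norm_divide)
  qed (use i in auto)
  also have "\<dots> = (LINT x|lborel. norm (F x))"
    using i e[of "(1/2) *\<^sub>R e"] e[of "(- 1/2) *\<^sub>R e"] by (simp add: f_def g_def)
  finally show "(LINT x|lborel. norm (central_diff e F x)) \<le> (LINT x|lborel. norm (F x))" .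
qed

lemma band_limited_central_diff_power:
  assumes "band_limited R F"
  shows "band_limited R ((central_diff e ^^ m) F) \<and>
    (\<forall>\<xi>. fourier ((central_diff e ^^ m) F) \<xi> = of_real (sin (e \<bullet> \<xi> / 2)) ^ m * fourier F \<xi>) \<and>
    (LINT x|lborel. norm ((central_diff e ^^ m) F x)) \<le> (LINT x|lborel. norm (F x))"
proof (induction m)
  case (Suc m)
  then show ?case
    using band_limited_central_diff[of R "(central_diff e ^^ m) F" e]
    by (auto simp: mult_ac intro: order_trans)
qed (use assms in auto)

text \<open>
  On the Fourier side \<^const>\<open>central_diff\<close> is multiplication by \<open>sin (e \<bullet> \<xi> / 2)\<close>, and
  \<open>\<bar>e \<bullet> \<xi> / 2\<bar> \<le> 3/2 < \<pi>/2\<close> on the spectrum, where the sine series of the exponential applies.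
\<close>

lemma shift_eq_central_diff_series:
  fixes F :: "real ^ 'n::finite \<Rightarrow> complex" and t :: real
  assumes F: "band_limited 3 F" and B: "\<And>x. norm (F x) \<le> B" and e: "norm e \<le> 1"
  shows "(\<lambda>m. exp_arcsin_coeff (2 * \<i> * of_real t) m * (central_diff e ^^ m) F x) sums F (t *\<^sub>R e + x)"
proof -
  define c where "c = exp_arcsin_coeff (2 * \<i> * of_real t)"
  define g where "g m x = c m * (central_diff e ^^ m) F x" for m x
  define A where "A = (LINT x|lborel. norm (F x))"
  have c: "summable (\<lambda>m. norm (c m))" unfolding c_def by (rule exp_arcsin_coeff_abs_summable)
  have gB: "norm (g m x) \<le> norm (c m) * B" for m x
    unfolding g_def norm_mult by (intro mult_left_mono norm_central_diff_power_le B) auto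
  have sg: "summable (\<lambda>m. norm (g m x))" for x
    by (rule summable_comparison_test'[OF summable_mult2[OF c, of B]]) (use gB in auto)
  have bg: "band_limited 3 (g m)" for m
    unfolding g_def[abs_def] by (intro band_limited_cmult) (use band_limited_central_diff_power[OF F] in blast)
  have ig: "integrable lborel (g m)" and cg: "continuous_on UNIV (g m)" for m
    using bg[of m] by (auto simp: band_limited_def)
  have gA: "(LINT x|lborel. norm (g m x)) \<le> norm (c m) * A" for m
    using band_limited_central_diff_power[OF F, where e = e and m = m]
    by (auto simp: g_def norm_mult A_def intro!: mult_left_mono)
  have sA: "summable (\<lambda>m. LINT x|lborel. norm (g m x))"
    by (rule summable_comparison_test'[OF summable_mult2[OF c, of A]]) (use gA in auto)
  \<comment> \<open>The series converges both in L^1 and uniformly: the first allows transforming it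
    term by term, the second gives the continuity that the injectivity argument needs.\<close>
  define G where "G x = (\<Sum>m. g m x)" for x
  have iG: "integrable lborel G"
    unfolding G_def[abs_def] by (rule integrable_suminf[OF ig _ sA]) (use sg in auto)
  have cG: "continuous_on UNIV G"
  proof (rule uniform_limit_theorem[OF always_eventually])
    show "uniform_limit UNIV (\<lambda>n x. \<Sum>m<n. g m x) G sequentially"
      unfolding G_def[abs_def]
      by (rule Weierstrass_m_test[OF _ summable_mult2[OF c, of B]]) (use gB in auto)
  qed (auto intro!: continuous_intros cg)
  have fG: "fourier G \<xi> = (\<Sum>m. c m * of_real (sin (e \<bullet> \<xi> / 2)) ^ m * fourier F \<xi>)" for \<xi>
  proof -
    let ?E = "\<lambda>x. exp (- \<i> * of_real (x \<bullet> \<xi>))"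
    have n1: "norm (?E x * z) = norm z" for x z by (simp add: norm_mult norm_exp_eq_Re)
    have "fourier G \<xi> = (LINT x|lborel. (\<Sum>m. ?E x * g m x))"
      unfolding fourier_def G_def using sg by (subst suminf_mult) (auto intro: summable_norm_cancel)
    also have "\<dots> = (\<Sum>m. LINT x|lborel. ?E x * g m x)"
      by (rule integral_suminf) (simp_all only: n1 sg sA integrable_fourier[OF ig], simp)
    also have "\<dots> = (\<Sum>m. fourier (g m) \<xi>)" by (simp add: fourier_def)
    also have "\<dots> = (\<Sum>m. c m * of_real (sin (e \<bullet> \<xi> / 2)) ^ m * fourier F \<xi>)"
      using band_limited_central_diff_power[OF F, where e = e]
      by (simp add: g_def[abs_def] fourier_cmult mult_ac)
    finally show ?thesis .
  qed
  have iF: "integrable lborel F" using F by (simp add: band_limited_def)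
  have "band_limited 3 (\<lambda>x. F (t *\<^sub>R e + x))" by (intro band_limited_shift F)
  then have iS: "integrable lborel (\<lambda>x. F (t *\<^sub>R e + x))" and cS: "continuous_on UNIV (\<lambda>x. F (t *\<^sub>R e + x))"
    by (auto simp: band_limited_def)
  have eq: "fourier G \<xi> = fourier (\<lambda>x. F (t *\<^sub>R e + x)) \<xi>" for \<xi>
  proof (cases "norm \<xi> \<le> 3")
    case True
    have "\<bar>e \<bullet> \<xi>\<bar> \<le> norm e * norm \<xi>" by (rule Cauchy_Schwarz_ineq2)
    also have "\<dots> \<le> 1 * 3" using e True by (intro mult_mono) auto
    finally have "\<bar>e \<bullet> \<xi> / 2\<bar> < pi / 2" using pi_gt3 by auto
    \<comment> \<open>The exponent carries a factor 2 because the sine is taken at half the angle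
      \<open>e \<bullet> \<xi>\<close>.\<close>
    from exp_arcsin_series[OF this, of "2 * \<i> * of_real t"]
    have "(\<lambda>m. c m * of_real (sin (e \<bullet> \<xi> / 2)) ^ m) sums exp (\<i> * of_real ((t *\<^sub>R e) \<bullet> \<xi>))"
      unfolding c_def by (simp add: mult_ac)
    then have "fourier G \<xi> = exp (\<i> * of_real ((t *\<^sub>R e) \<bullet> \<xi>)) * fourier F \<xi>"
      unfolding fG by (intro sums_unique[symmetric] sums_mult2)
    then show ?thesis
      using fourier_affine[OF iF, of 1 "t *\<^sub>R e" \<xi>] by simp
  next
    case False
    then have "fourier F \<xi> = 0" using F by (auto simp: band_limited_def)
    then show ?thesis
      using fourier_affine[OF iF, of 1 "t *\<^sub>R e" \<xi>] by (simp add: fG)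
  qed
  \<comment> \<open>Two continuous integrable functions with the same transform: their difference is
    band-limited for every radius, hence 0 everywhere.\<close>
  have "band_limited R (\<lambda>x. G x + (- 1) * F (t *\<^sub>R e + x))" for R
    unfolding band_limited_def
    by (subst fourier_add[OF iG integrable_mult_right[OF iS]], subst fourier_cmult)
       (auto simp: eq intro!: continuous_intros cG cS Bochner_Integration.integrable_diff iG iS)
  from band_limited_all_zero[OF this, of x] have "G x = F (t *\<^sub>R e + x)" by simp
  then show ?thesis
    using summable_sums[OF summable_norm_cancel[OF sg[of x]]] by (simp add: G_def g_def c_def)
qed

section \<open>Schwartz functions\<close>

lemma iter_partial_deriv_simps [simp]:
  "iter_partial_deriv [] f = f"
  "iter_partial_deriv (i # is) f = partial_deriv i (iter_partial_deriv is f)"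
  by (simp_all add: iter_partial_deriv_def)

text \<open>\<open>partial_deriv\<close> differentiates at parameter 0 of a line through the point.
  Moving the base point along the line gives the derivative at every parameter, as the mean value
  estimate on a segment requires.\<close>

lemma has_vector_derivative_partial_deriv:
  assumes "g differentiable (at (x + s *\<^sub>R axis i 1))"
  shows "((\<lambda>t. g (x + t *\<^sub>R axis i 1)) has_vector_derivative
    partial_deriv i g (x + s *\<^sub>R axis i 1)) (at s)"
proof -
  have 0: "((\<lambda>t. g (y + t *\<^sub>R axis i 1)) has_vector_derivative partial_deriv i g y) (at 0)"
    if "g differentiable (at y)" for y
  proof -
    have "(\<lambda>t::real. g (y + t *\<^sub>R axis i 1)) differentiable (at 0)"
      by (rule differentiable_compose[of g]) (use that in auto)
    then show ?thesis
      unfolding partial_deriv_def by (rule vector_derivative_works[THEN iffD1])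
  qed
  have "((\<lambda>t. t - s) has_vector_derivative 1) (at s)"
    by (auto intro!: derivative_eq_intros)
  from vector_diff_chain_at[OF this] 0[OF assms]
  have "((\<lambda>t. g (x + s *\<^sub>R axis i 1 + t *\<^sub>R axis i 1)) \<circ> (\<lambda>t. t - s) has_vector_derivative
      1 *\<^sub>R partial_deriv i g (x + s *\<^sub>R axis i 1)) (at s)"
    by simp
  then show ?thesis by (simp add: o_def algebra_simps)
qed

lemma partial_deriv_eqI:
  "((\<lambda>t. g (x + t *\<^sub>R axis i 1)) has_vector_derivative d) (at 0) \<Longrightarrow> partial_deriv i g x = d"
  unfolding partial_deriv_def by (rule vector_derivative_at)

lemma smooth_differentiable: "smooth f \<Longrightarrow> iter_partial_deriv is f differentiable (at x)"
  by (auto simp: smooth_def differentiable_on_def)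

lemma iter_partial_deriv_add:
  assumes "smooth f" "smooth g"
  shows "iter_partial_deriv is (\<lambda>x. f x + g x) = (\<lambda>x. iter_partial_deriv is f x + iter_partial_deriv is g x)"
proof (induction "is")
  case (Cons i "is")
  show ?case
    unfolding iter_partial_deriv_simps Cons
    by (intro ext partial_deriv_eqI has_vector_derivative_add
      has_vector_derivative_partial_deriv[where s = 0, simplified] smooth_differentiable assms)
qed simp

lemma iter_partial_deriv_cmult:
  assumes "smooth f"
  shows "iter_partial_deriv is (\<lambda>x. c * f x) = (\<lambda>x. c * iter_partial_deriv is f x)"
proof (induction "is")
  case (Cons i "is")
  show ?case
    unfolding iter_partial_deriv_simps Cons
    by (intro ext partial_deriv_eqI has_vector_derivative_mult_right
      has_vector_derivative_partial_deriv[where s = 0, simplified] smooth_differentiable assms)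
qed simp

lemma iter_partial_deriv_affine:
  assumes "smooth f"
  shows "iter_partial_deriv is (\<lambda>x. f (b + c *\<^sub>R x)) =
    (\<lambda>x. of_real (c ^ length is) * iter_partial_deriv is f (b + c *\<^sub>R x))"
proof (induction "is")
  case (Cons i "is")
  let ?g = "iter_partial_deriv is f"
  show ?case
    unfolding iter_partial_deriv_simps Cons
  proof (intro ext partial_deriv_eqI)
    fix x
    have "((\<lambda>t. c * t) has_vector_derivative c) (at 0)" by (auto intro!: derivative_eq_intros)
    from vector_diff_chain_at[OF this, of "\<lambda>t. ?g (b + c *\<^sub>R x + t *\<^sub>R axis i 1)" "partial_deriv i ?g (b + c *\<^sub>R x)"]
      has_vector_derivative_partial_deriv[OF smooth_differentiable[OF assms], where s = 0, of "is" "b + c *\<^sub>R x" i]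
    have "((\<lambda>t. ?g (b + c *\<^sub>R (x + t *\<^sub>R axis i 1))) has_vector_derivative
        c *\<^sub>R partial_deriv i ?g (b + c *\<^sub>R x)) (at 0)"
      by (simp add: o_def algebra_simps)
    from has_vector_derivative_mult_right[OF this, of "of_real (c ^ length is)"]
    show "((\<lambda>t. of_real (c ^ length is) * ?g (b + c *\<^sub>R (x + t *\<^sub>R axis i 1))) has_vector_derivative
        of_real (c ^ length (i # is)) * partial_deriv i ?g (b + c *\<^sub>R x)) (at 0)"
      by (simp add: scaleR_conv_of_real mult_ac)
  qed
qed simp

lemma smooth_add: "smooth f \<Longrightarrow> smooth g \<Longrightarrow> smooth (\<lambda>x. f x + g x)"
  unfolding smooth_def
  by (subst iter_partial_deriv_add) (auto simp: smooth_def intro: differentiable_on_add)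

lemma smooth_cmult: "smooth f \<Longrightarrow> smooth (\<lambda>x. c * f x)"
  unfolding smooth_def
  by (subst iter_partial_deriv_cmult) (auto simp: smooth_def intro!: differentiable_on_mult)

lemma smooth_affine:
  assumes "smooth f"
  shows "smooth (\<lambda>x. f (b + c *\<^sub>R x))"
  unfolding smooth_def differentiable_on_def iter_partial_deriv_affine[OF assms]
  by (auto intro!: differentiable_mult differentiable_compose[of "iter_partial_deriv _ f"] smooth_differentiable assms)

lemma schwartz_smooth: "f \<in> schwartz_space \<Longrightarrow> smooth f"
  by (simp add: schwartz_space_def)

lemma schwartz_bound:
  "f \<in> schwartz_space \<Longrightarrow> (1 + norm x) ^ N * norm (iter_partial_deriv is f x) \<le> schwartz_seminorm N is f"
  unfolding schwartz_seminorm_def by (rule cSUP_upper) (auto simp: schwartz_space_def)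

lemma schwartz_seminorm_le:
  "(\<And>x. (1 + norm x) ^ N * norm (iter_partial_deriv is f x) \<le> B) \<Longrightarrow> schwartz_seminorm N is f \<le> B"
  unfolding schwartz_seminorm_def by (rule cSUP_least) auto

lemma schwartz_seminorm_nonneg:
  assumes "f \<in> schwartz_space"
  shows "0 \<le> schwartz_seminorm N is f"
  by (rule order_trans[OF _ schwartz_bound[OF assms, where x = 0]]) simp

lemma schwartzI:
  assumes "smooth f" "\<And>N is. \<exists>B. \<forall>x. (1 + norm x) ^ N * norm (iter_partial_deriv is f x) \<le> B"
  shows "f \<in> schwartz_space"
  using assms by (fastforce simp: schwartz_space_def bdd_above_def)

lemma schwartz_add_bound:
  assumes "f \<in> schwartz_space" "g \<in> schwartz_space"
  shows "(1 + norm x) ^ N * norm (iter_partial_deriv is (\<lambda>x. f x + g x) x) \<le>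
    schwartz_seminorm N is f + schwartz_seminorm N is g"
proof -
  have "(1 + norm x) ^ N * norm (iter_partial_deriv is (\<lambda>x. f x + g x) x) \<le>
      (1 + norm x) ^ N * (norm (iter_partial_deriv is f x) + norm (iter_partial_deriv is g x))"
    using assms by (auto simp: iter_partial_deriv_add schwartz_smooth intro!: mult_left_mono norm_triangle_ineq)
  then show ?thesis
    using schwartz_bound[OF assms(1), of x N "is"] schwartz_bound[OF assms(2), of x N "is"]
    by (simp add: distrib_left)
qed

lemma schwartz_cmult_eq:
  assumes "f \<in> schwartz_space"
  shows "(1 + norm x) ^ N * norm (iter_partial_deriv is (\<lambda>x. c * f x) x) =
    norm c * ((1 + norm x) ^ N * norm (iter_partial_deriv is f x))"
  using assms by (simp add: iter_partial_deriv_cmult schwartz_smooth norm_mult)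

lemma schwartz_add: "f \<in> schwartz_space \<Longrightarrow> g \<in> schwartz_space \<Longrightarrow> (\<lambda>x. f x + g x) \<in> schwartz_space"
  by (rule schwartzI) (auto intro: smooth_add schwartz_smooth schwartz_add_bound)

lemma schwartz_cmult: "f \<in> schwartz_space \<Longrightarrow> (\<lambda>x. c * f x) \<in> schwartz_space"
  by (rule schwartzI, blast intro: smooth_cmult schwartz_smooth, subst schwartz_cmult_eq)
     (blast intro: mult_left_mono[OF schwartz_bound norm_ge_zero])+

text \<open>Solving y = b + c x for x gives the three factors. The translation \<open>b\<close>
  enters only through an \<open>N\<close>-th power, so the seminorms of translates grow
  polynomially, with known order.\<close>

lemma affine_weight_bound:
  fixes b x :: "'a::real_normed_vector"
  assumes "c \<noteq> 0"
  shows "(1 + norm x) ^ N \<le> (1 + 1 / \<bar>c\<bar>) ^ N * (1 + norm b) ^ N * (1 + norm (b + c *\<^sub>R x)) ^ N"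
proof -
  let ?y = "b + c *\<^sub>R x"
  have "\<bar>c\<bar> * norm x \<le> norm ?y + norm b"
    using norm_triangle_ineq4[of ?y b] by simp
  then have "norm x \<le> 1 / \<bar>c\<bar> * (norm ?y + norm b)" using assms by (simp add: field_simps)
  moreover have "0 \<le> norm ?y * norm b" "0 \<le> 1 / \<bar>c\<bar> * (norm b * norm ?y)" by simp_all
  moreover have "(1 + 1 / \<bar>c\<bar>) * (1 + norm b) * (1 + norm ?y) =
      1 + norm b + norm ?y + norm ?y * norm b + 1 / \<bar>c\<bar> * (norm ?y + norm b) + 1 / \<bar>c\<bar> * (norm b * norm ?y) + 1 / \<bar>c\<bar>"
    by (simp add: algebra_simps add_divide_distrib)
  moreover have "0 \<le> 1 / \<bar>c\<bar>" by simp
  ultimately have "1 + norm x \<le> (1 + 1 / \<bar>c\<bar>) * (1 + norm b) * (1 + norm ?y)"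
    using norm_ge_zero[of b] norm_ge_zero[of ?y] by linarith
  from power_mono[OF this, of N] show ?thesis by (simp add: power_mult_distrib)
qed

lemma schwartz_affine_bound:
  assumes "f \<in> schwartz_space" "c \<noteq> 0"
  shows "(1 + norm x) ^ N * norm (iter_partial_deriv is (\<lambda>x. f (b + c *\<^sub>R x)) x) \<le>
    \<bar>c\<bar> ^ length is * (1 + 1 / \<bar>c\<bar>) ^ N * (1 + norm b) ^ N * schwartz_seminorm N is f"
proof -
  let ?y = "b + c *\<^sub>R x" and ?k = "\<bar>c\<bar> ^ length is" and ?w = "(1 + 1 / \<bar>c\<bar>) ^ N * (1 + norm b) ^ N"
  have "(1 + norm x) ^ N * norm (iter_partial_deriv is (\<lambda>x. f (b + c *\<^sub>R x)) x) =
      (1 + norm x) ^ N * (?k * norm (iter_partial_deriv is f ?y))"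
    using assms by (simp add: iter_partial_deriv_affine schwartz_smooth norm_mult norm_power)
  also have "\<dots> \<le> (?w * (1 + norm ?y) ^ N) * (?k * norm (iter_partial_deriv is f ?y))"
    by (intro mult_right_mono affine_weight_bound assms) auto
  also have "\<dots> = (?k * ?w) * ((1 + norm ?y) ^ N * norm (iter_partial_deriv is f ?y))"
    by (simp add: mult_ac)
  also have "\<dots> \<le> (?k * ?w) * schwartz_seminorm N is f"
    by (intro mult_left_mono schwartz_bound assms) auto
  finally show ?thesis by (simp add: mult.assoc)
qed

lemma schwartz_affine:
  "f \<in> schwartz_space \<Longrightarrow> c \<noteq> 0 \<Longrightarrow> (\<lambda>x. f (b + c *\<^sub>R x)) \<in> schwartz_space"
  by (rule schwartzI) (auto intro: smooth_affine schwartz_smooth schwartz_affine_bound)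

lemma schwartz_iter_partial_deriv:
  assumes "f \<in> schwartz_space"
  shows "iter_partial_deriv is f \<in> schwartz_space"
proof -
  have app: "iter_partial_deriv js (iter_partial_deriv is f) = iter_partial_deriv (js @ is) f" for js
    by (simp add: iter_partial_deriv_def)
  show ?thesis
    by (rule schwartzI) (use assms app in \<open>auto simp: smooth_def schwartz_space_def intro: schwartz_bound[OF assms]\<close>)
qed

text \<open>The function is dominated by a sum over k of indicators of cubes of half side k + 1 with
  weights (k + 1)^-(n + 2). The volumes use up n of these powers and leave the summable (k +
  1)^-2.\<close>

lemma integrable_norm_decay:
  "integrable lborel (\<lambda>x::'a::euclidean_space. 1 / (1 + norm x) ^ (DIM('a) + 2))"
proof -
  define n where "n = DIM('a)"
  define Q where "Q k = cbox (- real (Suc k) *\<^sub>R One) (real (Suc k) *\<^sub>R One :: 'a)" for k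
  define f where "f k x = 1 / real (Suc k) ^ (n + 2) * indicator (Q k) x" for k and x :: 'a
  have mQ: "measure lborel (Q k) = (2 * real (Suc k)) ^ n" for k
  proof -
    have "\<forall>b\<in>Basis. (- real (Suc k) *\<^sub>R One) \<bullet> b \<le> (real (Suc k) *\<^sub>R One :: 'a) \<bullet> b" by simp
    then have "measure lborel (Q k) = (\<Prod>b\<in>(Basis::'a set). 2 * real (Suc k))"
      unfolding Q_def by (subst content_cbox) (auto simp: algebra_simps intro!: prod.cong)
    then show ?thesis by (simp add: n_def)
  qed
  have intf: "integrable lborel (f k)" for k
    unfolding f_def[abs_def] Q_def by (intro integrable_mult_right) auto
  have sq: "summable (\<lambda>k. 1 / real (Suc k) ^ 2)"
    using inverse_power_summable[of 2, where 'a = real] summable_Suc_iff[of "\<lambda>k. inverse (real k ^ 2)"]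
    by (simp add: inverse_eq_divide del: of_nat_Suc)
  have f0: "0 \<le> f k x" for k x by (simp add: f_def)
  have s1: "summable (\<lambda>k. norm (f k x))" for x
  proof (rule summable_comparison_test'[OF sq])
    fix k
    have "real (Suc k) ^ 2 \<le> real (Suc k) ^ (n + 2)" by (intro power_increasing) auto
    then have "1 / real (Suc k) ^ (n + 2) \<le> 1 / real (Suc k) ^ 2" by (intro divide_left_mono) auto
    then show "norm (norm (f k x)) \<le> 1 / real (Suc k) ^ 2"
      by (auto simp: f_def indicator_def simp del: of_nat_Suc)
  qed
  have "(LINT x|lborel. norm (f k x)) = 2 ^ n * (1 / real (Suc k) ^ 2)" for k
  proof -
    have "(LINT x|lborel. norm (f k x)) = 1 / real (Suc k) ^ (n + 2) * measure lborel (Q k)"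
      using f0 by (simp add: f_def Q_def)
    then show ?thesis
      by (simp add: mQ power_mult_distrib power_add power2_eq_square del: of_nat_Suc)
  qed
  then have s2: "summable (\<lambda>k. LINT x|lborel. norm (f k x))"
    using summable_mult[OF sq, of "2 ^ n"] by simp
  have I: "integrable lborel (\<lambda>x. \<Sum>k. f k x)"
    by (rule integrable_suminf[OF intf _ s2]) (use s1 in auto)
  show ?thesis
  proof (rule Bochner_Integration.integrable_bound[OF I])
    show "AE x in lborel. norm (1 / (1 + norm x) ^ (DIM('a) + 2)) \<le> norm (\<Sum>k. f k (x::'a))"
    proof (intro AE_I2)
      fix x :: 'a
      \<comment> \<open>As k <= |x| < k + 1, the point lies in the cube of index \<open>k\<close>,
        and the weight of this cube alone is at least the value at x.\<close>
      define k where "k = nat \<lfloor>norm x\<rfloor>"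
      have "real k = of_int \<lfloor>norm x\<rfloor>" by (simp add: k_def)
      then have k: "real k \<le> norm x" "norm x < real k + 1" by linarith+
      have "\<bar>x \<bullet> b\<bar> \<le> real (Suc k)" if "b \<in> Basis" for b
        using Basis_le_norm[OF that, of x] k by simp
      then have "x \<in> Q k" unfolding Q_def mem_box by (force simp: abs_le_iff)
      then have "1 / (1 + norm x) ^ (n + 2) \<le> f k x"
        using k power_mono[of "1 + real k" "1 + norm x" "n + 2"]
        by (auto simp: f_def field_simps simp del: power_Suc power_Suc2 power_add)
      also have "\<dots> \<le> (\<Sum>k. f k x)"
        using sum_le_suminf[of "\<lambda>k. f k x" "{k}"] s1[of x] f0 by auto
      finally show "norm (1 / (1 + norm x) ^ (DIM('a) + 2)) \<le> norm (\<Sum>k. f k x)"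
        by (simp add: n_def)
    qed
  qed measurable
qed

text \<open>Only decay is recorded, not smoothness: the class is closed under multiplication by
  coordinates without any product rule for derivatives.\<close>

definition rapidly_decreasing :: "('a::euclidean_space \<Rightarrow> complex) \<Rightarrow> bool" where
  "rapidly_decreasing f \<longleftrightarrow> f \<in> borel_measurable borel \<and>
    (\<forall>N. \<exists>B. \<forall>x. (1 + norm x) ^ N * norm (f x) \<le> B)"

lemma rapidly_decreasing_integrable:
  fixes f :: "'a::euclidean_space \<Rightarrow> complex"
  assumes "rapidly_decreasing f"
  shows "integrable lborel f"
proof -
  obtain B where B: "\<And>x. (1 + norm x) ^ (DIM('a) + 2) * norm (f x) \<le> B"
    using assms unfolding rapidly_decreasing_def by blast
  show ?thesis
  proof (rule Bochner_Integration.integrable_bound)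
    show "integrable lborel (\<lambda>x::'a. B * (1 / (1 + norm x) ^ (DIM('a) + 2)))"
      by (intro integrable_mult_right integrable_norm_decay)
    have p: "0 < (1 + norm x) ^ (DIM('a) + 2)" for x :: 'a
      by (intro zero_less_power) (use norm_ge_zero[of x] in linarith)
    have "norm (f x) \<le> B * (1 / (1 + norm x) ^ (DIM('a) + 2))" for x
      using B[of x] p[of x] by (simp add: pos_le_divide_eq mult.commute del: power_add)
    then show "AE x in lborel. norm (f x) \<le> norm (B * (1 / (1 + norm x) ^ (DIM('a) + 2)))"
      unfolding real_norm_def by (intro AE_I2 order_trans[OF _ abs_ge_self])
  qed (use assms in \<open>auto simp: rapidly_decreasing_def\<close>)
qed

lemma schwartz_continuous: "f \<in> schwartz_space \<Longrightarrow> continuous_on UNIV f"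
  using smooth_differentiable[OF schwartz_smooth, of f "[]"]
  by (auto intro!: differentiable_imp_continuous_on simp: differentiable_on_def)

lemma schwartz_rapidly_decreasing:
  assumes "f \<in> schwartz_space"
  shows "rapidly_decreasing f"
  using schwartz_bound[OF assms, of _ _ "[]"] schwartz_continuous[OF assms]
  by (auto simp: rapidly_decreasing_def intro: borel_measurable_continuous_onI)

lemma schwartz_integrable: "f \<in> schwartz_space \<Longrightarrow> integrable lborel f"
  by (intro rapidly_decreasing_integrable schwartz_rapidly_decreasing)

section \<open>Zeros of the Fourier transform, moments and derivatives\<close>

lemma tendsto_exp_diff_quotient:
  fixes a :: complex
  assumes h: "h \<longlonglongrightarrow> 0" "\<And>k. h k \<noteq> 0"
  shows "(\<lambda>k. (exp (a * of_real (h k)) - 1) / of_real (h k)) \<longlonglongrightarrow> a"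
proof -
  have "((\<lambda>z. exp (a * z)) has_field_derivative a) (at 0)"
    by (auto intro!: derivative_eq_intros)
  then have "(\<lambda>z. (exp (a * z) - 1) / z) \<midarrow>0\<rightarrow> a" by (simp add: DERIV_def)
  moreover have "filterlim (\<lambda>k. of_real (h k) :: complex) (at 0) sequentially"
    using tendsto_of_real[OF h(1), where 'a = complex] h(2)
    by (auto simp: filterlim_at)
  ultimately show ?thesis by (rule filterlim_compose)
qed

lemma has_vector_derivative_imp_diff_quotient:
  fixes F :: "real \<Rightarrow> 'a::real_normed_vector"
  assumes "(F has_vector_derivative d) (at 0)"
  shows "((\<lambda>t. (F t - F 0) /\<^sub>R t) \<longlongrightarrow> d) (at 0)"
proof -
  have "((\<lambda>t. norm (F t - F 0 - t *\<^sub>R d) / norm t) \<longlongrightarrow> 0) (at 0)"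
    using assms by (simp add: has_vector_derivative_def has_derivative_iff_norm)
  moreover have "\<forall>\<^sub>F t in at 0. norm (F t - F 0 - t *\<^sub>R d) / norm t = norm ((F t - F 0) /\<^sub>R t - d)"
  proof (intro eventually_at_topological[THEN iffD2] exI[of _ UNIV] conjI ballI impI)
    fix t :: real assume "t \<noteq> 0"
    then have "(F t - F 0) /\<^sub>R t - d = (F t - F 0 - t *\<^sub>R d) /\<^sub>R t"
      by (simp add: scaleR_diff_right)
    then show "norm (F t - F 0 - t *\<^sub>R d) / norm t = norm ((F t - F 0) /\<^sub>R t - d)"
      by (simp add: divide_inverse mult.commute)
  qed auto
  ultimately have "((\<lambda>t. norm ((F t - F 0) /\<^sub>R t - d)) \<longlongrightarrow> 0) (at 0)"
    by (rule Lim_transform_eventually)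
  then show ?thesis by (simp add: tendsto_norm_zero_iff LIM_zero_iff)
qed

lemma rapidly_decreasing_mult_coord:
  fixes f :: "real ^ 'n::finite \<Rightarrow> complex"
  assumes "rapidly_decreasing f"
  shows "rapidly_decreasing (\<lambda>x. of_real (x $ i) * f x)"
  unfolding rapidly_decreasing_def
proof (intro conjI allI)
  have [measurable]: "f \<in> borel_measurable borel" using assms by (simp add: rapidly_decreasing_def)
  show "(\<lambda>x. of_real (x $ i) * f x) \<in> borel_measurable borel" by measurable
  fix N
  obtain B where B: "\<And>x. (1 + norm x) ^ Suc N * norm (f x) \<le> B"
    using assms unfolding rapidly_decreasing_def by blast
  have "(1 + norm x) ^ N * norm (of_real (x $ i) * f x) \<le> B" for x
  proof -
    have "\<bar>x $ i\<bar> \<le> 1 + norm x" using component_le_norm_cart[of x i] by simp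
    then have "(1 + norm x) ^ N * norm (f x) * \<bar>x $ i\<bar> \<le> (1 + norm x) ^ N * norm (f x) * (1 + norm x)"
      by (intro mult_left_mono) auto
    also have "\<dots> \<le> B" using B[of x] by (simp add: mult_ac)
    finally show ?thesis by (simp add: norm_mult mult_ac)
  qed
  then show "\<exists>B. \<forall>x. (1 + norm x) ^ N * norm (of_real (x $ i) * f x) \<le> B" by blast
qed

text \<open>Up to a constant, multiplication by x_i differentiates the transform. Inside the ball
  its difference quotients in direction i vanish, and |exp(i s) - 1| <= |s| dominates their
  integrands by |x_i f|.\<close>

lemma fourier_mult_coord_eq_0:
  fixes f :: "real ^ 'n::finite \<Rightarrow> complex"
  assumes f: "rapidly_decreasing f" and r: "\<And>\<xi>. norm \<xi> < r \<Longrightarrow> fourier f \<xi> = 0" and \<xi>: "norm \<xi> < r"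
  shows "fourier (\<lambda>x. of_real (x $ i) * f x) \<xi> = 0"
proof -
  \<comment> \<open>The denominator k + 2 keeps the step strictly below r - norm xi already for k =
    0, so the shifted frequency stays in the ball.\<close>
  define h where "h k = (r - norm \<xi>) / real (k + 2)" for k
  have h0: "0 < h k" "h k < r - norm \<xi>" for k
    using \<xi> divide_strict_left_mono[of 1 "real (k + 2)" "r - norm \<xi>"] by (simp_all add: h_def)
  have hlim: "h \<longlonglongrightarrow> 0" unfolding h_def by real_asymp
  let ?g = "\<lambda>x. of_real (x $ i) * f x"
  let ?E = "\<lambda>x. exp (- \<i> * of_real (x \<bullet> \<xi>))"
  have f_int: "integrable lborel f" and g_int: "integrable lborel ?g"
    using f by (auto intro: rapidly_decreasing_integrable rapidly_decreasing_mult_coord)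
  have [measurable]: "f \<in> borel_measurable borel" using f by (simp add: rapidly_decreasing_def)
  define s where "s k x = ?E x * ((exp (- \<i> * of_real (x $ i) * of_real (h k)) - 1) / of_real (h k)) * f x" for k x
  have seq: "s k x = (exp (- \<i> * of_real (x \<bullet> (\<xi> + h k *\<^sub>R axis i 1))) * f x - ?E x * f x) / of_real (h k)" for k x
  proof -
    have "exp (- \<i> * of_real (x \<bullet> (\<xi> + h k *\<^sub>R axis i 1))) = ?E x * exp (- \<i> * of_real (x $ i) * of_real (h k))"
      by (simp add: inner_add_right inner_axis distrib_left mult_ac flip: exp_add)
    then show ?thesis by (simp only: s_def) (simp add: diff_divide_distrib algebra_simps)
  qed
  have s0: "(LINT x|lborel. s k x) = 0" for k
  proof -
    have "norm (\<xi> + h k *\<^sub>R axis i 1) \<le> norm \<xi> + h k"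
      using norm_triangle_ineq[of \<xi> "h k *\<^sub>R axis i 1"] h0[of k] by simp
    then have "fourier f (\<xi> + h k *\<^sub>R axis i 1) = 0" "fourier f \<xi> = 0"
      using h0[of k] \<xi> by (auto intro!: r)
    moreover have "(LINT x|lborel. exp (- \<i> * of_real (x \<bullet> (\<xi> + h k *\<^sub>R axis i 1))) * f x - ?E x * f x) =
        fourier f (\<xi> + h k *\<^sub>R axis i 1) - fourier f \<xi>"
      unfolding fourier_def by (intro Bochner_Integration.integral_diff integrable_fourier f_int)
    ultimately show ?thesis unfolding seq integral_divide_zero by simp
  qed
  have "(\<lambda>k. LINT x|lborel. s k x) \<longlonglongrightarrow> (LINT x|lborel. ?E x * (- \<i> * of_real (x $ i)) * f x)"
  proof (rule integral_dominated_convergence)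
    show "integrable lborel (\<lambda>x. norm (?g x))" using g_int by simp
    show "(\<lambda>x. ?E x * (- \<i> * of_real (x $ i)) * f x) \<in> borel_measurable lborel" by measurable
    show "s k \<in> borel_measurable lborel" for k unfolding s_def by measurable
    show "AE x in lborel. (\<lambda>k. s k x) \<longlonglongrightarrow> ?E x * (- \<i> * of_real (x $ i)) * f x"
      unfolding s_def using h0 hlim
      by (intro AE_I2 tendsto_intros tendsto_exp_diff_quotient) (auto simp: less_imp_neq[symmetric])
    show "AE x in lborel. norm (s k x) \<le> norm (?g x)" for k
    proof (intro AE_I2)
      fix x
      have "norm (exp (- \<i> * of_real (x $ i) * of_real (h k)) - 1) = 2 * \<bar>sin (- (x $ i * h k) / 2)\<bar>"
        using dist_exp_i_1[of "- (x $ i * h k)"] by (simp add: mult_ac)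
      also have "\<dots> \<le> 2 * \<bar>- (x $ i * h k) / 2\<bar>" by (intro mult_left_mono abs_sin_x_le_abs_x) auto
      also have "\<dots> = \<bar>x $ i\<bar> * h k" using h0[of k] by (simp add: abs_mult)
      finally have "norm ((exp (- \<i> * of_real (x $ i) * of_real (h k)) - 1) / of_real (h k)) \<le> \<bar>x $ i\<bar>"
        using h0[of k] by (simp add: norm_divide divide_le_eq)
      from mult_right_mono[OF this, of "norm (f x)"] show "norm (s k x) \<le> norm (?g x)"
        unfolding s_def norm_mult by (simp add: norm_exp_eq_Re)
    qed
  qed
  then have "(LINT x|lborel. ?E x * (- \<i> * of_real (x $ i)) * f x) = 0"
    by (simp add: s0 LIMSEQ_const_iff)
  moreover have "(\<lambda>x. ?E x * (- \<i> * of_real (x $ i)) * f x) = (\<lambda>x. - \<i> * (?E x * ?g x))"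
    by (simp add: fun_eq_iff)
  ultimately have "(LINT x|lborel. - \<i> * (?E x * ?g x)) = 0" by (simp only:)
  then show ?thesis unfolding fourier_def integral_mult_right_zero by simp
qed

text \<open>Moments are derivatives of the transform at the origin. The class \<open>V\<close> is
  stable under multiplication by coordinates, so it contains every monomial multiple of
  \<open>f\<close>.\<close>

lemma schwartz_inftyI:
  fixes f :: "real ^ 'n::finite \<Rightarrow> complex"
  assumes f: "f \<in> schwartz_space" and r: "0 < r" "\<And>\<xi>. norm \<xi> < r \<Longrightarrow> fourier f \<xi> = 0"
  shows "f \<in> schwartz_infty"
proof -
  define V where "V = {g. rapidly_decreasing g \<and> (\<forall>\<xi>::real^'n. norm \<xi> < r \<longrightarrow> fourier g \<xi> = 0)}"
  have step: "(\<lambda>x. of_real (x $ i) * g x) \<in> V" if "g \<in> V" for g i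
    using that fourier_mult_coord_eq_0[of g r _ i] by (auto simp: V_def rapidly_decreasing_mult_coord)
  have pow: "(\<lambda>x. of_real (x $ i ^ k) * g x) \<in> V" if "g \<in> V" for g i k
  proof (induction k)
    case (Suc k)
    from step[OF this, of i] show ?case by (simp add: mult.assoc)
  qed (use that in simp)
  have "(\<lambda>x. of_real (\<Prod>i\<in>I. x $ i ^ \<gamma> i) * f x) \<in> V" if "finite I" for I and \<gamma> :: "'n \<Rightarrow> nat"
    using that
  proof (induction I rule: finite_induct)
    case empty
    then show ?case using f r(2) by (auto simp: V_def schwartz_rapidly_decreasing)
  next
    case (insert i I)
    from pow[OF insert(3), of i "\<gamma> i"] show ?case using insert(1,2) by (simp add: mult.assoc)
  qed
  then have "fourier (\<lambda>x. of_real (\<Prod>i\<in>UNIV. x $ i ^ \<gamma> i) * f x) 0 = 0" for \<gamma> :: "'n \<Rightarrow> nat"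
    using r(1) by (auto simp: V_def)
  then show ?thesis using f by (simp add: schwartz_infty_def fourier_def mult.commute)
qed

text \<open>Difference quotients of \<open>f\<close> take the place of an integration by parts. A
  translation multiplies the transform by a phase, so its zeros persist; the mean value inequality
  supplies the integrable bound for passing to the derivative.\<close>

lemma fourier_partial_deriv_eq_0:
  fixes f :: "real ^ 'n::finite \<Rightarrow> complex"
  assumes f: "f \<in> schwartz_space" and 0: "fourier f \<xi> = 0"
  shows "fourier (partial_deriv i f) \<xi> = 0"
proof -
  let ?g = "partial_deriv i f"
  let ?E = "\<lambda>x. exp (- \<i> * of_real (x \<bullet> \<xi>))"
  define h where "h k = 1 / real (k + 1)" for k
  have h0: "0 < h k" "h k \<le> 1" for k by (auto simp: h_def)
  have hlim: "h \<longlonglongrightarrow> 0" unfolding h_def by real_asymp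
  have g: "?g \<in> schwartz_space" using schwartz_iter_partial_deriv[OF f, of "[i]"] by simp
  define M where "M = DIM(real^'n) + 2"
  obtain C where C: "\<And>x. (1 + norm x) ^ M * norm (?g x) \<le> C"
    using schwartz_rapidly_decreasing[OF g] unfolding rapidly_decreasing_def by blast
  have D: "((\<lambda>t. f (x + t *\<^sub>R axis i 1)) has_vector_derivative ?g (x + s *\<^sub>R axis i 1)) (at s)" for x s
    using has_vector_derivative_partial_deriv[OF smooth_differentiable[OF schwartz_smooth[OF f], of "[]"]] by simp
  define q where "q k x = (f (x + h k *\<^sub>R axis i 1) - f x) / of_real (h k)" for k x
  have fi: "integrable lborel f" and fm: "integrable lborel (\<lambda>x. f (x + h k *\<^sub>R axis i 1))" for k
    using schwartz_integrable[OF f] integrable_lborel_affine[of f 1 "h k *\<^sub>R axis i 1"]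
    by (auto simp: add.commute)
  have [measurable]: "f \<in> borel_measurable borel" "?g \<in> borel_measurable borel" "q k \<in> borel_measurable borel" for k
    using fi fm[of k] schwartz_integrable[OF g] unfolding q_def[abs_def] by auto
  have q0: "(LINT x|lborel. ?E x * q k x) = 0" for k
  proof -
    have "fourier (\<lambda>x. f (x + h k *\<^sub>R axis i 1)) \<xi> = 0"
      using fourier_affine[OF fi, of 1 "h k *\<^sub>R axis i 1" \<xi>] 0 by (simp add: add.commute)
    moreover have "(LINT x|lborel. ?E x * q k x) =
        (LINT x|lborel. (?E x * f (x + h k *\<^sub>R axis i 1) - ?E x * f x) / of_real (h k))"
      unfolding q_def by (simp add: right_diff_distrib)
    moreover have "(LINT x|lborel. ?E x * f (x + h k *\<^sub>R axis i 1) - ?E x * f x) =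
        fourier (\<lambda>x. f (x + h k *\<^sub>R axis i 1)) \<xi> - fourier f \<xi>"
      unfolding fourier_def by (intro Bochner_Integration.integral_diff integrable_fourier fi fm)
    ultimately show ?thesis using 0 by simp
  qed
  have "(\<lambda>k. LINT x|lborel. ?E x * q k x) \<longlonglongrightarrow> (LINT x|lborel. ?E x * ?g x)"
  proof (rule integral_dominated_convergence)
    show "integrable lborel (\<lambda>x::real^'n. 2 ^ M * C * (1 / (1 + norm x) ^ M))"
      unfolding M_def by (intro integrable_mult_right integrable_norm_decay)
    show "(\<lambda>x. ?E x * ?g x) \<in> borel_measurable lborel" "(\<lambda>x. ?E x * q k x) \<in> borel_measurable lborel" for k
      by measurable
    show "AE x in lborel. (\<lambda>k. ?E x * q k x) \<longlonglongrightarrow> ?E x * ?g x"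
    proof (intro AE_I2 tendsto_intros)
      fix x
      have "((\<lambda>t. (f (x + t *\<^sub>R axis i 1) - f x) /\<^sub>R t) \<longlongrightarrow> ?g x) (at 0)"
        using has_vector_derivative_imp_diff_quotient[OF D[of x 0, simplified]] by simp
      moreover have "filterlim h (at 0) sequentially"
        using hlim h0(1) by (auto simp: filterlim_at less_imp_neq[symmetric])
      ultimately have "(\<lambda>k. (f (x + h k *\<^sub>R axis i 1) - f x) /\<^sub>R h k) \<longlonglongrightarrow> ?g x"
        by (rule filterlim_compose)
      then show "(\<lambda>k. q k x) \<longlonglongrightarrow> ?g x"
        by (simp add: q_def scaleR_conv_of_real divide_inverse mult.commute)
    qed
    show "AE x in lborel. norm (?E x * q k x) \<le> 2 ^ M * C * (1 / (1 + norm x) ^ M)" for k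
    proof (intro AE_I2)
      fix x
      have "\<exists>s\<in>{0<..<h k}. norm (f (x + h k *\<^sub>R axis i 1) - f (x + 0 *\<^sub>R axis i 1)) \<le>
          norm ((h k - 0) *\<^sub>R ?g (x + s *\<^sub>R axis i 1))"
        by (rule mvt_general[OF h0(1)])
           (use D in \<open>auto simp: has_vector_derivative_def intro!: continuous_at_imp_continuous_on has_vector_derivative_continuous\<close>)
      then obtain s where s: "0 < s" "s < h k"
        "norm (f (x + h k *\<^sub>R axis i 1) - f x) \<le> h k * norm (?g (x + s *\<^sub>R axis i 1))"
        using h0[of k] by auto
      let ?y = "x + s *\<^sub>R axis i 1"
      have "norm x \<le> norm ?y + s"
        using norm_triangle_ineq4[of ?y "s *\<^sub>R axis i 1"] s by simp
      \<comment> \<open>The steps are at most 1, so passing to the intermediate point at most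
        doubles the weight.\<close>
      then have "1 + norm x \<le> 2 * (1 + norm ?y)" using s h0[of k] norm_ge_zero[of ?y] by argo
      then have "(1 + norm x) ^ M \<le> 2 ^ M * (1 + norm ?y) ^ M"
        using power_mono[of "1 + norm x" "2 * (1 + norm ?y)" M] by (simp only: power_mult_distrib) simp
      then have "(1 + norm x) ^ M * norm (?g ?y) \<le> 2 ^ M * ((1 + norm ?y) ^ M * norm (?g ?y))"
        unfolding mult.assoc[symmetric] by (rule mult_right_mono) simp
      also have "\<dots> \<le> 2 ^ M * C" by (intro mult_left_mono C) simp
      finally have "norm (?g ?y) \<le> 2 ^ M * C * (1 / (1 + norm x) ^ M)"
        using zero_less_power[OF add_pos_nonneg[OF zero_less_one norm_ge_zero[of x]], of M]
        by (simp add: pos_le_divide_eq mult.commute)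
      moreover have "norm (?E x * q k x) \<le> norm (?g ?y)"
        using s h0[of k] by (simp add: norm_mult norm_exp_eq_Re q_def norm_divide divide_le_eq mult.commute)
      ultimately show "norm (?E x * q k x) \<le> 2 ^ M * C * (1 / (1 + norm x) ^ M)" by linarith
    qed
  qed
  then show ?thesis unfolding fourier_def q0 by (simp only: LIMSEQ_const_iff)
qed

lemma fourier_iter_partial_deriv_eq_0:
  assumes "f \<in> schwartz_space" "fourier f \<xi> = 0"
  shows "fourier (iter_partial_deriv is f) \<xi> = 0"
  by (induction "is") (use assms in \<open>auto intro: fourier_partial_deriv_eq_0 schwartz_iter_partial_deriv\<close>)

text \<open>Additivity of the integral requires integrable summands, so monomial multiples of
  Schwartz functions are first shown to decrease rapidly.\<close>

lemma schwartz_infty_add: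
  assumes "f \<in> schwartz_infty" "g \<in> schwartz_infty"
  shows "(\<lambda>x. f x + g x) \<in> schwartz_infty"
proof -
  have i: "integrable lborel (\<lambda>x. h x * of_real (\<Prod>i\<in>UNIV. x $ i ^ \<gamma> i))"
    if "h \<in> schwartz_space" for h :: "real ^ 'a \<Rightarrow> complex" and \<gamma>
  proof -
    have pow: "rapidly_decreasing (\<lambda>x. of_real (x $ i ^ k) * g x)" if "rapidly_decreasing g" for g :: "real ^ 'a \<Rightarrow> complex" and i k
    proof (induction k)
      case (Suc k)
      from rapidly_decreasing_mult_coord[OF this, of i] show ?case by (simp add: mult.assoc)
    qed (use that in simp)
    have "rapidly_decreasing (\<lambda>x. of_real (\<Prod>i\<in>I. x $ i ^ \<gamma> i) * h x)" if "finite I" for I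
      using that
    proof (induction I rule: finite_induct)
      case empty then show ?case using \<open>h \<in> schwartz_space\<close> by (simp add: schwartz_rapidly_decreasing)
    next
      case (insert i I)
      from pow[OF insert(3), of i "\<gamma> i"] show ?case using insert(1,2) by (simp add: mult.assoc)
    qed
    then show ?thesis by (simp add: rapidly_decreasing_integrable mult.commute)
  qed
  show ?thesis
    using assms Bochner_Integration.integral_add[OF i i, of f g]
    by (auto simp: schwartz_infty_def schwartz_add distrib_right simp del: of_real_prod)
qed

lemma schwartz_infty_cmult:
  "f \<in> schwartz_infty \<Longrightarrow> (\<lambda>x. c * f x) \<in> schwartz_infty"
  by (auto simp: schwartz_infty_def schwartz_cmult mult.assoc)

section \<open>Functionals on the Schwartz space\<close>

text \<open>A generating ball has one seminorm and an arbitrary centre; if it contains 0, the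
  triangle inequality fits a ball of the same seminorm around 0 into it. Finite intersections
  collect finitely many seminorms.\<close>

lemma schwartz_topology_neighbourhood_0:
  fixes U :: "(real ^ 'n::finite \<Rightarrow> complex) set"
  assumes "openin schwartz_topology U" "(\<lambda>x. 0) \<in> U"
  shows "\<exists>F e. finite F \<and> 0 < e \<and>
    {g \<in> schwartz_space. \<forall>(N, is) \<in> F. schwartz_seminorm N is g < e} \<subseteq> U"
  using assms unfolding schwartz_topology_def openin_topology_generated_by_iff
proof (induction rule: generate_topology_on.induct)
  case (Int a b)
  then obtain F e F' e' where *: "finite F" "0 < e" "finite F'" "0 < e'"
    "{g \<in> schwartz_space. \<forall>(N, is) \<in> F. schwartz_seminorm N is g < e} \<subseteq> a"
    "{g \<in> schwartz_space. \<forall>(N, is) \<in> F'. schwartz_seminorm N is g < e'} \<subseteq> b"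
    by auto
  show ?case
    by (rule exI[of _ "F \<union> F'"], rule exI[of _ "min e e'"]) (use * in fastforce)
next
  case (UN K)
  then obtain k where k: "k \<in> K" "(\<lambda>x. 0) \<in> k" by blast
  from UN(2)[OF this] obtain F e where
    "finite F" "0 < e" "{g \<in> schwartz_space. \<forall>(N, is) \<in> F. schwartz_seminorm N is g < e} \<subseteq> k"
    by blast
  with k(1) show ?case by (intro exI[of _ F] exI[of _ e]) blast
next
  case (Basis s)
  then obtain h N "is" e where h: "h \<in> schwartz_space"
    and s: "s = {g \<in> schwartz_space. schwartz_seminorm N is (\<lambda>x. g x - h x) < e}"
    by blast
  define k where "k = (\<lambda>x. - 1 * h x)"
  have k: "k \<in> schwartz_space" unfolding k_def by (rule schwartz_cmult[OF h])
  have gh: "(\<lambda>x. g x - h x) = (\<lambda>x. g x + k x)" for g by (simp add: k_def)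
  have pos: "0 < e - schwartz_seminorm N is k" using Basis(2) by (simp add: s gh)
  have "{g \<in> schwartz_space. schwartz_seminorm N is g < e - schwartz_seminorm N is k} \<subseteq> s"
    unfolding s gh
  proof safe
    fix g :: "real ^ 'n \<Rightarrow> complex"
    assume g: "g \<in> schwartz_space" "schwartz_seminorm N is g < e - schwartz_seminorm N is k"
    have "schwartz_seminorm N is (\<lambda>x. g x + k x) \<le> schwartz_seminorm N is g + schwartz_seminorm N is k"
      by (intro schwartz_seminorm_le schwartz_add_bound g k)
    then show "schwartz_seminorm N is (\<lambda>x. g x + k x) < e" using g by linarith
  qed
  then show ?case using pos
    by (intro exI[of _ "{(N, is)}"] exI[of _ "e - schwartz_seminorm N is k"]) auto
qed simp

lemma schwartz_seminorm_cmult_le: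
  assumes "f \<in> schwartz_space"
  shows "schwartz_seminorm N is (\<lambda>x. c * f x) \<le> norm c * schwartz_seminorm N is f"
  by (rule schwartz_seminorm_le, subst schwartz_cmult_eq[OF assms])
     (intro mult_left_mono schwartz_bound assms norm_ge_zero)

text \<open>Continuity at 0 gives |f| < 1 on a neighbourhood described by finitely many seminorms,
  and homogeneity turns this into a bound by their sum.\<close>

lemma schwartz_infty_dual_bound:
  fixes f :: "(real ^ 'n::finite \<Rightarrow> complex) \<Rightarrow> complex"
  assumes f: "f \<in> schwartz_infty_dual"
  shows "\<exists>F C. finite F \<and> 0 \<le> C \<and>
    (\<forall>\<psi>\<in>schwartz_infty. norm (f \<psi>) \<le> C * (\<Sum>(N, is)\<in>F. schwartz_seminorm N is \<psi>))"
proof -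
  have top: "topspace (schwartz_infty_topology :: (real ^ 'n \<Rightarrow> complex) topology) = schwartz_infty"
  proof -
    have "g \<in> topspace schwartz_topology" if "g \<in> schwartz_infty" for g :: "real ^ 'n \<Rightarrow> complex"
    proof -
      have g: "g \<in> schwartz_space" using that by (simp add: schwartz_infty_def)
      have "schwartz_seminorm 0 [] (\<lambda>x. g x - g x) \<le> 0"
        by (rule schwartz_seminorm_le) simp
      then have "g \<in> {g' \<in> schwartz_space. schwartz_seminorm 0 [] (\<lambda>x. g' x - g x) < 1}"
        using g by simp
      then show ?thesis
        unfolding schwartz_topology_def topology_generated_by_topspace
        using g by (blast intro: zero_less_one)
    qed
    then show ?thesis unfolding schwartz_infty_topology_def by auto
  qed
  have cm: "f (\<lambda>x. c * \<psi> x) = c * f \<psi>" if "\<psi> \<in> schwartz_infty" for c \<psi>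
    using f that by (simp add: schwartz_infty_dual_def)
  have z: "(\<lambda>x::real^'n. 0) \<in> schwartz_infty" if "\<psi> \<in> schwartz_infty" for \<psi> :: "real ^ 'n \<Rightarrow> complex"
    using schwartz_infty_cmult[OF that, of 0] by simp
  show ?thesis
  \<comment> \<open>The zero function is obtained as a multiple of some member of the space, hence
    the case distinction.\<close>
  proof (cases "schwartz_infty = ({} :: (real ^ 'n \<Rightarrow> complex) set)")
    case True then show ?thesis by (intro exI[of _ "{}"] exI[of _ 0]) simp
  next
    case False
    then obtain \<psi>0 :: "real ^ 'n \<Rightarrow> complex" where \<psi>0: "\<psi>0 \<in> schwartz_infty" by blast
    have f0: "f (\<lambda>x. 0) = 0" using cm[OF \<psi>0, of 0] by simp
    have "continuous_map schwartz_infty_topology euclidean f"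
      using f by (simp add: schwartz_infty_dual_def)
    from openin_continuous_map_preimage[OF this, of "ball 0 1"]
    have "openin schwartz_infty_topology {\<psi> \<in> topspace schwartz_infty_topology. f \<psi> \<in> ball 0 1}"
      by (simp del: mem_ball)
    then obtain U where U: "openin schwartz_topology U"
      "{\<psi> \<in> schwartz_infty. f \<psi> \<in> ball 0 1} = U \<inter> schwartz_infty"
      unfolding top unfolding schwartz_infty_topology_def openin_subtopology by blast
    have "(\<lambda>x. 0) \<in> {\<psi> \<in> schwartz_infty. f \<psi> \<in> ball 0 1}"
      by (simp add: f0 z[OF \<psi>0])
    then have "(\<lambda>x. 0) \<in> U" unfolding U(2) by blast
    from schwartz_topology_neighbourhood_0[OF U(1) this] obtain F e where
      F: "finite F" "0 < e" and sub: "{g \<in> schwartz_space. \<forall>(N, is) \<in> F. schwartz_seminorm N is g < e} \<subseteq> U"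
      by blast
    have small: "norm (f \<psi>) < 1"
      if "\<psi> \<in> schwartz_infty" "\<And>N is. (N, is) \<in> F \<Longrightarrow> schwartz_seminorm N is \<psi> < e" for \<psi>
    proof -
      have "\<psi> \<in> schwartz_space" using that by (simp add: schwartz_infty_def)
      then have "\<psi> \<in> U" using that(2) by (intro subsetD[OF sub]) auto
      then have "\<psi> \<in> {\<psi> \<in> schwartz_infty. f \<psi> \<in> ball 0 1}" using U(2) that(1) by blast
      then show ?thesis by simp
    qed
    have "norm (f \<psi>) \<le> 1 / e * (\<Sum>(N, is)\<in>F. schwartz_seminorm N is \<psi>)" if \<psi>: "\<psi> \<in> schwartz_infty" for \<psi>
    proof -
      let ?S = "\<Sum>(N, is)\<in>F. schwartz_seminorm N is \<psi>"
      have \<psi>s: "\<psi> \<in> schwartz_space" using \<psi> by (simp add: schwartz_infty_def)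
      have S0: "0 \<le> ?S" using schwartz_seminorm_nonneg[OF \<psi>s] by (intro sum_nonneg) auto
      \<comment> \<open>The sum of seminorms may be 0; the additional eta keeps the scaling factor
        \<open>t\<close> positive.\<close>
      have "norm (f \<psi>) * e \<le> ?S + \<eta>" if \<eta>: "0 < \<eta>" for \<eta>
      proof -
        define t where "t = e / (?S + \<eta>)"
        have t: "0 < t" using F S0 \<eta> by (simp add: t_def)
        have "schwartz_seminorm N is (\<lambda>x. of_real t * \<psi> x) < e" if "(N, is) \<in> F" for N "is"
        proof -
          have "schwartz_seminorm N is \<psi> \<le> ?S"
            using member_le_sum[OF that, of "\<lambda>(N, is). schwartz_seminorm N is \<psi>"] F
              schwartz_seminorm_nonneg[OF \<psi>s] by auto
          then have "t * schwartz_seminorm N is \<psi> < t * (?S + \<eta>)"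
            using t \<eta> by (intro mult_strict_left_mono) auto
          also have "\<dots> = e" using S0 \<eta> by (simp add: t_def)
          finally show ?thesis
            using schwartz_seminorm_cmult_le[OF \<psi>s, of N "is" "of_real t"] t by simp
        qed
        from small[OF schwartz_infty_cmult[OF \<psi>] this] have "t * norm (f \<psi>) < 1"
          using t by (simp add: cm[OF \<psi>] norm_mult)
        then show ?thesis using F S0 \<eta> by (simp add: t_def divide_less_eq mult.commute)
      qed
      then have "norm (f \<psi>) * e \<le> ?S" by (rule field_le_epsilon)
      then show ?thesis using F by (simp add: field_simps)
    qed
    then show ?thesis using F by (intro exI[of _ F] exI[of _ "1 / e"]) auto
  qed
qed

text \<open>Differences are taken in the parameter \<open>x\<close> while \<open>L\<close> acts on
  the variable \<open>y\<close>, so linearity lets them commute. \<open>L\<close> is abstract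
  because both \<open>f\<close> and the evaluation of a derivative at a point will take its
  place.\<close>

lemma linear_central_diff_power:
  fixes L :: "(real ^ 'n::finite \<Rightarrow> complex) \<Rightarrow> complex"
  assumes add: "\<And>g h. g \<in> schwartz_infty \<Longrightarrow> h \<in> schwartz_infty \<Longrightarrow> L (\<lambda>y. g y + h y) = L g + L h"
    and cmult: "\<And>c g. g \<in> schwartz_infty \<Longrightarrow> L (\<lambda>y. c * g y) = c * L g"
    and E: "\<And>x. E x \<in> schwartz_infty"
  shows "(\<lambda>y. (central_diff e ^^ m) (\<lambda>x. E x y) x) \<in> schwartz_infty \<and>
    L (\<lambda>y. (central_diff e ^^ m) (\<lambda>x. E x y) x) = (central_diff e ^^ m) (\<lambda>x. L (E x)) x"
proof (induction m arbitrary: x)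
  case 0 then show ?case using E by simp
next
  case (Suc m)
  define A where "A x = (\<lambda>y. (central_diff e ^^ m) (\<lambda>x. E x y) x)" for x
  have IH: "A x \<in> schwartz_infty" "L (A x) = (central_diff e ^^ m) (\<lambda>x. L (E x)) x" for x
    using Suc by (auto simp: A_def)
  have eq: "(\<lambda>y. (central_diff e ^^ Suc m) (\<lambda>x. E x y) x) =
      (\<lambda>y. 1 / (2 * \<i>) * A (x + (1/2) *\<^sub>R e) y + - 1 / (2 * \<i>) * A (x - (1/2) *\<^sub>R e) y)"
    by (simp add: central_diff_def A_def fun_eq_iff field_simps)
  have eq2: "(central_diff e ^^ Suc m) (\<lambda>x. L (E x)) x =
      1 / (2 * \<i>) * L (A (x + (1/2) *\<^sub>R e)) + - 1 / (2 * \<i>) * L (A (x - (1/2) *\<^sub>R e))"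
    unfolding funpow.simps o_def central_diff_def[of e "(central_diff e ^^ m) _"] IH
    by (simp add: field_simps)
  show ?case
    unfolding eq eq2
    by (subst add) (simp_all only: cmult IH(1) schwartz_infty_add schwartz_infty_cmult)
qed

text \<open>The remainder of the truncated series is kept as a single test function:
  \<open>f\<close> maps it to the error of the series for \<open>H\<close>, and evaluations of
  derivatives give its seminorms.\<close>

lemma linear_central_diff_sum:
  fixes L :: "(real ^ 'n::finite \<Rightarrow> complex) \<Rightarrow> complex"
  assumes add: "\<And>g h. g \<in> schwartz_infty \<Longrightarrow> h \<in> schwartz_infty \<Longrightarrow> L (\<lambda>y. g y + h y) = L g + L h"
    and cmult: "\<And>c g. g \<in> schwartz_infty \<Longrightarrow> L (\<lambda>y. c * g y) = c * L g"
    and E: "\<And>x. E x \<in> schwartz_infty"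
  shows "(\<lambda>y. E x' y - (\<Sum>m<K. c m * (central_diff e ^^ m) (\<lambda>x. E x y) x)) \<in> schwartz_infty \<and>
    L (\<lambda>y. E x' y - (\<Sum>m<K. c m * (central_diff e ^^ m) (\<lambda>x. E x y) x)) =
      L (E x') - (\<Sum>m<K. c m * (central_diff e ^^ m) (\<lambda>x. L (E x)) x)"
proof (induction K)
  case 0 then show ?case using E by simp
next
  case (Suc K)
  let ?A = "\<lambda>y. (central_diff e ^^ K) (\<lambda>x. E x y) x"
  have A: "?A \<in> schwartz_infty" "L ?A = (central_diff e ^^ K) (\<lambda>x. L (E x)) x"
    by (simp_all only: linear_central_diff_power[of L E, OF add cmult E])
  define B where "B = (\<lambda>y. E x' y - (\<Sum>m<K. c m * (central_diff e ^^ m) (\<lambda>x. E x y) x))"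
  define D where "D = (\<lambda>y. - c K * ?A y)"
  have D: "D \<in> schwartz_infty" "L D = - c K * (central_diff e ^^ K) (\<lambda>x. L (E x)) x"
    unfolding D_def using A(1) by (simp_all only: schwartz_infty_cmult cmult A(2))
  have B: "B \<in> schwartz_infty" "L B = L (E x') - (\<Sum>m<K. c m * (central_diff e ^^ m) (\<lambda>x. L (E x)) x)"
    using Suc by (simp_all only: B_def)
  have "(\<lambda>y. E x' y - (\<Sum>m<Suc K. c m * (central_diff e ^^ m) (\<lambda>x. E x y) x)) = (\<lambda>y. B y + D y)"
    by (simp add: fun_eq_iff B_def D_def)
  moreover have "L (\<lambda>y. B y + D y) = L (E x') - (\<Sum>m<Suc K. c m * (central_diff e ^^ m) (\<lambda>x. L (E x)) x)"
    by (simp add: add B D)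
  ultimately show ?case using schwartz_infty_add[OF B(1) D(1)] by (simp only:)
qed

text \<open>With d = norm (x - a), the inequalities 1 + |x| <= (1 + |a|) (1 + d) and 1 + d <= 2
  max(1, d) reduce the weight to max(1, d). Then |K| <= 1 settles d <= 1 and the decay settles the
  rest. The point is a bound independent of \<open>x\<close>.\<close>

lemma sinc_kernel_weight:
  fixes a x :: "real ^ 'n::finite"
  assumes \<epsilon>: "0 < \<epsilon>" and P: "P \<le> N"
  shows "(1 + norm x) ^ P * \<bar>sinc_kernel \<epsilon> N a x\<bar> \<le>
    (1 + norm a) ^ N * 2 ^ N * (1 + real CARD('n) ^ N / \<epsilon> ^ N)"
proof -
  let ?d = "norm (x - a)" and ?K = "\<bar>sinc_kernel \<epsilon> N a x\<bar>"
  have "1 + norm x \<le> (1 + norm a) * (1 + ?d)"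
  proof -
    have "(1 + norm a) * (1 + ?d) = 1 + norm a + ?d + norm a * ?d" by (simp add: algebra_simps)
    moreover have "norm x \<le> ?d + norm a" using norm_triangle_ineq[of "x - a" a] by simp
    moreover have "0 \<le> norm a * ?d" by simp
    ultimately show ?thesis by linarith
  qed
  moreover have "1 + ?d \<le> 2 * max 1 ?d" by simp
  ultimately have "1 + norm x \<le> (1 + norm a) * (2 * max 1 ?d)"
    using mult_left_mono[of "1 + ?d" "2 * max 1 ?d" "1 + norm a"] norm_ge_zero[of a] by linarith
  then have "(1 + norm x) ^ N \<le> (1 + norm a) ^ N * 2 ^ N * max 1 ?d ^ N"
    using power_mono[of "1 + norm x" "(1 + norm a) * (2 * max 1 ?d)" N]
    by (simp add: power_mult_distrib mult.assoc)
  moreover have "(1 + norm x) ^ P \<le> (1 + norm x) ^ N" using P by (intro power_increasing) auto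
  moreover have "max 1 ?d ^ N * ?K \<le> 1 + real CARD('n) ^ N / \<epsilon> ^ N"
  proof -
    have "?d ^ N * ?K \<le> real CARD('n) ^ N / \<epsilon> ^ N"
      using sinc_kernel_decay[of \<epsilon> x a N] \<epsilon> by (simp add: power_mult_distrib field_simps)
    moreover have "?K \<le> 1" by (rule abs_sinc_kernel_le_1)
    moreover have "0 \<le> real CARD('n) ^ N / \<epsilon> ^ N" "0 \<le> ?d ^ N * ?K" using \<epsilon> by auto
    moreover have "max 1 ?d ^ N * ?K = ?K \<or> max 1 ?d ^ N * ?K = ?d ^ N * ?K"
      by (simp add: max_def)
    ultimately show ?thesis by argo
  qed
  ultimately show ?thesis
    using mult_right_mono[of "(1 + norm x) ^ P" "(1 + norm a) ^ N * 2 ^ N * max 1 ?d ^ N" ?K]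
      mult_left_mono[of "max 1 ?d ^ N * ?K" _ "(1 + norm a) ^ N * 2 ^ N"]
    by (simp add: mult.assoc) (smt (verit) norm_ge_zero zero_le_power mult_left_mono mult_nonneg_nonneg)
qed

section \<open>Littlewood--Paley pieces of a functional\<close>

lemma littlewood_paley_fourier_eq_0:
  assumes "littlewood_paley \<phi>" "norm \<xi> < 1/2 \<or> 2 < norm \<xi>"
  shows "fourier \<phi> \<xi> = 0"
proof (rule ccontr)
  assume "fourier \<phi> \<xi> \<noteq> 0"
  then have "\<xi> \<in> closure {\<xi>. fourier \<phi> \<xi> \<noteq> 0}" by (intro subsetD[OF closure_subset]) simp
  then show False using assms by (auto simp: littlewood_paley_def)
qed

text \<open>The spectral gap of phi at the origin survives the affine substitution, with radius |c|
  / 2, and forces all moments to vanish.\<close>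

lemma littlewood_paley_translate_schwartz_infty:
  fixes \<phi> :: "real ^ 'n::finite \<Rightarrow> complex"
  assumes "littlewood_paley \<phi>" "c \<noteq> 0"
  shows "(\<lambda>y. \<phi> (x + c *\<^sub>R y)) \<in> schwartz_infty"
proof (rule schwartz_inftyI)
  have \<phi>: "\<phi> \<in> schwartz_space" using assms by (simp add: littlewood_paley_def)
  then show "(\<lambda>y. \<phi> (x + c *\<^sub>R y)) \<in> schwartz_space" using assms by (intro schwartz_affine)
  show "0 < \<bar>c\<bar> / 2" using assms by simp
  fix \<xi> :: "real ^ 'n" assume "norm \<xi> < \<bar>c\<bar> / 2"
  then have "norm (\<xi> /\<^sub>R c) < 1/2" using assms by (simp add: field_simps)
  then show "fourier (\<lambda>y. \<phi> (x + c *\<^sub>R y)) \<xi> = 0"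
    using fourier_affine[OF schwartz_integrable[OF \<phi>] assms(2), of x \<xi>]
      littlewood_paley_fourier_eq_0[OF assms(1)] by simp
qed

text \<open>
  The order of growth of \<open>f (\<lambda>y. \<phi> (x + c y))\<close> in \<open>x\<close> depends on \<open>f\<close>.  The factor \<open>K\<close> compensates
  it and widens the spectrum from radius 2 to at most 3, whatever the order, so that all
  constants below are independent of \<open>f\<close>.
\<close>

lemma localized_shift_series:
  fixes \<phi> :: "real ^ 'n::finite \<Rightarrow> complex"
  assumes lp: "littlewood_paley \<phi>" and f: "f \<in> schwartz_infty_dual" and c: "c \<noteq> 0"
  obtains K B where "continuous_on UNIV K" "K a = 1" "\<And>x. \<bar>K x\<bar> \<le> 1"
    "\<And>x. norm (of_real (K x) * f (\<lambda>y. \<phi> (x + c *\<^sub>R y))) \<le> B"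
    "\<And>x e t. norm e \<le> 1 \<Longrightarrow>
      (\<lambda>m. exp_arcsin_coeff (2 * \<i> * of_real t) m *
        (central_diff e ^^ m) (\<lambda>x. of_real (K x) * f (\<lambda>y. \<phi> (x + c *\<^sub>R y))) x)
      sums (of_real (K (t *\<^sub>R e + x)) * f (\<lambda>y. \<phi> (t *\<^sub>R e + x + c *\<^sub>R y)))"
proof -
  obtain F C where F: "finite F" and C: "0 \<le> C" and
    fb: "\<And>\<psi>. \<psi> \<in> schwartz_infty \<Longrightarrow> norm (f \<psi>) \<le> C * (\<Sum>(N, is)\<in>F. schwartz_seminorm N is \<psi>)"
    using schwartz_infty_dual_bound[OF f] by blast
  \<comment> \<open>The sum of the orders is a common upper bound for them, also when
    \<open>F\<close> is empty.\<close>
  define N where "N = (\<Sum>p\<in>F. fst p)"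
  have N: "P \<le> N" if "(P, is) \<in> F" for P "is"
    using member_le_sum[OF that, of fst] F by (simp add: N_def)
  \<comment> \<open>With this choice the kernel widens the spectrum by at most 1; the summand 1
    covers N = 0.\<close>
  define \<epsilon> where "\<epsilon> = 1 / (real N * real CARD('n) + 1)"
  have \<epsilon>: "0 < \<epsilon>" "real N * real CARD('n) * \<bar>\<epsilon>\<bar> \<le> 1"
  proof -
    have "0 < real N * real CARD('n) + 1" by (intro add_nonneg_pos) auto
    then show "0 < \<epsilon>" "real N * real CARD('n) * \<bar>\<epsilon>\<bar> \<le> 1"
      by (auto simp: \<epsilon>_def field_simps)
  qed
  define K where "K = sinc_kernel \<epsilon> N a"
  have \<phi>: "\<phi> \<in> schwartz_space" using lp by (simp add: littlewood_paley_def)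
  have f_add: "f (\<lambda>x. g x + h x) = f g + f h" if "g \<in> schwartz_infty" "h \<in> schwartz_infty" for g h
    using f that by (simp add: schwartz_infty_dual_def)
  have f_cmult: "f (\<lambda>x. k * g x) = k * f g" if "g \<in> schwartz_infty" for g k
    using f that by (simp add: schwartz_infty_dual_def)
  define E where "E x = (\<lambda>y. of_real (K x) * \<phi> (x + c *\<^sub>R y))" for x
  define H where "H x = f (E x)" for x
  have E: "E x \<in> schwartz_infty" for x
    unfolding E_def by (intro schwartz_infty_cmult littlewood_paley_translate_schwartz_infty lp c)
  have Heq: "H x = of_real (K x) * f (\<lambda>y. \<phi> (x + c *\<^sub>R y))" for x
    unfolding H_def E_def by (intro f_cmult littlewood_paley_translate_schwartz_infty lp c)
  define W where "W = (1 + norm a) ^ N * 2 ^ N * (1 + real CARD('n) ^ N / \<epsilon> ^ N)"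
  define b where "b P is = \<bar>c\<bar> ^ length is * (1 + 1 / \<bar>c\<bar>) ^ P * schwartz_seminorm P is \<phi>" for P "is"
  have b0: "0 \<le> b P is" for P "is"
    unfolding b_def by (intro mult_nonneg_nonneg schwartz_seminorm_nonneg[OF \<phi>]) auto
  have DE: "iter_partial_deriv is (E x) y =
      of_real (K x) * (of_real (c ^ length is) * iter_partial_deriv is \<phi> (x + c *\<^sub>R y))" for "is" x y
    unfolding E_def
    by (simp add: iter_partial_deriv_cmult smooth_affine iter_partial_deriv_affine schwartz_smooth[OF \<phi>])
  have EB: "(1 + norm y) ^ P * norm (iter_partial_deriv is (E x) y) \<le> W * b P is" if "P \<le> N" for P "is" x y
  proof -
    have "(1 + norm y) ^ P * norm (iter_partial_deriv is (E x) y) =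
        \<bar>K x\<bar> * ((1 + norm y) ^ P * norm (iter_partial_deriv is (\<lambda>y. \<phi> (x + c *\<^sub>R y)) y))"
      by (simp add: DE iter_partial_deriv_affine schwartz_smooth[OF \<phi>] norm_mult)
    also have "\<dots> \<le> \<bar>K x\<bar> * (\<bar>c\<bar> ^ length is * (1 + 1 / \<bar>c\<bar>) ^ P * (1 + norm x) ^ P * schwartz_seminorm P is \<phi>)"
      by (intro mult_left_mono schwartz_affine_bound \<phi> c) auto
    also have "\<dots> = ((1 + norm x) ^ P * \<bar>K x\<bar>) * b P is" by (simp add: b_def mult_ac)
    also have "\<dots> \<le> W * b P is"
      unfolding W_def K_def by (intro mult_right_mono sinc_kernel_weight \<epsilon> that b0)
    finally show ?thesis .
  qed
  define B where "B = C * (\<Sum>(P, is)\<in>F. W * b P is)"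
  have HB: "norm (H x) \<le> B" for x
  proof -
    have "norm (H x) \<le> C * (\<Sum>(P, is)\<in>F. schwartz_seminorm P is (E x))"
      unfolding H_def by (rule fb[OF E])
    also have "\<dots> \<le> B"
      unfolding B_def using C by (intro mult_left_mono sum_mono) (auto intro!: schwartz_seminorm_le EB dest: N)
    finally show ?thesis .
  qed
  have series: "(\<lambda>m. exp_arcsin_coeff (2 * \<i> * of_real t) m * (central_diff e ^^ m) H x) sums H (t *\<^sub>R e + x)"
    if e: "norm e \<le> 1" for x e t
  proof -
    define q where "q = exp_arcsin_coeff (2 * \<i> * of_real t)"
    have q: "summable (\<lambda>m. norm (q m))" unfolding q_def by (rule exp_arcsin_coeff_abs_summable)
    define T where "T k = (\<Sum>m. norm (q (m + k)))" for k
    have Tlim: "T \<longlonglongrightarrow> 0" unfolding T_def by (rule suminf_exist_split2[OF q])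
    define \<psi> where "\<psi> k = (\<lambda>y. E (t *\<^sub>R e + x) y - (\<Sum>m<k. q m * (central_diff e ^^ m) (\<lambda>x. E x y) x))" for k
    have \<psi>: "\<psi> k \<in> schwartz_infty" and f\<psi>: "f (\<psi> k) = H (t *\<^sub>R e + x) - (\<Sum>m<k. q m * (central_diff e ^^ m) H x)" for k
      using linear_central_diff_sum[of f E, OF f_add f_cmult E] unfolding \<psi>_def H_def by blast+
    \<comment> \<open>Evaluating a derivative at a fixed \<open>y\<close> is linear on test
      functions, and applied to \<open>E x\<close> it gives a band-limited function \<open>G\<close>
      of the parameter x, so the series for integrable functions controls the remainder. The bound
      is uniform in \<open>y\<close>, hence one for a seminorm of \<open>\<psi> k\<close>.\<close>
    have tail: "(1 + norm y) ^ P * norm (iter_partial_deriv is (\<psi> k) y) \<le> (W * b P is) * T k"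
      if P: "P \<le> N" for P "is" k y
    proof -
      define L where "L g = iter_partial_deriv is g y" for g
      define G where "G x = L (E x)" for x
      have "L (\<lambda>y. g y + h y) = L g + L h" if "g \<in> schwartz_infty" "h \<in> schwartz_infty" for g h
        using that by (simp add: L_def iter_partial_deriv_add schwartz_smooth schwartz_infty_def)
      moreover have "L (\<lambda>y. k * g y) = k * L g" if "g \<in> schwartz_infty" for g k
        using that by (simp add: L_def iter_partial_deriv_cmult schwartz_smooth schwartz_infty_def)
      ultimately have L\<psi>: "L (\<psi> k) = G (t *\<^sub>R e + x) - (\<Sum>m<k. q m * (central_diff e ^^ m) G x)"
        using linear_central_diff_sum[of L E, OF _ _ E] unfolding \<psi>_def G_def by blast
      define D where "D = iter_partial_deriv is \<phi>"
      have D: "D \<in> schwartz_space" unfolding D_def by (rule schwartz_iter_partial_deriv[OF \<phi>])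
      have "fourier D \<xi> = 0" if "2 < norm \<xi>" for \<xi>
        unfolding D_def
        by (intro fourier_iter_partial_deriv_eq_0 \<phi> littlewood_paley_fourier_eq_0 lp) (use that in simp)
      then have "band_limited 2 D"
        using schwartz_continuous[OF D] schwartz_integrable[OF D] by (simp add: band_limited_def)
      then have "band_limited (2 + real N * real CARD('n) * \<bar>\<epsilon>\<bar>)
          (\<lambda>x. of_real (K x) * (of_real (c ^ length is) * D (c *\<^sub>R y + x)))"
        unfolding K_def by (intro band_limited_sinc_kernel band_limited_cmult band_limited_shift)
      moreover have "(\<lambda>x. of_real (K x) * (of_real (c ^ length is) * D (c *\<^sub>R y + x))) = G"
        by (simp add: fun_eq_iff G_def L_def DE D_def add.commute)
      ultimately have G: "band_limited 3 G"
        using \<epsilon>(2) by (auto intro: band_limited_mono)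
      \<comment> \<open>A bound for \<open>G\<close> over all parameters. The weight at
        \<open>y\<close> is divided out here and multiplied back at the end.\<close>
      define \<beta> where "\<beta> = W * b P is / (1 + norm y) ^ P"
      have y0: "0 < (1 + norm y) ^ P"
        using add_pos_nonneg[OF zero_less_one norm_ge_zero[of y]] by simp
      have G\<beta>: "norm (G x) \<le> \<beta>" for x
        using EB[OF P, of y "is" x] y0 by (simp add: \<beta>_def G_def L_def pos_le_divide_eq mult.commute)
      have s: "(\<lambda>m. q m * (central_diff e ^^ m) G x) sums G (t *\<^sub>R e + x)"
        unfolding q_def by (rule shift_eq_central_diff_series[OF G G\<beta> e])
      have "norm (q m * (central_diff e ^^ m) G x) \<le> norm (q m) * \<beta>" for m
        unfolding norm_mult by (intro mult_left_mono norm_central_diff_power_le G\<beta>) auto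
      then have n: "norm (q (m + k) * (central_diff e ^^ (m + k)) G x) \<le> norm (q (m + k)) * \<beta>" for m
        by blast
      have sk: "summable (\<lambda>m. norm (q (m + k)))" using summable_ignore_initial_segment[OF q] .
      have sn: "summable (\<lambda>m. norm (q (m + k) * (central_diff e ^^ (m + k)) G x))"
        by (rule summable_comparison_test'[OF summable_mult2[OF sk, of \<beta>]]) (use n in simp)
      have "L (\<psi> k) = (\<Sum>m. q (m + k) * (central_diff e ^^ (m + k)) G x)"
        using sums_unique[OF sums_iff_shift'[THEN iffD2, OF s]] sums_split_initial_segment[OF s, of k]
        by (simp add: L\<psi> sums_iff)
      also have "norm \<dots> \<le> (\<Sum>m. norm (q (m + k) * (central_diff e ^^ (m + k)) G x))"
        by (rule summable_norm[OF sn])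
      also have "\<dots> \<le> (\<Sum>m. norm (q (m + k)) * \<beta>)"
        by (intro suminf_le n sn summable_mult2 sk)
      also have "\<dots> = \<beta> * T k" unfolding T_def by (subst suminf_mult2[OF sk, symmetric]) (rule mult.commute)
      finally show ?thesis using y0 by (simp add: L_def \<beta>_def field_simps)
    qed
    have "norm (f (\<psi> k)) \<le> B * T k" for k
    proof -
      have "norm (f (\<psi> k)) \<le> C * (\<Sum>(P, is)\<in>F. schwartz_seminorm P is (\<psi> k))" by (rule fb[OF \<psi>])
      also have "\<dots> \<le> C * (\<Sum>(P, is)\<in>F. (W * b P is) * T k)"
        using C by (intro mult_left_mono sum_mono) (auto intro!: schwartz_seminorm_le tail dest: N)
      also have "\<dots> = B * T k" by (simp add: B_def sum_distrib_right mult.assoc case_prod_unfold)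
      finally show ?thesis .
    qed
    moreover have "(\<lambda>k. B * T k) \<longlonglongrightarrow> 0" using tendsto_mult_right_zero[OF Tlim] by simp
    ultimately have "(\<lambda>k. f (\<psi> k)) \<longlonglongrightarrow> 0"
      by (intro Lim_null_comparison[of "\<lambda>k. f (\<psi> k)"] always_eventually) auto
    then have "(\<lambda>k. H (t *\<^sub>R e + x) - f (\<psi> k)) \<longlonglongrightarrow> H (t *\<^sub>R e + x) - 0"
      by (intro tendsto_intros)
    then show ?thesis by (simp add: f\<psi> sums_def q_def)
  qed
  show ?thesis
  proof (rule that[of K B, folded Heq])
    show "continuous_on UNIV K" "K a = 1" "\<bar>K x\<bar> \<le> 1" for x
      unfolding K_def by (rule continuous_on_sinc_kernel sinc_kernel_center abs_sinc_kernel_le_1)+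
  qed (rule HB, rule series)
qed

lemma localized_modulus_of_continuity:
  fixes \<phi> :: "real ^ 'n::finite \<Rightarrow> complex"
  assumes lp: "littlewood_paley \<phi>" and f: "f \<in> schwartz_infty_dual" and c: "c \<noteq> 0"
  obtains K B where "continuous_on UNIV K" "K a = 1" "\<And>x. \<bar>K x\<bar> \<le> 1"
    "\<And>x. norm (of_real (K x) * f (\<lambda>y. \<phi> (x + c *\<^sub>R y))) \<le> B"
    "\<forall>M x z. (\<forall>x. norm (of_real (K x) * f (\<lambda>y. \<phi> (x + c *\<^sub>R y))) \<le> M) \<longrightarrow>
      norm (of_real (K z) * f (\<lambda>y. \<phi> (z + c *\<^sub>R y)) - of_real (K x) * f (\<lambda>y. \<phi> (x + c *\<^sub>R y)))
        \<le> (exp (pi * norm (z - x)) - 1) * M"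
proof -
  obtain K B where
    K: "continuous_on UNIV K" "K a = 1" "\<And>x. \<bar>K x\<bar> \<le> 1" and
    B: "\<And>x. norm (of_real (K x) * f (\<lambda>y. \<phi> (x + c *\<^sub>R y))) \<le> B" and
    series: "\<And>x e t. norm e \<le> 1 \<Longrightarrow>
      (\<lambda>m. exp_arcsin_coeff (2 * \<i> * of_real t) m *
        (central_diff e ^^ m) (\<lambda>x. of_real (K x) * f (\<lambda>y. \<phi> (x + c *\<^sub>R y))) x)
      sums (of_real (K (t *\<^sub>R e + x)) * f (\<lambda>y. \<phi> (t *\<^sub>R e + x + c *\<^sub>R y)))"
    using localized_shift_series[OF assms, where a = a] by blast
  define H where "H x = of_real (K x) * f (\<lambda>y. \<phi> (x + c *\<^sub>R y))" for x
  have "norm (H z - H x) \<le> (exp (pi * norm (z - x)) - 1) * M" if M: "\<And>x. norm (H x) \<le> M" for M x z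
  proof -
    \<comment> \<open>For z = x the direction is \<open>sgn 0 = 0\<close>, which
      \<open>norm e \<le> 1\<close> admits.\<close>
    define t e where "t = norm (z - x)" and "e = sgn (z - x)"
    have e: "norm e \<le> 1" by (simp add: e_def norm_sgn)
    have z: "t *\<^sub>R e + x = z"
      by (cases "z = x") (simp_all add: t_def e_def sgn_div_norm)
    define q where "q = exp_arcsin_coeff (2 * \<i> * of_real t)"
    have q: "summable (\<lambda>m. norm (q m))" and qs: "(\<Sum>m. norm (q m)) \<le> exp (pi * t)"
      unfolding q_def using exp_arcsin_coeff_abs_summable[of "2 * \<i> * of_real t"]
      by (auto simp: norm_mult t_def mult.commute)
    have s: "(\<lambda>m. q m * (central_diff e ^^ m) H x) sums H z"
      using series[OF e, of t x] unfolding z unfolding q_def H_def[abs_def] .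
    have q1: "q 0 = 1" by (simp add: q_def)
    have s1: "(\<lambda>m. q (Suc m) * (central_diff e ^^ Suc m) H x) sums (H z - H x)"
      using s sums_Suc_iff[of "\<lambda>m. q m * (central_diff e ^^ m) H x" "H z - H x"] by (simp add: q1)
    have n: "norm (q (Suc m) * (central_diff e ^^ Suc m) H x) \<le> norm (q (Suc m)) * M" for m
      unfolding norm_mult by (intro mult_left_mono norm_central_diff_power_le M) auto
    have qS: "summable (\<lambda>m. norm (q (Suc m)))" using summable_ignore_initial_segment[OF q, of 1] by simp
    have sn: "summable (\<lambda>m. norm (q (Suc m) * (central_diff e ^^ Suc m) H x))"
      by (rule summable_comparison_test'[OF summable_mult2[OF qS, of M]]) (use n in simp)
    have "norm (H z - H x) \<le> (\<Sum>m. norm (q (Suc m) * (central_diff e ^^ Suc m) H x))"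
      using summable_norm[OF sn] by (simp only: sums_unique[OF s1])
    also have "\<dots> \<le> (\<Sum>m. norm (q (Suc m)) * M)"
      by (intro suminf_le n sn summable_mult2 qS)
    also have "\<dots> = ((\<Sum>m. norm (q m)) - 1) * M"
      using suminf_split_head[OF q] q1 by (simp add: suminf_mult2[OF qS, symmetric])
    also have "\<dots> \<le> (exp (pi * t) - 1) * M"
      using qs order_trans[OF norm_ge_zero M] by (intro mult_right_mono) auto
    finally show ?thesis by (simp add: t_def)
  qed
  then show ?thesis
    using that[of K B] K B unfolding H_def by blast
qed

text \<open>At \<open>a\<close> the localized product is continuous by its modulus of continuity,
  and K is continuous with value 1 there, so one may divide by K nearby.\<close>

lemma continuous_on_convolution:
  fixes \<phi> :: "real ^ 'n::finite \<Rightarrow> complex"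
  assumes lp: "littlewood_paley \<phi>" and f: "f \<in> schwartz_infty_dual" and c: "c \<noteq> 0"
  shows "continuous_on UNIV (\<lambda>x. f (\<lambda>y. \<phi> (x + c *\<^sub>R y)))"
proof (intro continuous_at_imp_continuous_on ballI)
  fix a :: "real ^ 'n"
  define G where "G x = f (\<lambda>y. \<phi> (x + c *\<^sub>R y))" for x
  obtain K B where K: "continuous_on UNIV K" "K a = 1" "\<And>x. \<bar>K x\<bar> \<le> 1" and
    B: "\<And>x. norm (of_real (K x) * G x) \<le> B" and
    mod: "\<forall>M x z. (\<forall>x. norm (of_real (K x) * G x) \<le> M) \<longrightarrow>
      norm (of_real (K z) * G z - of_real (K x) * G x) \<le> (exp (pi * norm (z - x)) - 1) * M"
    by (rule localized_modulus_of_continuity[OF assms, where a = a, folded G_def], rule that) assumption+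
  have "((\<lambda>z. (exp (pi * norm (z - a)) - 1) * B) \<longlongrightarrow> (exp (pi * norm (a - a)) - 1) * B) (at a)"
    by (intro tendsto_intros)
  then have "((\<lambda>z. (exp (pi * norm (z - a)) - 1) * B) \<longlongrightarrow> 0) (at a)" by simp
  then have "((\<lambda>z. of_real (K z) * G z - of_real (K a) * G a) \<longlongrightarrow> 0) (at a)"
    by (rule Lim_null_comparison[OF always_eventually, rotated]) (use mod B in blast)
  then have l1: "((\<lambda>z. of_real (K z) * G z) \<longlongrightarrow> of_real (K a) * G a) (at a)"
    by (simp only: LIM_zero_iff)
  have "isCont K a" using K(1) by (simp add: continuous_on_eq_continuous_at)
  then have l2: "(K \<longlongrightarrow> 1) (at a)" by (simp add: isCont_def K)
  have "((\<lambda>z. of_real (K z) * G z / of_real (K z)) \<longlongrightarrow> of_real (K a) * G a / of_real 1) (at a)"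
    by (intro tendsto_divide l1 tendsto_of_real l2) simp
  moreover have "\<forall>\<^sub>F z in at a. of_real (K z) * G z / of_real (K z) = G z"
    using order_tendstoD(1)[OF l2, of 0] by (auto elim: eventually_mono)
  ultimately have "(G \<longlongrightarrow> of_real (K a) * G a / of_real 1) (at a)"
    by (rule Lim_transform_eventually)
  then show "isCont (\<lambda>x. f (\<lambda>y. \<phi> (x + c *\<^sub>R y))) a"
    by (simp add: isCont_def K G_def[abs_def])
qed

text \<open>The centre \<open>u\<close> is a point where the localized product exceeds half its
  supremum and may be far from \<open>a\<close>. This does no harm, since the Besov-type norm takes
  the supremum over all cubes.\<close>

lemma convolution_large_on_ball:
  fixes \<phi> :: "real ^ 'n::finite \<Rightarrow> complex"
  assumes lp: "littlewood_paley \<phi>" and f: "f \<in> schwartz_infty_dual" and c: "c \<noteq> 0"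
  shows "\<exists>u. \<forall>z. norm (z - u) \<le> 1/20 \<longrightarrow>
    norm (f (\<lambda>y. \<phi> (a + c *\<^sub>R y))) \<le> 4 * norm (f (\<lambda>y. \<phi> (z + c *\<^sub>R y)))"
proof -
  define G where "G x = f (\<lambda>y. \<phi> (x + c *\<^sub>R y))" for x
  obtain K B where K: "continuous_on UNIV K" "K a = 1" "\<And>x. \<bar>K x\<bar> \<le> 1" and
    B: "\<And>x. norm (of_real (K x) * G x) \<le> B" and
    mod: "\<forall>M x z. (\<forall>x. norm (of_real (K x) * G x) \<le> M) \<longrightarrow>
      norm (of_real (K z) * G z - of_real (K x) * G x) \<le> (exp (pi * norm (z - x)) - 1) * M"
    by (rule localized_modulus_of_continuity[OF assms, where a = a, folded G_def], rule that) assumption+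
  define H where "H x = of_real (K x) * G x" for x
  define M where "M = (SUP x. norm (H x))"
  have bdd: "bdd_above (range (\<lambda>x. norm (H x)))" using B by (auto simp: bdd_above_def H_def)
  have HM: "norm (H x) \<le> M" for x unfolding M_def by (rule cSUP_upper[OF _ bdd]) simp
  have HG: "norm (H x) \<le> norm (G x)" for x
    using mult_right_mono[OF K(3)[of x] norm_ge_zero[of "G x"]] by (simp add: H_def norm_mult)
  have GM: "norm (G a) \<le> M" using HM[of a] by (simp add: H_def K)
  \<comment> \<open>The radius 1/20 ensures exp(pi / 20) <= exp(1/5) <= 5/4. An oscillation of at
    most M/4 below a value above M/2 leaves M/4, hence the factor 4.\<close>
  have e: "exp (pi * r) - 1 \<le> 1/4" if "0 \<le> r" "r \<le> 1/20" for r
  proof -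
    have "pi * r \<le> 4 * (1/20)" using that pi_less_4 by (intro mult_mono) auto
    then have "exp (pi * r) \<le> exp (1/5)" by simp
    also have "\<dots> \<le> 1 + 1/5 + (1/5)\<^sup>2" by (rule exp_bound) auto
    also have "\<dots> \<le> 5/4" by (simp add: power2_eq_square)
    finally show ?thesis by simp
  qed
  show ?thesis
  proof (cases "M = 0")
    case True then show ?thesis using GM by (simp add: G_def)
  next
    case False
    then have "M / 2 < M" using order_trans[OF norm_ge_zero GM] by simp
    then obtain u where u: "M / 2 < norm (H u)"
      using less_cSUP_iff[OF _ bdd, of "M / 2"] unfolding M_def[symmetric] by auto
    have "norm (G a) \<le> 4 * norm (G z)" if z: "norm (z - u) \<le> 1/20" for z
    proof -
      have "norm (H z - H u) \<le> (exp (pi * norm (z - u)) - 1) * M"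
        using mod HM by (simp add: H_def)
      also have "\<dots> \<le> 1/4 * M" using z order_trans[OF norm_ge_zero GM] by (intro mult_right_mono e) auto
      finally have "M / 4 \<le> norm (H z)" using u norm_triangle_ineq2[of "H u" "H z"] by (simp add: norm_minus_commute)
      then show ?thesis using HG[of z] GM by linarith
    qed
    then show ?thesis unfolding G_def by blast
  qed
qed

section \<open>Dyadic cubes and comparison of the norms\<close>

lemma dyadic_cube_measurable [measurable]: "dyadic_cube j k \<in> sets borel"
proof -
  have "dyadic_cube j k = {x. \<forall>i. 2 powi (- j) * of_int (k $ i) \<le> x $ i \<and> x $ i < 2 powi (- j) * (of_int (k $ i) + 1)}"
    using mem_dyadic_cube by blast
  then show ?thesis by simp
qed

lemma emeasure_dyadic_cube:
  fixes k :: "int ^ 'n::finite"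
  shows "emeasure lborel (dyadic_cube j k) = ennreal ((2 powi (- j)) ^ CARD('n))"
proof -
  define d where "d = (2 powi (- j) :: real)"
  have d: "0 < d" by (simp add: d_def)
  define a b where "a = (\<chi> i. d * of_int (k $ i))" and "b = (\<chi> i. d * (of_int (k $ i) + 1))"
  have "box a b \<subseteq> dyadic_cube j k" "dyadic_cube j k \<subseteq> cbox a b"
    by (auto simp: mem_dyadic_cube mem_box_cart a_def b_def d_def[symmetric] less_imp_le)
  then have "emeasure lborel (box a b) \<le> emeasure lborel (dyadic_cube j k)"
    "emeasure lborel (dyadic_cube j k) \<le> emeasure lborel (cbox a b)"
    by (auto intro!: emeasure_mono)
  moreover have le: "\<forall>i\<in>Basis. a \<bullet> i \<le> b \<bullet> i"
    using d by (auto simp: Basis_vec_def inner_axis a_def b_def)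
  have "cbox a b \<noteq> {}" using le by (auto simp: box_ne_empty)
  then have "measure lborel (cbox a b) = d ^ CARD('n)"
    by (subst content_cbox_if_cart) (auto simp: a_def b_def distrib_left)
  then have "emeasure lborel (cbox a b) = ennreal (d ^ CARD('n))"
    by (metis emeasure_eq_ennreal_measure emeasure_lborel_cbox_finite less_irrefl infinity_ennreal_def)
  moreover have "emeasure lborel (box a b) = emeasure lborel (cbox a b)"
    using le by (simp add: emeasure_lborel_box emeasure_lborel_cbox)
  ultimately show ?thesis by (simp add: d_def)
qed

lemma measure_dyadic_cube:
  "measure lborel (dyadic_cube j (k :: int ^ 'n::finite)) = (2 powi (- j)) ^ CARD('n)"
  by (simp add: measure_def emeasure_dyadic_cube)

lemma mem_dyadic_cube_floor: "x \<in> dyadic_cube j (\<chi> i. \<lfloor>2 powi j * x $ i\<rfloor>)"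
proof -
  have e: "2 powi (- j) * t = t / (2 powi j)" for t :: real
    by (simp add: power_int_minus divide_inverse)
  have "0 < (2 powi j :: real)" by simp
  then show ?thesis
    unfolding mem_dyadic_cube e
    by (auto simp: divide_le_eq less_divide_eq mult.commute)
qed

lemma dyadic_cube_nested:
  fixes x :: "real ^ 'n::finite"
  shows "dyadic_cube (j + int L) (\<chi> i. \<lfloor>2 powi (j + int L) * x $ i\<rfloor>) \<subseteq> dyadic_cube j (\<chi> i. \<lfloor>2 powi j * x $ i\<rfloor>)"
proof
  fix z
  assume z: "z \<in> dyadic_cube (j + int L) (\<chi> i. \<lfloor>2 powi (j + int L) * x $ i\<rfloor>)"
  define d where "d = (2 powi (- j) :: real)"
  have d: "0 < d" by (simp add: d_def)
  have e: "2 powi (- (j + int L)) = d / 2 ^ L" "2 powi (j + int L) = 2 ^ L / d" "2 powi j = 1 / d"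
    by (simp_all add: d_def power_int_add power_int_diff power_int_minus divide_inverse mult.commute)
  show "z \<in> dyadic_cube j (\<chi> i. \<lfloor>2 powi j * x $ i\<rfloor>)"
    unfolding mem_dyadic_cube
  proof (intro allI)
    fix i
    define t where "t = x $ i / d"
    define m where "m = \<lfloor>t\<rfloor>"
    define m' where "m' = \<lfloor>2 ^ L * t\<rfloor>"
    have m: "of_int m \<le> t" "t < of_int m + 1" unfolding m_def by linarith+
    have "2 ^ L * of_int m \<le> 2 ^ L * t" using m by (intro mult_left_mono) auto
    then have "of_int (2 ^ L * m) \<le> 2 ^ L * t" by simp
    then have l: "2 ^ L * m \<le> m'" unfolding m'_def by (simp only: le_floor_iff)
    have "2 ^ L * t < 2 ^ L * (of_int m + 1)" using m by (intro mult_strict_left_mono) auto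
    then have "2 ^ L * t < of_int (2 ^ L * (m + 1))" by simp
    then have "m' < 2 ^ L * (m + 1)" unfolding m'_def by (simp only: floor_less_iff)
    \<comment> \<open>Integrality turns the strict inequality into room for the whole half-open
      subcube.\<close>
    then have u: "m' + 1 \<le> 2 ^ L * (m + 1)" by simp
    have "d / 2 ^ L * of_int m' \<le> z $ i" "z $ i < d / 2 ^ L * (of_int m' + 1)"
      using z unfolding mem_dyadic_cube e m'_def t_def by (auto dest: spec[of _ i])
    moreover have "d * of_int m \<le> d / 2 ^ L * of_int m'"
    proof -
      have "d / 2 ^ L * of_int (2 ^ L * m) \<le> d / 2 ^ L * of_int m'"
        using l d by (intro mult_left_mono) (simp_all only: of_int_le_iff, simp)
      then show ?thesis by simp
    qed
    moreover have "d / 2 ^ L * (of_int m' + 1) \<le> d * (of_int m + 1)"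
    proof -
      have "d / 2 ^ L * of_int (m' + 1) \<le> d / 2 ^ L * of_int (2 ^ L * (m + 1))"
        using u d by (intro mult_left_mono) (simp_all only: of_int_le_iff, simp)
      then show ?thesis by simp
    qed
    ultimately show "2 powi (- j) * of_int ((\<chi> i. \<lfloor>2 powi j * x $ i\<rfloor>) $ i) \<le> z $ i \<and>
        z $ i < 2 powi (- j) * (of_int ((\<chi> i. \<lfloor>2 powi j * x $ i\<rfloor>) $ i) + 1)"
      by (simp add: e m_def t_def flip: d_def)
  qed
qed

lemma dyadic_cube_diameter:
  fixes x y :: "real ^ 'n::finite"
  assumes "x \<in> dyadic_cube j k" "y \<in> dyadic_cube j k"
  shows "norm (x - y) \<le> real CARD('n) * 2 powi (- j)"
proof -
  have "\<bar>(x - y) $ i\<bar> \<le> 2 powi (- j)" for i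
    using assms unfolding mem_dyadic_cube
    by (auto simp: abs_le_iff distrib_left dest!: spec[of _ i])
  then have "(\<Sum>i\<in>UNIV. \<bar>(x - y) $ i\<bar>) \<le> (\<Sum>i\<in>(UNIV::'n set). 2 powi (- j))"
    by (intro sum_mono)
  then show ?thesis using norm_le_l1_cart[of "x - y"] by simp
qed

section \<open>Quasi-norms over dyadic cubes\<close>

lemma lp_norm_infinity_UNIV:
  "lp_norm \<infinity> UNIV g = esssup lborel (\<lambda>x. ennreal (norm (g x)))"
proof -
  have "restrict_space lborel UNIV = (lborel :: (real ^ 'a) measure)"
    by (rule measure_eqI) (auto simp: sets_restrict_space emeasure_restrict_space)
  then show ?thesis by (simp add: lp_norm_def)
qed

text \<open>The prefactor turns the quasi-norm over the cube into a power mean, which is at most the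
  essential supremum. For p = infinity the exponent is 0 and the prefactor 1.\<close>

lemma lp_norm_le_esssup:
  fixes g :: "real ^ 'n::finite \<Rightarrow> complex"
  assumes g [measurable]: "g \<in> borel_measurable borel" and p: "0 < p"
  shows "ennreal (1 / measure lborel (dyadic_cube j k) powr recip_exponent p) * lp_norm p (dyadic_cube j k) g
    \<le> lp_norm \<infinity> UNIV g"
proof -
  let ?P = "dyadic_cube j k"
  define V where "V = measure lborel ?P"
  have V: "0 < V" "emeasure lborel ?P = ennreal V"
    by (simp_all add: V_def measure_dyadic_cube emeasure_dyadic_cube)
  define S where "S = esssup lborel (\<lambda>x. ennreal (norm (g x)))"
  have S: "lp_norm \<infinity> UNIV g = S" unfolding S_def by (rule lp_norm_infinity_UNIV)
  have AE: "AE x in lborel. ennreal (norm (g x)) \<le> S" unfolding S_def by (rule esssup_AE)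
  show ?thesis
  proof (cases "p = \<infinity>")
    case True
    have "esssup (restrict_space lborel ?P) (\<lambda>x. ennreal (norm (g x))) \<le> S"
    proof (rule esssup_I)
      show "AE x in restrict_space lborel ?P. ennreal (norm (g x)) \<le> S"
        using AE by (subst AE_restrict_space_iff) auto
    qed (auto intro!: measurable_restrict_space1)
    then show ?thesis
      unfolding S unfolding True using V by (simp add: lp_norm_def recip_exponent_def flip: V_def)
  next
    case False
    define q where "q = enn2real p"
    have q: "0 < q" using p False by (simp add: q_def enn2real_positive_iff less_top)
    define I where "I = (\<integral>\<^sup>+x\<in>?P. ennreal (norm (g x) powr q) \<partial>lborel)"
    have lp: "lp_norm p ?P g = (if I = \<infinity> then \<infinity> else ennreal (enn2real I powr (1 / q)))"
      using False by (simp add: lp_norm_def I_def q_def)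
    have r: "recip_exponent p = 1 / q" using False by (simp add: recip_exponent_def q_def)
    show ?thesis
    proof (cases S)
      case (real \<sigma>)
      have "I \<le> (\<integral>\<^sup>+x\<in>?P. ennreal (\<sigma> powr q) \<partial>lborel)"
        unfolding I_def
      proof (rule nn_integral_mono_AE)
        show "AE x in lborel. ennreal (norm (g x) powr q) * indicator ?P x \<le> ennreal (\<sigma> powr q) * indicator ?P x"
          using AE
        proof eventually_elim
          case (elim x)
          then have "norm (g x) \<le> \<sigma>" using real by simp
          then have "norm (g x) powr q \<le> \<sigma> powr q" using q by (intro powr_mono2) auto
          then show ?case by (intro mult_right_mono ennreal_leI) auto
        qed
      qed
      also have "\<dots> = ennreal (\<sigma> powr q * V)"
        using V by (simp add: nn_integral_cmult_indicator ennreal_mult)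
      finally have I: "I \<le> ennreal (\<sigma> powr q * V)" .
      then have Ifin: "I \<noteq> \<infinity>" by (auto simp: top_unique)
      have "enn2real I \<le> \<sigma> powr q * V" using V enn2real_mono[OF I] by simp
      then have "enn2real I powr (1 / q) \<le> (\<sigma> powr q * V) powr (1 / q)"
        using q by (intro powr_mono2) auto
      also have "\<dots> = \<sigma> * V powr (1 / q)" using real q V by (simp add: powr_mult powr_powr)
      finally have "1 / V powr (1 / q) * enn2real I powr (1 / q) \<le> \<sigma>"
        using V by (simp add: divide_le_eq)
      then show ?thesis
        unfolding S using Ifin V real by (simp add: lp r ennreal_mult[symmetric] ennreal_leI flip: V_def)
    qed (unfold S, simp)
  qed
qed

text \<open>The subcube is the fraction 2^(-L n) of the cube, so the lower bound gamma on it leaves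
  gamma times this fraction to the power 1/p in the mean. For p = infinity it matters only that the
  subcube has positive measure.\<close>

lemma norm_le_lp_norm:
  fixes g :: "real ^ 'n::finite \<Rightarrow> complex"
  assumes g [measurable]: "g \<in> borel_measurable borel" and p: "0 < p"
    and \<gamma>: "0 \<le> \<gamma>" and sub: "dyadic_cube (j + int L) k' \<subseteq> dyadic_cube j k"
    and large: "\<And>z. z \<in> dyadic_cube (j + int L) k' \<Longrightarrow> \<gamma> \<le> norm (g z)"
  shows "ennreal \<gamma> \<le> ennreal ((2 ^ (L * CARD('n))) powr recip_exponent p) *
    (ennreal (1 / measure lborel (dyadic_cube j k) powr recip_exponent p) * lp_norm p (dyadic_cube j k) g)"
proof -
  let ?P = "dyadic_cube j k" and ?Q = "dyadic_cube (j + int L) k'"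
  define V where "V = measure lborel ?P"
  define K where "K = (2 ^ (L * CARD('n)) :: real)"
  have K: "0 < K" by (simp add: K_def)
  have V: "0 < V" by (simp add: V_def measure_dyadic_cube)
  have "(2 powi (- (j + int L))) ^ CARD('n) = V / K"
    by (simp add: V_def K_def measure_dyadic_cube power_int_add power_int_diff power_int_minus power_mult power_divide divide_inverse
        power_mult_distrib power_inverse)
  then have Q: "emeasure lborel ?Q = ennreal (V / K)" by (simp only: emeasure_dyadic_cube)
  show ?thesis
  proof (cases "p = \<infinity>")
    case True
    define S where "S = esssup (restrict_space lborel ?P) (\<lambda>x. ennreal (norm (g x)))"
    have "AE x in restrict_space lborel ?P. ennreal (norm (g x)) \<le> S" unfolding S_def by (rule esssup_AE)
    then have AE: "AE x in lborel. x \<in> ?P \<longrightarrow> ennreal (norm (g x)) \<le> S"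
      by (subst (asm) AE_restrict_space_iff) auto
    have "ennreal \<gamma> \<le> S"
    proof (rule ccontr)
      assume "\<not> ennreal \<gamma> \<le> S"
      then have "AE x in lborel. x \<notin> ?Q"
        using AE by (elim eventually_mono) (metis sub large subsetD ennreal_leI order_trans)
      then have "emeasure lborel ?Q = 0" by (subst (asm) AE_iff_measurable[of ?Q]) auto
      then show False using V K by (simp add: Q)
    qed
    then show ?thesis using V K True by (simp add: lp_norm_def recip_exponent_def S_def flip: V_def K_def)
  next
    case False
    define q where "q = enn2real p"
    have q: "0 < q" using p False by (simp add: q_def enn2real_positive_iff less_top)
    define I where "I = (\<integral>\<^sup>+x\<in>?P. ennreal (norm (g x) powr q) \<partial>lborel)"
    have lp: "lp_norm p ?P g = (if I = \<infinity> then \<infinity> else ennreal (enn2real I powr (1 / q)))"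
      using False by (simp add: lp_norm_def I_def q_def)
    have r: "recip_exponent p = 1 / q" using False by (simp add: recip_exponent_def q_def)
    show ?thesis
    proof (cases "I = \<infinity>")
      case True
      then show ?thesis using V K by (simp add: lp r ennreal_mult_top flip: V_def K_def)
    next
      case False
      have "ennreal (\<gamma> powr q * (V / K)) = ennreal (\<gamma> powr q) * emeasure lborel ?Q"
        unfolding Q using V K by (intro ennreal_mult) auto
      also have "\<dots> = (\<integral>\<^sup>+x\<in>?Q. ennreal (\<gamma> powr q) \<partial>lborel)"
        by (intro nn_integral_cmult_indicator[symmetric]) simp
      also have "\<dots> \<le> I"
        unfolding I_def
      proof (rule nn_integral_mono)
        fix x
        show "ennreal (\<gamma> powr q) * indicator ?Q x \<le> ennreal (norm (g x) powr q) * indicator ?P x"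
          using sub large[of x] q \<gamma> by (auto simp: indicator_def intro!: ennreal_leI powr_mono2)
      qed
      finally have "\<gamma> powr q * (V / K) \<le> enn2real I"
        using False by (metis enn2real_ennreal enn2real_mono infinity_ennreal_def less_top V K divide_nonneg_nonneg less_imp_le mult_nonneg_nonneg powr_ge_zero)
      then have "(\<gamma> powr q * (V / K)) powr (1 / q) \<le> enn2real I powr (1 / q)"
        using q V K by (intro powr_mono2) auto
      moreover have "(\<gamma> powr q * (V / K)) powr (1 / q) = \<gamma> * V powr (1 / q) / K powr (1 / q)"
        using q V K \<gamma> by (simp add: powr_mult powr_powr powr_divide)
      ultimately have "\<gamma> * V powr (1 / q) / K powr (1 / q) \<le> enn2real I powr (1 / q)" by (simp only:)
      then have "\<gamma> \<le> K powr (1 / q) * (1 / V powr (1 / q) * enn2real I powr (1 / q))"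
        using V K by (simp add: field_simps)
      then show ?thesis
        using False V K by (simp add: lp r ennreal_mult[symmetric] ennreal_leI flip: V_def K_def)
    qed
  qed
qed

text \<open>The scale moves into the argument while phi stays fixed, so the results at unit
  frequency apply with c = -2^j at the point 2^j x.\<close>

lemma conv_dilate_eq:
  fixes \<phi> :: "real ^ 'n::finite \<Rightarrow> complex"
  assumes lp: "littlewood_paley \<phi>" and f: "f \<in> schwartz_infty_dual"
  shows "conv (dilate j \<phi>) f x =
    of_real (2 powi (j * int CARD('n))) * f (\<lambda>y. \<phi> ((2 powi j) *\<^sub>R x + (- (2 powi j)) *\<^sub>R y))"
proof -
  have "(\<lambda>y. \<phi> ((2 powi j) *\<^sub>R x + (- (2 powi j)) *\<^sub>R y)) \<in> schwartz_infty"
    by (rule littlewood_paley_translate_schwartz_infty[OF lp]) simp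
  then show ?thesis
    using f by (simp add: conv_def dilate_def schwartz_infty_dual_def scaleR_diff_right)
qed

text \<open>Almost everywhere bounds are passed on to the essential supremum for measurable
  functions.\<close>

lemma conv_dilate_measurable:
  fixes \<phi> :: "real ^ 'n::finite \<Rightarrow> complex"
  assumes lp: "littlewood_paley \<phi>" and f: "f \<in> schwartz_infty_dual"
  shows "conv (dilate j \<phi>) f \<in> borel_measurable borel"
proof -
  define G where "G x = f (\<lambda>y. \<phi> (x + (- (2 powi j)) *\<^sub>R y))" for x
  have "continuous_on UNIV G"
    unfolding G_def[abs_def] by (rule continuous_on_convolution[OF assms]) simp
  then have "continuous_on UNIV (\<lambda>x. G ((2 powi j) *\<^sub>R x))"
    by (rule continuous_on_compose2) (auto intro!: continuous_intros)
  then have "continuous_on UNIV (conv (dilate j \<phi>) f)"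
    using conv_dilate_eq[OF assms, of j] by (auto simp: G_def fun_eq_iff intro!: continuous_intros)
  then show ?thesis by (rule borel_measurable_continuous_onI)
qed

lemma conv_dilate_large_on_ball:
  fixes \<phi> :: "real ^ 'n::finite \<Rightarrow> complex"
  assumes lp: "littlewood_paley \<phi>" and f: "f \<in> schwartz_infty_dual"
  shows "\<exists>u. \<forall>z. norm (z - u) \<le> 2 powi (- j) / 20 \<longrightarrow>
    norm (conv (dilate j \<phi>) f a) \<le> 4 * norm (conv (dilate j \<phi>) f z)"
proof -
  define c where "c = (2 powi j :: real)"
  have c: "0 < c" "2 powi (- j) = 1 / c" by (simp_all add: c_def power_int_minus divide_inverse)
  from convolution_large_on_ball[OF assms, of "- c" "c *\<^sub>R a"] c(1) obtain v where
    v: "\<And>z. norm (z - v) \<le> 1/20 \<Longrightarrow>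
      norm (f (\<lambda>y. \<phi> (c *\<^sub>R a + (- c) *\<^sub>R y))) \<le> 4 * norm (f (\<lambda>y. \<phi> (z + (- c) *\<^sub>R y)))"
    by auto
  have "norm (conv (dilate j \<phi>) f a) \<le> 4 * norm (conv (dilate j \<phi>) f z)"
    if "norm (z - v /\<^sub>R c) \<le> 2 powi (- j) / 20" for z
  proof -
    have "c *\<^sub>R z - v = c *\<^sub>R (z - v /\<^sub>R c)" using c by (simp add: scaleR_diff_right)
    then have "norm (c *\<^sub>R z - v) = c * norm (z - v /\<^sub>R c)" using c by simp
    also have "\<dots> \<le> 1/20" using that c by (simp add: field_simps)
    finally have "norm (f (\<lambda>y. \<phi> (c *\<^sub>R a + (- c) *\<^sub>R y))) \<le> 4 * norm (f (\<lambda>y. \<phi> (c *\<^sub>R z + (- c) *\<^sub>R y)))"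
      by (rule v)
    from mult_left_mono[OF this, of "2 powi (j * int CARD('n))"] show ?thesis
      unfolding conv_dilate_eq[OF assms] c_def by (simp add: norm_mult)
  qed
  then show ?thesis by blast
qed

lemma besov_type_norm_le:
  fixes \<phi> :: "real ^ 'n::finite \<Rightarrow> complex"
  assumes lp: "littlewood_paley \<phi>" and f: "f \<in> schwartz_infty_dual" and p: "0 < p"
  shows "besov_type_norm \<phi> s (recip_exponent p) p f \<le> besov_infty_norm \<phi> s f"
  unfolding besov_type_norm_def
proof (rule SUP_least)
  fix P :: "(real ^ 'n) set" assume "P \<in> dyadic_cubes"
  then obtain i k where P: "P = dyadic_cube i k" by (auto simp: dyadic_cubes_def)
  show "ennreal (1 / measure lborel P powr recip_exponent p) *
      (SUP j\<in>{j. dyadic_level P \<le> real_of_int j}.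
        ennreal (2 powr (real_of_int j * s)) * lp_norm p P (conv (dilate j \<phi>) f)) \<le> besov_infty_norm \<phi> s f"
    unfolding SUP_mult_left_ennreal
  proof (rule SUP_least)
    fix j
    have "ennreal (1 / measure lborel P powr recip_exponent p) *
        (ennreal (2 powr (real_of_int j * s)) * lp_norm p P (conv (dilate j \<phi>) f)) =
        ennreal (2 powr (real_of_int j * s)) *
        (ennreal (1 / measure lborel P powr recip_exponent p) * lp_norm p P (conv (dilate j \<phi>) f))"
      by (rule mult.left_commute)
    also have "\<dots> \<le> ennreal (2 powr (real_of_int j * s)) * lp_norm \<infinity> UNIV (conv (dilate j \<phi>) f)"
      unfolding P by (intro mult_left_mono lp_norm_le_esssup conv_dilate_measurable lp f p) simp
    also have "\<dots> \<le> besov_infty_norm \<phi> s f"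
      unfolding besov_infty_norm_def by (rule SUP_upper) simp
    finally show "ennreal (1 / measure lborel P powr recip_exponent p) *
        (ennreal (2 powr (real_of_int j * s)) * lp_norm p P (conv (dilate j \<phi>) f)) \<le> besov_infty_norm \<phi> s f" .
  qed
qed

text \<open>The cube \<open>P\<close> of level j around \<open>u\<close> is tested at its lowest
  admissible level, j itself, and a subcube of fixed relative size lies in the ball where the piece
  is large. The constant 4 times 2^(L n / p) depends on the dimension and p only.\<close>

lemma besov_infty_norm_le:
  fixes \<phi> :: "real ^ 'n::finite \<Rightarrow> complex"
  assumes lp: "littlewood_paley \<phi>" and p: "0 < p"
  shows "\<exists>C>0. \<forall>f\<in>schwartz_infty_dual.
    besov_infty_norm \<phi> s f \<le> ennreal C * besov_type_norm \<phi> s (recip_exponent p) p f"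
proof -
  \<comment> \<open>A subcube of level j + L has diameter at most n 2^(-j-L); this \<open>L\<close>
    makes it fit into the ball of radius 2^(-j) / 20 around any of its points.\<close>
  obtain L where "real CARD('n) * 20 < 2 ^ L" using real_arch_pow[of 2] by auto
  then have L: "real CARD('n) / 2 ^ L \<le> 1 / 20" by (simp add: field_simps)
  define A where "A = (2 ^ (L * CARD('n)) :: real) powr recip_exponent p"
  have A: "0 < A" by (simp add: A_def)
  have "besov_infty_norm \<phi> s f \<le> ennreal (4 * A) * besov_type_norm \<phi> s (recip_exponent p) p f"
    if f: "f \<in> schwartz_infty_dual" for f
    unfolding besov_infty_norm_def
  proof (rule SUP_least)
    fix j :: int
    define g where "g = conv (dilate j \<phi>) f"
    define N where "N = besov_type_norm \<phi> s (recip_exponent p) p f"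
    define w where "w = 2 powr (real_of_int j * s)"
    have w: "0 < w" by (simp add: w_def)
    have g: "g \<in> borel_measurable borel" unfolding g_def by (rule conv_dilate_measurable[OF lp f])
    have bound: "ennreal w * ennreal (norm (g a)) \<le> ennreal (4 * A) * N" for a
    proof -
      obtain u where u: "\<And>z. norm (z - u) \<le> 2 powi (- j) / 20 \<Longrightarrow> norm (g a) \<le> 4 * norm (g z)"
        using conv_dilate_large_on_ball[OF lp f, of j a] unfolding g_def by blast
      define P where "P = dyadic_cube j (\<chi> i. \<lfloor>2 powi j * u $ i\<rfloor>)"
      define Q where "Q = dyadic_cube (j + int L) (\<chi> i. \<lfloor>2 powi (j + int L) * u $ i\<rfloor>)"
      have "norm (g a) / 4 \<le> norm (g z)" if "z \<in> Q" for z
      proof -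
        have "norm (z - u) \<le> real CARD('n) * 2 powi (- (j + int L))"
          using that unfolding Q_def by (rule dyadic_cube_diameter[OF _ mem_dyadic_cube_floor])
        also have "2 powi (- (j + int L)) = (2 powi (- j) :: real) / 2 ^ L"
          by (simp add: power_int_add power_int_diff power_int_minus divide_inverse)
        also have "real CARD('n) * (2 powi (- j) / 2 ^ L) = real CARD('n) / 2 ^ L * 2 powi (- j)" by simp
        also have "\<dots> \<le> 1 / 20 * 2 powi (- j)" by (intro mult_right_mono L) simp
        finally show ?thesis using u[of z] by simp
      qed
      then have "ennreal (norm (g a) / 4) \<le> ennreal A *
          (ennreal (1 / measure lborel P powr recip_exponent p) * lp_norm p P g)"
        unfolding A_def P_def Q_def
        by (intro norm_le_lp_norm[OF g p _ dyadic_cube_nested]) auto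
      then have "ennreal (4 * w) * ennreal (norm (g a) / 4) \<le> ennreal (4 * w) * (ennreal A *
          (ennreal (1 / measure lborel P powr recip_exponent p) * lp_norm p P g))"
        by (rule mult_left_mono) simp
      also have "\<dots> = ennreal (4 * A) *
          (ennreal (1 / measure lborel P powr recip_exponent p) * (ennreal w * lp_norm p P g))"
        using w A by (simp add: ennreal_mult mult_ac)
      also have "\<dots> \<le> ennreal (4 * A) * N"
      proof (intro mult_left_mono)
        have "ennreal w * lp_norm p P g \<le> (SUP j\<in>{j. dyadic_level P \<le> real_of_int j}.
            ennreal (2 powr (real_of_int j * s)) * lp_norm p P (conv (dilate j \<phi>) f))"
          unfolding w_def g_def by (rule SUP_upper) (simp add: P_def dyadic_level_dyadic_cube)
        then have "ennreal (1 / measure lborel P powr recip_exponent p) * (ennreal w * lp_norm p P g) \<le>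
            ennreal (1 / measure lborel P powr recip_exponent p) * (SUP j\<in>{j. dyadic_level P \<le> real_of_int j}.
            ennreal (2 powr (real_of_int j * s)) * lp_norm p P (conv (dilate j \<phi>) f))"
          by (rule mult_left_mono) simp
        also have "\<dots> \<le> N"
          unfolding N_def besov_type_norm_def by (rule SUP_upper) (auto simp: P_def dyadic_cubes_def)
        finally show "ennreal (1 / measure lborel P powr recip_exponent p) * (ennreal w * lp_norm p P g) \<le> N" .
      qed simp
      also have "ennreal (4 * w) * ennreal (norm (g a) / 4) = ennreal w * ennreal (norm (g a))"
        using w by (simp add: ennreal_mult[symmetric])
      finally show ?thesis .
    qed
    \<comment> \<open>The weight is positive and finite, so it is moved out of the essential
      supremum by dividing here and multiplying again below.\<close>
    have "esssup lborel (\<lambda>x. ennreal (norm (g x))) \<le> ennreal (1 / w) * (ennreal (4 * A) * N)"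
    proof (rule esssup_I)
      show "AE x in lborel. ennreal (norm (g x)) \<le> ennreal (1 / w) * (ennreal (4 * A) * N)"
      proof (intro AE_I2)
        fix x
        have "ennreal (norm (g x)) = ennreal (1 / w) * (ennreal w * ennreal (norm (g x)))"
          using w by (simp add: ennreal_mult[symmetric])
        also have "\<dots> \<le> ennreal (1 / w) * (ennreal (4 * A) * N)"
          by (intro mult_left_mono bound) simp
        finally show "ennreal (norm (g x)) \<le> ennreal (1 / w) * (ennreal (4 * A) * N)" .
      qed
    qed (use g in measurable)
    then have "ennreal w * esssup lborel (\<lambda>x. ennreal (norm (g x))) \<le>
        ennreal w * (ennreal (1 / w) * (ennreal (4 * A) * N))"
      by (rule mult_left_mono) simp
    also have "\<dots> = ennreal (4 * A) * N"
      using w by (simp add: ennreal_mult[symmetric] flip: mult.assoc)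
    finally show "ennreal (2 powr (real_of_int j * s)) * lp_norm \<infinity> UNIV (conv (dilate j \<phi>) f)
        \<le> ennreal (4 * A) * besov_type_norm \<phi> s (recip_exponent p) p f"
      unfolding lp_norm_infinity_UNIV by (simp add: g_def N_def w_def)
  qed
  then show ?thesis using A by (intro exI[of _ "4 * A"]) auto
qed

text \<open>Both estimates hold for every functional with values in [0, infinity], so finiteness of
  one norm entails that of the other and the spaces agree as sets. The constants are 1/C and
  1.\<close>

theorem corollary2:
  fixes \<phi> :: "real ^ 'n::finite \<Rightarrow> complex" and s :: real and p :: ennreal
  assumes "littlewood_paley \<phi>" and "0 < p"
  shows "besov_type_space \<phi> s (recip_exponent p) p = besov_infty_space \<phi> s \<and>
    (\<exists>c>0. \<exists>C>0. \<forall>f\<in>besov_infty_space \<phi> s.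
       ennreal c * besov_infty_norm \<phi> s f \<le> besov_type_norm \<phi> s (recip_exponent p) p f \<and>
       besov_type_norm \<phi> s (recip_exponent p) p f \<le> ennreal C * besov_infty_norm \<phi> s f)"
proof -
  let ?T = "besov_type_norm \<phi> s (recip_exponent p) p" and ?B = "besov_infty_norm \<phi> s"
  from besov_infty_norm_le[OF assms] obtain C where C: "0 < C"
    and BT: "\<And>f. f \<in> schwartz_infty_dual \<Longrightarrow> ?B f \<le> ennreal C * ?T f" by blast
  have TB: "?T f \<le> ?B f" if "f \<in> schwartz_infty_dual" for f
    by (rule besov_type_norm_le[OF assms(1) that assms(2)])
  have "?T f < \<infinity> \<longleftrightarrow> ?B f < \<infinity>" if "f \<in> schwartz_infty_dual" for f
    using TB[OF that] order.strict_trans1[OF BT[OF that]]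
    by (auto simp: ennreal_mult_less_top intro: order.strict_trans1)
  then have "besov_type_space \<phi> s (recip_exponent p) p = besov_infty_space \<phi> s"
    by (auto simp: besov_type_space_def besov_infty_space_def)
  moreover have "ennreal (1 / C) * ?B f \<le> ?T f" if "f \<in> schwartz_infty_dual" for f
  proof -
    have "ennreal (1 / C) * ?B f \<le> ennreal (1 / C) * (ennreal C * ?T f)"
      by (intro mult_left_mono BT that) simp
    also have "\<dots> = ?T f" using C by (simp add: ennreal_mult[symmetric] flip: mult.assoc)
    finally show ?thesis .
  qed
  ultimately show ?thesis
    using C TB by (intro conjI exI[of _ "1 / C"] exI[of _ 1]) (auto simp: besov_infty_space_def)
qed

end
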